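(* Let $E$, $\mathcal B$, $(P_t)_{t\ge0}$, $(U_\alpha)_{\alpha>0}$ and the right process $X$ be as in the context. Let $\beta>0$, $M\in\mathcal B$, let $\nu$ be a $\sigma$-finite measure on $(E,\mathcal B)$, and consider the measure $\nu_M:=\nu\circ\widehat{R_\beta^M}$. Then $\nu_M$ is carried by the fine closure of $M$, $\nu_M\circ U_\beta\le\nu\circ U_\beta$, and $$\nu_M\circ U_\beta=\nu\circ U_\beta\quad\text{on }M$$ (i.e. $\nu_M\circ U_\beta(F)=\nu\circ U_\beta(F)$ for all $F\in\mathcal B$, $F\subset M$).
   Context: $H$ is a separable real Hilbert space, continuously and densely embedded in a (separable real) Banach space $E$ with Borel $\sigma$-algebra $\mathcal B$. $(\nu_t)_{t\ge0}$ is a convolution semigroup of probability measures on $(E,\mathcal B)$, $P_tf(x)=\int_Ef(x+y)\nu_t(dy)$, $U_\alpha=\int_0^\infty e^{-\alpha t}P_t\,dt$. It is assumed that $(P_t)_{t\ge0}$ is the transition function of a right process $X=(\Omega,\mathcal F,\mathcal F_t,X_t,\theta_t,P^x)$ with state space $E$ (this holds for Brownian motion on an abstract Wiener space and for Lévy processes on Hilbert space). A $\mathcal B$-measurable $u:E\to[0,\infty]$ is $\mathcal U_\beta$-excessive if $\alpha U_{\beta+\alpha}u\le u$ for all $\alpha>0$ and $\alpha U_{\beta+\alpha}u\to u$ pointwise as $\alpha\to\infty$. The fine topology is the topology on $E$ generated by all $\mathcal U_\beta$-excessive functions. For $v$ $\mathcal U_\beta$-excessive, $R_\beta^Mv=\inf\{u\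 \mathcal U_\beta\text{-excessive}:u\ge v\text{ on }M\}$ and $\widehat{R_\beta^M}v=\sup_{\alpha>0}\alpha U_{\beta+\alpha}(R_\beta^Mv)$; the map $v\mapsto\widehat{R_\beta^M}v$ extends to a kernel on $E$, given by $\widehat{R_\beta^M}f(x)=E^x(e^{-\beta T_M}f(X_{T_M});T_M<\infty)$, $T_M=\inf\{t>0:X_t\in M\}$. For a measure $\nu$ and a kernel $N$, $\nu\circ N$ is the measure $A\mapsto\int_EN1_A\,d\nu$. *)

theory Defs
  imports "HOL-Probability.Probability"
begin

section \<open>Kernels\<close>

text \<open>
  A kernel is a measure-valued function. Some functions and kernels below are only universally
  measurable. This is harmless because \<open>nn_integral\<close> is a lower integral and agrees, for
  arbitrary integrands, with the integral over the completion (\<open>nn_integral_completion\<close>):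
  a universally measurable function is integrated as usual.
\<close>

definition universal_completion :: "'a measure \<Rightarrow> 'a measure" where
  "universal_completion S = sigma (space S)
     {A. A \<subseteq> space S \<and>
         (\<forall>\<mu>. prob_space \<mu> \<and> sets \<mu> = sets S \<longrightarrow> A \<in> sets (completion \<mu>))}"

definition is_kernel :: "'a measure \<Rightarrow> 'b measure \<Rightarrow> ('a \<Rightarrow> 'b measure) \<Rightarrow> bool" where
  "is_kernel S T K \<longleftrightarrow>
     (\<forall>x\<in>space S. sets (K x) = sets T) \<and>
     (\<forall>A\<in>sets T. (\<lambda>x. emeasure (K x) A) \<in> borel_measurable (universal_completion S))"

definition kernel_op :: "('a \<Rightarrow> 'b measure) \<Rightarrow> ('b \<Rightarrow> ennreal) \<Rightarrow> 'a \<Rightarrow> ennreal" where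
  "kernel_op K f x = (\<integral>\<^sup>+y. f y \<partial>K x)"

text \<open>The measure \<open>\<mu> \<circ> K\<close> on the measurable space \<open>T\<close>.\<close>

definition kernel_comp :: "'b measure \<Rightarrow> 'a measure \<Rightarrow> ('a \<Rightarrow> 'b measure) \<Rightarrow> 'b measure" where
  "kernel_comp T \<mu> K = measure_of (space T) (sets T) (\<lambda>A. \<integral>\<^sup>+x. emeasure (K x) A \<partial>\<mu>)"


section \<open>Convolution semigroups, excessive functions and balayage\<close>

text \<open>
  The library convolution is restricted to finite-dimensional spaces, so its defining formula is
  written out. Only indices \<open>t \<ge> 0\<close> are meaningful. Weak continuity is not required here; it follows
  from the right-continuity of the paths when the semigroup is the transition semigroup of a
  right process.
\<close>

definition convolution_semigroup ::
  "(real \<Rightarrow> 'e::{banach, second_countable_topology} measure) \<Rightarrow> bool" where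
  "convolution_semigroup \<nu> \<longleftrightarrow>
     (\<forall>t\<ge>0. prob_space (\<nu> t) \<and> sets (\<nu> t) = sets borel) \<and>
     \<nu> 0 = return borel 0 \<and>
     (\<forall>s\<ge>0. \<forall>t\<ge>0. distr (\<nu> s \<Otimes>\<^sub>M \<nu> t) borel (\<lambda>(x, y). x + y) = \<nu> (s + t))"

definition transition ::
  "(real \<Rightarrow> 'e::{banach, second_countable_topology} measure) \<Rightarrow> real \<Rightarrow> 'e \<Rightarrow> 'e measure" where
  "transition \<nu> t x = distr (\<nu> t) borel (\<lambda>y. x + y)"

definition resolvent ::
  "(real \<Rightarrow> 'e::{banach, second_countable_topology} measure) \<Rightarrow> real \<Rightarrow> 'e \<Rightarrow> 'e measure" where
  "resolvent \<nu> \<alpha> x = measure_of UNIV (sets borel)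
     (\<lambda>A. \<integral>\<^sup>+t\<in>{0..}. ennreal (exp (- \<alpha> * t)) * emeasure (transition \<nu> t x) A \<partial>lborel)"

definition excessive ::
  "(real \<Rightarrow> 'e::{banach, second_countable_topology} measure) \<Rightarrow> real \<Rightarrow> ('e \<Rightarrow> ennreal) \<Rightarrow> bool" where
  "excessive \<nu> \<beta> u \<longleftrightarrow>
     u \<in> borel_measurable borel \<and>
     (\<forall>\<alpha>>0. \<forall>x. ennreal \<alpha> * kernel_op (resolvent \<nu> (\<beta> + \<alpha>)) u x \<le> u x) \<and>
     (\<forall>x. ((\<lambda>\<alpha>. ennreal \<alpha> * kernel_op (resolvent \<nu> (\<beta> + \<alpha>)) u x) \<longlongrightarrow> u x) at_top)"

text \<open>The coarsest topology for which all excessive functions are continuous into \<open>[0, \<infinity>]\<close>.\<close>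

definition fine_topology ::
  "(real \<Rightarrow> 'e::{banach, second_countable_topology} measure) \<Rightarrow> real \<Rightarrow> 'e topology" where
  "fine_topology \<nu> \<beta> = topology_generated_by {u -` G | u G. excessive \<nu> \<beta> u \<and> open G}"

definition reduced ::
  "(real \<Rightarrow> 'e::{banach, second_countable_topology} measure) \<Rightarrow> real \<Rightarrow> 'e set \<Rightarrow>
     ('e \<Rightarrow> ennreal) \<Rightarrow> 'e \<Rightarrow> ennreal" where
  "reduced \<nu> \<beta> M v x = (INF u\<in>{u. excessive \<nu> \<beta> u \<and> (\<forall>y\<in>M. v y \<le> u y)}. u x)"

definition balayage ::
  "(real \<Rightarrow> 'e::{banach, second_countable_topology} measure) \<Rightarrow> real \<Rightarrow> 'e set \<Rightarrow>
     ('e \<Rightarrow> ennreal) \<Rightarrow> 'e \<Rightarrow> ennreal" where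
  "balayage \<nu> \<beta> M v x =
     (SUP \<alpha>\<in>{0<..}. ennreal \<alpha> * kernel_op (resolvent \<nu> (\<beta> + \<alpha>)) (reduced \<nu> \<beta> M v) x)"


section \<open>Right processes\<close>

text \<open>
  A right process with transition function \<open>(P\<^sub>t)\<close>, in the usual sense: normal, Markov, with
  right-continuous paths and shift operators, filtration satisfying the usual conditions relative
  to the laws \<open>P\<^sup>\<mu>\<close>, and excessive functions right-continuous along the paths. The strong Markov
  property is a consequence of these axioms and is not assumed. The path space \<open>\<Omega>\<close> is
  \<open>space F\<close>; only the \<open>\<sigma>\<close>-algebras of \<open>F\<close> and \<open>Ft t\<close> matter, and only times \<open>t \<ge> 0\<close>.
  No cemetery state is needed since \<open>P\<^sub>t 1 = 1\<close>.
\<close>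

locale right_process =
  fixes \<nu> :: "real \<Rightarrow> 'e::{banach, second_countable_topology} measure"
    and F :: "'w measure"
    and Ft :: "real \<Rightarrow> 'w measure"
    and X :: "real \<Rightarrow> 'w \<Rightarrow> 'e"
    and \<theta> :: "real \<Rightarrow> 'w \<Rightarrow> 'w"
    and P :: "'e \<Rightarrow> 'w measure"
  assumes prob: "prob_space (P x)"
    and P_kernel: "is_kernel borel F P"
    and Ft_space: "0 \<le> t \<Longrightarrow> space (Ft t) = space F"
    and Ft_subalgebra: "0 \<le> t \<Longrightarrow> sets (Ft t) \<subseteq> sets F"
    and Ft_mono: "0 \<le> s \<Longrightarrow> s \<le> t \<Longrightarrow> sets (Ft s) \<subseteq> sets (Ft t)"
    and Ft_right_continuous: "0 \<le> t \<Longrightarrow> (\<Inter>s\<in>{t<..}. sets (Ft s)) \<subseteq> sets (Ft t)"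
    and F_complete:
      "A \<subseteq> space F \<Longrightarrow>
       (\<forall>\<mu>. prob_space \<mu> \<and> sets \<mu> = sets borel \<longrightarrow> A \<in> sets (completion (kernel_comp F \<mu> P))) \<Longrightarrow>
       A \<in> sets F"
    and Ft_augmented:
      "0 \<le> t \<Longrightarrow> A \<subseteq> space F \<Longrightarrow>
       (\<forall>\<mu>. prob_space \<mu> \<and> sets \<mu> = sets borel \<longrightarrow>
         A \<in> sigma_sets (space F) (sets (Ft t) \<union> null_sets (completion (kernel_comp F \<mu> P)))) \<Longrightarrow>
       A \<in> sets (Ft t)"
    and adapted: "0 \<le> t \<Longrightarrow> X t \<in> borel_measurable (Ft t)"
    and paths_right_continuous:
      "\<omega> \<in> space F \<Longrightarrow> 0 \<le> t \<Longrightarrow> continuous (at_right t) (\<lambda>s. X s \<omega>)"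
    and shift_space: "\<omega> \<in> space F \<Longrightarrow> 0 \<le> t \<Longrightarrow> \<theta> t \<omega> \<in> space F"
    and shift: "\<omega> \<in> space F \<Longrightarrow> 0 \<le> s \<Longrightarrow> 0 \<le> t \<Longrightarrow> X s (\<theta> t \<omega>) = X (s + t) \<omega>"
    and normal: "AE \<omega> in P x. X 0 \<omega> = x"
    and markov:
      "0 \<le> s \<Longrightarrow> 0 \<le> t \<Longrightarrow> A \<in> sets (Ft s) \<Longrightarrow> B \<in> sets borel \<Longrightarrow>
       emeasure (P x) {\<omega> \<in> A. X (s + t) \<omega> \<in> B} =
         (\<integral>\<^sup>+\<omega>\<in>A. emeasure (transition \<nu> t (X s \<omega>)) B \<partial>P x)"
    and excessive_right_continuous:
      "0 < \<alpha> \<Longrightarrow> excessive \<nu> \<alpha> u \<Longrightarrow>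
       AE \<omega> in P x. \<forall>t\<ge>0. continuous (at_right t) (\<lambda>s. u (X s \<omega>))"

definition hitting_time :: "(real \<Rightarrow> 'w \<Rightarrow> 'e) \<Rightarrow> 'e set \<Rightarrow> 'w \<Rightarrow> ereal" where
  "hitting_time X M \<omega> = (INF t\<in>{t. 0 < t \<and> X t \<omega> \<in> M}. ereal t)"

definition hitting_op ::
  "(real \<Rightarrow> 'w \<Rightarrow> 'e) \<Rightarrow> ('e \<Rightarrow> 'w measure) \<Rightarrow> real \<Rightarrow> 'e set \<Rightarrow> ('e \<Rightarrow> ennreal) \<Rightarrow> 'e \<Rightarrow> ennreal" where
  "hitting_op X P \<beta> M f x =
     (\<integral>\<^sup>+\<omega>. (if hitting_time X M \<omega> < \<infinity>
            then (let T = real_of_ereal (hitting_time X M \<omega>)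
                  in ennreal (exp (- \<beta> * T)) * f (X T \<omega>))
            else 0) \<partial>P x)"

text \<open>
  The kernel extending \<open>v \<mapsto> balayage \<nu> \<beta> M v\<close> from the excessive functions to all
  nonnegative Borel functions, given by the hitting distribution. There is at most one such kernel;
  its existence is Hunt's theorem. As usual it is a kernel from the universally
  measurable sets to the Borel sets.
\<close>

definition balayage_kernel ::
  "(real \<Rightarrow> 'e::{banach, second_countable_topology} measure) \<Rightarrow> (real \<Rightarrow> 'w \<Rightarrow> 'e) \<Rightarrow>
     ('e \<Rightarrow> 'w measure) \<Rightarrow> real \<Rightarrow> 'e set \<Rightarrow> ('e \<Rightarrow> 'e measure) \<Rightarrow> bool" where
  "balayage_kernel \<nu> X P \<beta> M N \<longleftrightarrow>
     is_kernel borel borel N \<and>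
     (\<forall>v. excessive \<nu> \<beta> v \<longrightarrow> kernel_op N v = balayage \<nu> \<beta> M v) \<and>
     (\<forall>f\<in>borel_measurable borel. kernel_op N f = hitting_op X P \<beta> M f)"

end

theory Submission
  imports Defs
begin

text \<open>
  Write \<open>U\<close> for \<open>U\<^sub>\<beta>\<close>. A potential \<open>U 1\<^sub>A\<close> is excessive, hence \<open>N (U 1\<^sub>A)\<close> is its balayage, which is at most
  \<open>U 1\<^sub>A\<close>; integrating with respect to \<open>\<mu>\<close> gives the inequality. For \<open>A \<subseteq> M\<close> the domination principle
  says that an excessive function that dominates \<open>U 1\<^sub>A\<close> on \<open>A\<close> dominates it everywhere, so
  \<open>U 1\<^sub>A\<close> coincides with its balayage. The domination principle follows from the resolvent equation
  and from \<open>\<alpha> U\<^sub>\<alpha> 1\<^sub>G \<longrightarrow> 1\<close> on open sets \<open>G\<close>.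

  For the carrier, let \<open>T\<close> be the hitting time of \<open>M\<close>. By measurable projection \<open>T\<close> is a stopping time. If
  \<open>X\<^sub>T \<notin> M\<close>, then \<open>M\<close> is hit again immediately after \<open>T\<close>, so \<open>X\<^sub>T\<close> is regular for \<open>M\<close> by the strong Markov
  property; the latter holds since \<open>P\<^sub>t\<close> preserves bounded continuous functions. Finally, regular points of \<open>M\<close>
  belong to its fine closure, as excessive functions are right-continuous along the paths. The regular points
  form a universally measurable set, which is what makes the exceptional set \<open>\<mu>\<^sub>M\<close>-null.
\<close>

section \<open>Measurable projection\<close>

text \<open>Measurability shapes most of the work. The hitting time of a Borel set is controlled
  only up to completion, so each event about it is enclosed, for one finite measure at a time,
  between sets of the original sigma-algebra. The irregular points form a universally measurable
  set, while \<open>kernel_comp borel \<mu> N\<close> need not be sigma-finite (one point may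
  receive infinite mass). They are therefore enclosed with respect to a finite measure obtained from
  a positive integrable density of \<open>\<mu>\<close>, and null sets are carried back. The
  resolvent can be iterated only once \<open>P\<^sub>t f x\<close> is jointly measurable in
  \<open>(t, x)\<close>. By translation invariance it is the expectation of
  \<open>f (x + X\<^sub>t)\<close> under \<open>P 0\<close>, a single probability space with
  right-continuous paths. The domination principle is proved analytically. Potentials of indicators
  are bounded, so terms cancel in \<open>ennreal\<close>. A Borel set must be enlarged to an open
  one, since \<open>\<alpha> U\<^sub>\<alpha> 1\<^sub>A\<close> need not tend to 1 on
  \<open>A\<close>.\<close>

definition closed_sections :: "'w measure \<Rightarrow> ('w \<Rightarrow> real set) \<Rightarrow> bool" where
  "closed_sections m k \<longleftrightarrow> simple_function m k \<and> (\<forall>\<omega>\<in>space m. closed (k \<omega>))"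

lemma closed_sections_Un:
  assumes "closed_sections m k" "closed_sections m l"
  shows "closed_sections m (\<lambda>\<omega>. k \<omega> \<union> l \<omega>)"
  using assms simple_function_compose2[of m k l "(\<union>)"] by (auto simp: closed_sections_def)

lemma closed_sections_Int:
  assumes "closed_sections m k" "closed_sections m l"
  shows "closed_sections m (\<lambda>\<omega>. k \<omega> \<inter> l \<omega>)"
  using assms simple_function_compose2[of m k l "(\<inter>)"] by (auto simp: closed_sections_def)

lemma closed_sections_const: "closed K \<Longrightarrow> closed_sections m (\<lambda>\<omega>. K)"
  by (auto simp: closed_sections_def)

lemma closed_sections_UN:
  assumes "finite I" "\<And>i. i \<in> I \<Longrightarrow> closed_sections m (k i)"
  shows "closed_sections m (\<lambda>\<omega>. \<Union>i\<in>I. k i \<omega>)"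
  using assms
proof (induction I rule: finite_induct)
  case empty
  then show ?case by (simp add: closed_sections_const)
next
  case (insert x F)
  then show ?case using closed_sections_Un[of m "k x" "\<lambda>\<omega>. \<Union>i\<in>F. k i \<omega>"] by simp
qed

lemma closed_sections_INT_atMost:
  assumes "\<And>j. closed_sections m (k j)"
  shows "closed_sections m (\<lambda>\<omega>. \<Inter>j\<in>{..n::nat}. k j \<omega>)"
proof (induction n)
  case 0
  have "(\<lambda>\<omega>. \<Inter>j\<in>{..0::nat}. k j \<omega>) = k 0" by auto
  then show ?case using assms by simp
next
  case (Suc n)
  have "(\<lambda>\<omega>. \<Inter>j\<in>{..Suc n}. k j \<omega>) = (\<lambda>\<omega>. k (Suc n) \<omega> \<inter> (\<Inter>j\<in>{..n}. k j \<omega>))"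
    by (auto simp: atMost_Suc)
  then show ?case using closed_sections_Int[OF assms[of "Suc n"] Suc] by simp
qed

lemma closed_sections_if:
  assumes "B \<in> sets m"
  shows "closed_sections m (\<lambda>\<omega>. if \<omega> \<in> B then UNIV else {})"
proof -
  have "simple_function m (\<lambda>\<omega>. if \<omega> \<in> B then UNIV else ({} :: real set))"
    using assms by (intro simple_function_If_set) auto
  then show ?thesis by (auto simp: closed_sections_def)
qed

text \<open>The finitely many values of a simple function make this projection elementary;
  difficulties arise only when infinitely many stages are intersected.\<close>

lemma closed_sections_projection:
  assumes "closed_sections m k"
  shows "{\<omega>\<in>space m. k \<omega> \<noteq> {}} \<in> sets m"
proof -
  have "k -` (-{{}}) \<inter> space m \<in> sets m"
    using assms simple_functionD(2) by (auto simp: closed_sections_def)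
  also have "k -` (-{{}}) \<inter> space m = {\<omega>\<in>space m. k \<omega> \<noteq> {}}" by auto
  finally show ?thesis .
qed

text \<open>
  The Souslin operation applied to sets with \<open>closed_sections\<close>. The function \<open>f\<close> says
  that \<open>S \<alpha> j\<close> depends only on the entries of \<open>\<alpha>\<close> up to \<open>f j\<close>.
\<close>

definition souslin_scheme ::
  "'w measure \<Rightarrow> ((nat \<Rightarrow> nat) \<Rightarrow> nat \<Rightarrow> 'w \<Rightarrow> real set) \<Rightarrow> (nat \<Rightarrow> nat) \<Rightarrow> bool" where
  "souslin_scheme m S f \<longleftrightarrow> (\<forall>\<alpha> j. closed_sections m (S \<alpha> j)) \<and>
     (\<forall>\<alpha> \<alpha>' j. (\<forall>i\<le>f j. \<alpha> i = \<alpha>' i) \<longrightarrow> S \<alpha> j = S \<alpha>' j)"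

definition souslin :: "'w measure \<Rightarrow> (real \<times> 'w) set \<Rightarrow> bool" where
  "souslin m A \<longleftrightarrow> (\<exists>S f. souslin_scheme m S f \<and>
     A = {(t, \<omega>). \<omega> \<in> space m \<and> (\<exists>\<alpha>. \<forall>j. t \<in> S \<alpha> j \<omega>)})"

lemma souslin_closed_sections:
  assumes "closed_sections m k"
  shows "souslin m {(t, \<omega>). \<omega> \<in> space m \<and> t \<in> k \<omega>}"
  unfolding souslin_def souslin_scheme_def
  using assms by (intro exI[of _ "\<lambda>_ _. k"] exI[of _ "\<lambda>_. 0"]) auto

lemma souslin_UN:
  assumes "\<And>n::nat. souslin m (A n)"
  shows "souslin m (\<Union>n. A n)"
proof -
  have "\<forall>n. \<exists>S f. souslin_scheme m S f \<and> A n = {(t, \<omega>). \<omega> \<in> space m \<and> (\<exists>\<alpha>. \<forall>j. t \<in> S \<alpha> j \<omega>)}"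
    using assms unfolding souslin_def by blast
  then obtain S f where Sf: "\<And>n. souslin_scheme m (S n) (f n)"
    and A: "\<And>n. A n = {(t, \<omega>). \<omega> \<in> space m \<and> (\<exists>\<alpha>. \<forall>j. t \<in> S n \<alpha> j \<omega>)}"
    unfolding choice_iff by blast
  text \<open>The entry \<open>\<alpha> 0\<close> selects \<open>n\<close>. Stage \<open>j\<close> of the scheme for \<open>A n\<close> is placed at
    \<open>prod_encode (n, j)\<close> because the dependence bounds \<open>f n\<close> need not be uniform in \<open>n\<close>.\<close>
  define U where "U \<alpha> j = (if fst (prod_decode j) = \<alpha> 0
      then S (fst (prod_decode j)) (\<alpha> \<circ> Suc) (snd (prod_decode j)) else (\<lambda>_. UNIV))" for \<alpha> j
  define g where "g j = Suc (f (fst (prod_decode j)) (snd (prod_decode j)))" for j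
  have "souslin_scheme m U g"
    unfolding souslin_scheme_def
  proof (intro conjI allI impI)
    show "closed_sections m (U \<alpha> j)" for \<alpha> j
      using Sf by (auto simp: U_def souslin_scheme_def closed_sections_const)
    show "U \<alpha> j = U \<alpha>' j" if "\<forall>i\<le>g j. \<alpha> i = \<alpha>' i" for \<alpha> \<alpha>' j
    proof -
      have "S (fst (prod_decode j)) (\<alpha> \<circ> Suc) (snd (prod_decode j)) =
            S (fst (prod_decode j)) (\<alpha>' \<circ> Suc) (snd (prod_decode j))"
        using Sf[of "fst (prod_decode j)"] that unfolding souslin_scheme_def g_def by simp
      moreover have "\<alpha> 0 = \<alpha>' 0" using that by (simp add: g_def)
      ultimately show ?thesis unfolding U_def by (simp only:)
    qed
  qed
  moreover have "(\<Union>n. A n) = {(t, \<omega>). \<omega> \<in> space m \<and> (\<exists>\<alpha>. \<forall>j. t \<in> U \<alpha> j \<omega>)}"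
  proof (intro set_eqI iffI; clarsimp simp: A)
    fix t \<omega> n \<alpha> assume t: "\<forall>j. t \<in> S n \<alpha> j \<omega>"
    have "case_nat n \<alpha> \<circ> Suc = \<alpha>" by auto
    then show "\<exists>\<alpha>. \<forall>j. t \<in> U \<alpha> j \<omega>"
      using t by (intro exI[of _ "case_nat n \<alpha>"]) (auto simp: U_def)
  next
    fix t \<omega> \<alpha> assume t: "\<forall>j. t \<in> U \<alpha> j \<omega>"
    have "t \<in> S (\<alpha> 0) (\<alpha> \<circ> Suc) j \<omega>" for j
      using t[rule_format, of "prod_encode (\<alpha> 0, j)"] by (simp add: U_def)
    then show "\<exists>n \<alpha>. \<forall>j. t \<in> S n \<alpha> j \<omega>" by blast
  qed
  ultimately show ?thesis unfolding souslin_def by blast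
qed

text \<open>One sequence codes countably many: its entries at \<open>prod_encode (n, i)\<close> feed
  the scheme for \<open>A n\<close>. Each stage still reads finitely many entries, and
  \<open>g\<close> bounds their codes.\<close>

lemma souslin_INT:
  assumes "\<And>n::nat. souslin m (A n)"
  shows "souslin m (\<Inter>n. A n)"
proof -
  have "\<forall>n. \<exists>S f. souslin_scheme m S f \<and> A n = {(t, \<omega>). \<omega> \<in> space m \<and> (\<exists>\<alpha>. \<forall>j. t \<in> S \<alpha> j \<omega>)}"
    using assms unfolding souslin_def by blast
  then obtain S f where Sf: "\<And>n. souslin_scheme m (S n) (f n)"
    and A: "\<And>n. A n = {(t, \<omega>). \<omega> \<in> space m \<and> (\<exists>\<alpha>. \<forall>j. t \<in> S n \<alpha> j \<omega>)}"
    unfolding choice_iff by blast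
  define U where "U \<alpha> j = S (fst (prod_decode j)) (\<lambda>i. \<alpha> (prod_encode (fst (prod_decode j), i)))
      (snd (prod_decode j))" for \<alpha> j
  define g where "g j = Max ((\<lambda>i. prod_encode (fst (prod_decode j), i)) `
      {..f (fst (prod_decode j)) (snd (prod_decode j))})" for j
  have "souslin_scheme m U g"
    unfolding souslin_scheme_def
  proof (intro conjI allI impI)
    show "closed_sections m (U \<alpha> j)" for \<alpha> j
      using Sf by (auto simp: U_def souslin_scheme_def)
    show "U \<alpha> j = U \<alpha>' j" if "\<forall>i\<le>g j. \<alpha> i = \<alpha>' i" for \<alpha> \<alpha>' j
    proof -
      have "prod_encode (fst (prod_decode j), i) \<le> g j"
        if "i \<le> f (fst (prod_decode j)) (snd (prod_decode j))" for i
        unfolding g_def using that by (intro Max_ge) auto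
      then show ?thesis
        using Sf[of "fst (prod_decode j)"] that unfolding souslin_scheme_def U_def by simp
    qed
  qed
  moreover have "(\<Inter>n. A n) = {(t, \<omega>). \<omega> \<in> space m \<and> (\<exists>\<alpha>. \<forall>j. t \<in> U \<alpha> j \<omega>)}"
  proof (intro set_eqI iffI)
    fix x assume x: "x \<in> (\<Inter>n. A n)"
    obtain t \<omega> where tw: "x = (t, \<omega>)" by (cases x)
    have "\<omega> \<in> space m" "\<forall>n. \<exists>\<alpha>. \<forall>j. t \<in> S n \<alpha> j \<omega>" using x unfolding tw A by auto
    then obtain \<alpha> where \<alpha>: "\<And>n j. t \<in> S n (\<alpha> n) j \<omega>" by metis
    have "\<exists>\<alpha>. \<forall>j. t \<in> U \<alpha> j \<omega>"
      using \<alpha> by (intro exI[of _ "\<lambda>i. case_prod \<alpha> (prod_decode i)"]) (auto simp: U_def)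
    then show "x \<in> {(t, \<omega>). \<omega> \<in> space m \<and> (\<exists>\<alpha>. \<forall>j. t \<in> U \<alpha> j \<omega>)}"
      using \<open>\<omega> \<in> space m\<close> tw by simp
  next
    fix x assume x: "x \<in> {(t, \<omega>). \<omega> \<in> space m \<and> (\<exists>\<alpha>. \<forall>j. t \<in> U \<alpha> j \<omega>)}"
    then obtain t \<omega> \<alpha> where tw: "x = (t, \<omega>)" "\<omega> \<in> space m" and t: "\<forall>j. t \<in> U \<alpha> j \<omega>"
      by auto
    have "t \<in> S n (\<lambda>i. \<alpha> (prod_encode (n, i))) j \<omega>" for n j
      using t[rule_format, of "prod_encode (n, j)"] by (simp add: U_def)
    then show "x \<in> (\<Inter>n. A n)" using tw unfolding A by blast
  qed
  ultimately show ?thesis unfolding souslin_def by blast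
qed

text \<open>Souslin sets are not closed under complements, so the argument runs over sets that are
  Souslin together with their complement. These form a sigma-algebra, and both coordinate maps are
  measurable for it.\<close>

lemma souslin_pair_measure:
  assumes "A \<in> sets (borel \<Otimes>\<^sub>M m)"
  shows "souslin m A"
proof -
  let ?O = "UNIV \<times> space m"
  define D where "D = {A. A \<subseteq> ?O \<and> souslin m A \<and> souslin m (?O - A)}"
  have O: "?O = {(t, \<omega>). \<omega> \<in> space m \<and> t \<in> UNIV}" by auto
  interpret D: sigma_algebra ?O D
    unfolding sigma_algebra_iff2
  proof (intro conjI allI impI ballI)
    show "D \<subseteq> Pow ?O" by (auto simp: D_def)
    have "{} = {(t, \<omega>). \<omega> \<in> space m \<and> t \<in> {}}" by auto
    then have "souslin m {}" using souslin_closed_sections[OF closed_sections_const[of "{}"]] by simp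
    moreover have "souslin m ?O"
      unfolding O by (rule souslin_closed_sections[OF closed_sections_const]) simp
    ultimately show "{} \<in> D" by (simp add: D_def)
    show "?O - s \<in> D" if "s \<in> D" for s
    proof -
      have "?O - (?O - s) = s" using that by (auto simp: D_def)
      then show ?thesis using that by (simp add: D_def)
    qed
    show "\<Union> (range A) \<in> D" if "range A \<subseteq> D" for A :: "nat \<Rightarrow> _"
    proof -
      have "?O - \<Union> (range A) = (\<Inter>n. ?O - A n)" by auto
      moreover have "A n \<subseteq> ?O" "souslin m (A n)" "souslin m (?O - A n)" for n
        using that by (auto simp: D_def)
      ultimately show ?thesis
        using souslin_UN[of m A] souslin_INT[of m "\<lambda>n. ?O - A n"]
        by (simp add: D_def UN_least)
    qed
  qed
  let ?D = "sigma ?O D"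
  have sets_D: "sets ?D = D" by (simp add: D.sets_measure_of_eq D.space_closed)
  have "fst \<in> ?D \<rightarrow>\<^sub>M borel"
  proof (rule borel_measurableI_le)
    fix a :: real
    have "{x \<in> space ?D. fst x \<le> a} = {(t, \<omega>). \<omega> \<in> space m \<and> t \<in> {..a}}"
      by (auto simp: space_measure_of_conv)
    moreover have "?O - {(t, \<omega>). \<omega> \<in> space m \<and> t \<in> {..a}} =
        (\<Union>n. {(t, \<omega>). \<omega> \<in> space m \<and> t \<in> {a + 1 / real (Suc n)..}})"
    proof -
      have "\<exists>n. a + 1 / real (Suc n) \<le> t" if "a < t" for t
        using that nat_approx_posE[of "t - a"] by (metis add.commute diff_gt_0_iff_gt le_diff_eq less_imp_le)
      moreover have "a < t" if "a + 1 / real (Suc n) \<le> t" for t n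
        using that by (smt (verit) of_nat_0_less_iff zero_less_Suc zero_less_divide_1_iff)
      ultimately have "\<not> t \<le> a \<longleftrightarrow> (\<exists>n. a + 1 / real (Suc n) \<le> t)" for t
        unfolding not_le by blast
      then show ?thesis by (intro set_eqI; case_tac x; simp del: of_nat_Suc; blast)
    qed
    moreover have cl: "souslin m {(t, \<omega>). \<omega> \<in> space m \<and> t \<in> K}" if "closed K" for K
      using souslin_closed_sections[OF closed_sections_const[OF that]] .
    ultimately have "{x \<in> space ?D. fst x \<le> a} \<in> D"
      unfolding D_def mem_Collect_eq by (simp only:)
        (intro conjI souslin_UN cl closed_atMost closed_atLeast, auto)
    then show "{x \<in> space ?D. fst x \<le> a} \<in> sets ?D" unfolding sets_D .
  qed
  moreover have "snd \<in> ?D \<rightarrow>\<^sub>M m"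
  proof (rule measurableI)
    fix B assume B: "B \<in> sets m"
    have 1: "snd -` C \<inter> space ?D = {(t, \<omega>). \<omega> \<in> space m \<and> t \<in> (if \<omega> \<in> C then UNIV else {})}" for C
      by (auto simp: space_measure_of_conv)
    have 2: "?O - {(t, \<omega>). \<omega> \<in> space m \<and> t \<in> (if \<omega> \<in> B then UNIV else {})} =
        {(t, \<omega>). \<omega> \<in> space m \<and> t \<in> (if \<omega> \<in> space m - B then UNIV else {})}"
      by (auto split: if_splits)
    have "snd -` B \<inter> space ?D \<in> D"
      unfolding 1 unfolding D_def mem_Collect_eq 2
      using B by (intro conjI souslin_closed_sections closed_sections_if) auto
    then show "snd -` B \<inter> space ?D \<in> sets ?D" unfolding sets_D .
  qed (auto simp: space_measure_of_conv)
  ultimately have "(\<lambda>x. (fst x, snd x)) \<in> ?D \<rightarrow>\<^sub>M borel \<Otimes>\<^sub>M m" by (rule measurable_Pair)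
  then have "(\<lambda>x. (fst x, snd x)) -` A \<inter> space ?D \<in> sets ?D"
    using assms by (rule measurable_sets)
  moreover have "(\<lambda>x. (fst x, snd x)) -` A \<inter> space ?D = A"
    using sets.sets_into_space[OF assms] by (auto simp: space_pair_measure space_measure_of_conv)
  ultimately have "A \<in> D" unfolding sets_D by simp
  then show ?thesis by (simp add: D_def)
qed

section \<open>Compactness and capacitability\<close>

text \<open>Koenig's lemma. The bounds \<open>n\<close> make the tree of prefixes finitely
  branching, so a prefix that extends to every depth has a one-step extension of the same kind. The
  limit of these prefixes works because stage \<open>j\<close> reads only the entries up to
  \<open>f j\<close>.\<close>

lemma souslin_scheme_koenig:
  assumes f: "\<And>\<alpha> \<alpha>' j. \<forall>i\<le>f j. \<alpha> i = \<alpha>' i \<Longrightarrow> Q \<alpha> j \<longleftrightarrow> Q \<alpha>' j"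
    and ex: "\<And>k::nat. \<exists>\<alpha>. (\<forall>i. \<alpha> i \<le> n i) \<and> (\<forall>j\<le>k. Q \<alpha> j)"
  shows "\<exists>\<alpha>::nat \<Rightarrow> nat. \<forall>j. Q \<alpha> j"
proof -
  define Good where "Good k p \<longleftrightarrow>
    (\<forall>K. \<exists>\<alpha>. (\<forall>i. \<alpha> i \<le> n i) \<and> (\<forall>i<k. \<alpha> i = p i) \<and> (\<forall>j\<le>K. Q \<alpha> j))" for k and p :: "nat \<Rightarrow> nat"
  have "\<exists>p. \<forall>k. Good k (p k) \<and> (\<forall>i<k. p (Suc k) i = p k i)"
  proof (rule dependent_nat_choice)
    show "\<exists>p. Good 0 p" using ex by (simp add: Good_def)
    fix p k assume good: "Good k p"
    have "\<exists>m. Good (Suc k) (p(k := m))"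
    proof (rule ccontr)
      assume "\<not> ?thesis"
      then have "\<forall>m. \<exists>K. \<not> (\<exists>\<alpha>. (\<forall>i. \<alpha> i \<le> n i) \<and>
          (\<forall>i<Suc k. \<alpha> i = (p(k := m)) i) \<and> (\<forall>j\<le>K. Q \<alpha> j))"
        unfolding Good_def by simp
      then obtain K where K: "\<And>m \<alpha>. (\<forall>i. \<alpha> i \<le> n i) \<Longrightarrow>
          (\<forall>i<Suc k. \<alpha> i = (p(k := m)) i) \<Longrightarrow> (\<forall>j\<le>K m. Q \<alpha> j) \<Longrightarrow> False"
        by metis
      \<comment> \<open>A depth beyond all \<open>K m\<close> with \<open>m \<le> n k\<close>. The
        entry \<open>\<alpha> k\<close> is one of these \<open>m\<close>, which contradicts the
        choice of \<open>K\<close>.\<close>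
      obtain \<alpha> where \<alpha>: "\<forall>i. \<alpha> i \<le> n i" "\<forall>i<k. \<alpha> i = p i" "\<forall>j\<le>Max (K ` {..n k}). Q \<alpha> j"
        using good unfolding Good_def by blast
      have "K (\<alpha> k) \<le> Max (K ` {..n k})" using \<alpha>(1) by (intro Max_ge) auto
      then have "\<forall>j\<le>K (\<alpha> k). Q \<alpha> j" using \<alpha>(3) by (meson order_trans)
      then show False using K[of \<alpha> "\<alpha> k"] \<alpha> by (auto simp: less_Suc_eq)
    qed
    then show "\<exists>p'. Good (Suc k) p' \<and> (\<forall>i<k. p' i = p i)" by force
  qed
  then obtain p where good: "\<And>k. Good k (p k)" and step: "\<And>k i. i < k \<Longrightarrow> p (Suc k) i = p k i"
    by blast
  have p: "p k i = p (Suc i) i" if "i < k" for k i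
    using that by (induction k) (auto simp: step less_Suc_eq)
  define \<alpha> where "\<alpha> i = p (Suc i) i" for i
  have "Q \<alpha> j" for j
  proof -
    obtain \<alpha>' where "\<forall>i<Suc (f j). \<alpha>' i = p (Suc (f j)) i" "Q \<alpha>' j"
      using good[of "Suc (f j)"] unfolding Good_def by blast
    moreover have "\<alpha>' i = \<alpha> i" if "i \<le> f j" for i
      using calculation(1) that p[of i "Suc (f j)"] by (simp add: \<alpha>_def)
    ultimately show ?thesis using f[of j \<alpha>' \<alpha>] by blast
  qed
  then show ?thesis by blast
qed

text \<open>Choquet's capacitability argument for the outer measure of the projection.\<close>

lemma souslin_inner_approximation:
  assumes "finite_measure m" and Sf: "souslin_scheme m S f"
    and compact: "\<And>\<alpha> j \<omega>. \<omega> \<in> space m \<Longrightarrow> compact (S \<alpha> j \<omega>)"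
    and c: "c < outer_measure_of m {\<omega>\<in>space m. \<exists>t \<alpha>. \<forall>j. t \<in> S \<alpha> j \<omega>}"
  shows "\<exists>B\<in>sets m. B \<subseteq> {\<omega>\<in>space m. \<exists>t \<alpha>. \<forall>j. t \<in> S \<alpha> j \<omega>} \<and> c \<le> emeasure m B"
proof -
  interpret finite_measure m by fact
  have dep: "\<And>\<alpha> \<alpha>' j. \<forall>i\<le>f j. \<alpha> i = \<alpha>' i \<Longrightarrow> S \<alpha> j = S \<alpha>' j"
    and clos: "\<And>\<alpha> j. closed_sections m (S \<alpha> j)"
    using Sf unfolding souslin_scheme_def by blast+
  define H where "H k n = {\<omega>\<in>space m. \<exists>t \<alpha>. (\<forall>i<k. \<alpha> i \<le> n i) \<and> (\<forall>j. t \<in> S \<alpha> j \<omega>)}"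
    for k and n :: "nat \<Rightarrow> nat"
  \<comment> \<open>The bounds are fixed one entry at a time: as \<open>l\<close> grows,
    \<open>H (Suc k) (n(k := l))\<close> increases to \<open>H k n\<close>, and outer measure is
    continuous along increasing sequences of arbitrary sets.\<close>
  have "\<exists>n. \<forall>k. c < outer_measure_of m (H k (n k)) \<and> (\<forall>i<k. n (Suc k) i = n k i)"
  proof (rule dependent_nat_choice)
    show "\<exists>n. c < outer_measure_of m (H 0 n)" using c by (simp add: H_def)
    fix n k assume n: "c < outer_measure_of m (H k n)"
    have "(\<Union>l. H (Suc k) (n(k := l))) = H k n"
    proof (intro set_eqI iffI)
      fix \<omega> assume "\<omega> \<in> H k n"
      then obtain t \<alpha> where "\<omega> \<in> space m" "\<forall>i<k. \<alpha> i \<le> n i" "\<forall>j. t \<in> S \<alpha> j \<omega>"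
        unfolding H_def by blast
      then have "\<omega> \<in> H (Suc k) (n(k := \<alpha> k))" unfolding H_def by (auto simp: less_Suc_eq)
      then show "\<omega> \<in> (\<Union>l. H (Suc k) (n(k := l)))" by blast
    next
      fix \<omega> assume "\<omega> \<in> (\<Union>l. H (Suc k) (n(k := l)))"
      then obtain l t \<alpha> where "\<omega> \<in> space m" "\<forall>i<Suc k. \<alpha> i \<le> (n(k := l)) i" "\<forall>j. t \<in> S \<alpha> j \<omega>"
        unfolding H_def by blast
      moreover have "\<alpha> i \<le> n i" if "i < k" for i using calculation(2) that
        by (metis fun_upd_other less_SucI less_irrefl)
      ultimately show "\<omega> \<in> H k n" unfolding H_def by blast
    qed
    moreover have "incseq (\<lambda>l. H (Suc k) (n(k := l)))"
    proof (intro monoI subsetI)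
      fix l l' \<omega> assume "l \<le> (l'::nat)" "\<omega> \<in> H (Suc k) (n(k := l))"
      then obtain t \<alpha> where "\<omega> \<in> space m" "\<forall>i<Suc k. \<alpha> i \<le> (n(k := l)) i" "\<forall>j. t \<in> S \<alpha> j \<omega>"
        unfolding H_def by blast
      moreover have "(n(k := l)) i \<le> (n(k := l')) i" for i using \<open>l \<le> l'\<close> by simp
      ultimately show "\<omega> \<in> H (Suc k) (n(k := l'))" unfolding H_def by (blast intro: order_trans)
    qed
    moreover have "H k' n' \<subseteq> space m" for k' n' by (auto simp: H_def)
    ultimately have "(SUP l. outer_measure_of m (H (Suc k) (n(k := l)))) = outer_measure_of m (H k n)"
      using SUP_outer_measure_of_incseq[of "\<lambda>l. H (Suc k) (n(k := l))" m] by simp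
    then obtain l where "c < outer_measure_of m (H (Suc k) (n(k := l)))"
      using n by (metis less_SUP_iff)
    then show "\<exists>n'. c < outer_measure_of m (H (Suc k) n') \<and> (\<forall>i<k. n' i = n i)"
      by (intro exI[of _ "n(k := l)"]) auto
  qed
  then obtain p where p: "\<And>k. c < outer_measure_of m (H k (p k))"
    and step: "\<And>k i. i < k \<Longrightarrow> p (Suc k) i = p k i"
    by blast
  define n where "n i = p (Suc i) i" for i
  have pn: "p k i = n i" if "i < k" for k i
    using that unfolding n_def by (induction k) (auto simp: step less_Suc_eq)
  have "H k (p k) = H k n" for k using pn by (auto simp: H_def)
  then have Hn: "c < outer_measure_of m (H k n)" for k using p by metis
  \<comment> \<open>The sets \<open>H k n\<close> need not be measurable. \<open>L k\<close> retains
    only the stages up to \<open>k\<close>, which read finitely many bounded entries; hence it takes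
    finitely many closed values and its projection \<open>B k\<close> is measurable.\<close>
  define L where "L k \<omega> = {t. \<exists>\<alpha>. (\<forall>i. \<alpha> i \<le> n i) \<and> (\<forall>j\<le>k. t \<in> S \<alpha> j \<omega>)}" for k :: nat and \<omega>
  define f' where "f' k = Max (f ` {..k})" for k :: nat
  have f': "f j \<le> f' k" if "j \<le> k" for j k unfolding f'_def using that by (intro Max_ge) auto
  have cut: "S (\<lambda>i. if i \<le> f' k then \<alpha> i else 0) j = S \<alpha> j" if "j \<le> k" for \<alpha> j k
    by (rule dep) (use f'[OF that] in auto)
  define I where "I k = {\<alpha>. (\<forall>i\<le>f' k. \<alpha> i \<le> n i) \<and> (\<forall>i. \<not> i \<le> f' k \<longrightarrow> \<alpha> i = 0)}" for k
  have fin: "finite (I k)" for k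
  proof (rule finite_subset)
    show "I k \<subseteq> {\<alpha>. \<forall>i. (i \<in> {..f' k} \<longrightarrow> \<alpha> i \<in> {..Max (n ` {..f' k})}) \<and> (i \<notin> {..f' k} \<longrightarrow> \<alpha> i = 0)}"
    proof (intro subsetI CollectI allI conjI impI)
      fix \<alpha> i assume \<alpha>: "\<alpha> \<in> I k"
      show "\<alpha> i = 0" if "i \<notin> {..f' k}" using \<alpha> that by (simp add: I_def)
      assume i: "i \<in> {..f' k}"
      then have "n i \<le> Max (n ` {..f' k})" by (intro Max_ge) auto
      moreover have "\<alpha> i \<le> n i" using \<alpha> i by (simp add: I_def)
      ultimately show "\<alpha> i \<in> {..Max (n ` {..f' k})}" by simp
    qed
  qed (rule finite_set_of_finite_funs; simp)
  have L_eq: "L k \<omega> = (\<Union>\<alpha>\<in>I k. \<Inter>j\<in>{..k}. S \<alpha> j \<omega>)" for k \<omega>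
  proof (intro set_eqI iffI)
    fix t assume "t \<in> L k \<omega>"
    then obtain \<alpha> where "\<forall>i. \<alpha> i \<le> n i" "\<forall>j\<le>k. t \<in> S \<alpha> j \<omega>" unfolding L_def by blast
    then show "t \<in> (\<Union>\<alpha>\<in>I k. \<Inter>j\<in>{..k}. S \<alpha> j \<omega>)"
      by (intro UN_I[of "\<lambda>i. if i \<le> f' k then \<alpha> i else 0"]) (auto simp: I_def cut)
  next
    fix t assume "t \<in> (\<Union>\<alpha>\<in>I k. \<Inter>j\<in>{..k}. S \<alpha> j \<omega>)"
    then obtain \<alpha> where "\<alpha> \<in> I k" "\<forall>j\<le>k. t \<in> S \<alpha> j \<omega>" by auto
    moreover from this(1) have "\<alpha> i \<le> n i" for i by (cases "i \<le> f' k") (auto simp: I_def)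
    ultimately show "t \<in> L k \<omega>" unfolding L_def by blast
  qed
  have L_closed: "closed_sections m (L k)" for k
    unfolding L_eq[abs_def]
    by (intro closed_sections_UN fin closed_sections_INT_atMost clos)
  have L_compact: "compact (L k \<omega>)" if "\<omega> \<in> space m" for k \<omega>
    unfolding L_eq using fin compact[OF that] by (intro compact_UN compact_Inter) auto
  define B where "B k = {\<omega>\<in>space m. L k \<omega> \<noteq> {}}" for k
  have B: "B k \<in> sets m" for k unfolding B_def by (rule closed_sections_projection[OF L_closed])
  have L_dec: "L l \<omega> \<subseteq> L k \<omega>" if "k \<le> l" for k l \<omega> using that unfolding L_def by (blast intro: order_trans)
  have "c \<le> emeasure m (B k)" for k
  proof -
    \<comment> \<open>The successor is needed because \<open>H\<close> bounds only the entries
      strictly below its first argument, whereas stages up to \<open>k\<close> read the entry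
      \<open>f' k\<close> as well. Later entries are reset to 0, which respects every bound.\<close>
    have "H (Suc (f' k)) n \<subseteq> B k"
    proof
      fix \<omega> assume "\<omega> \<in> H (Suc (f' k)) n"
      then obtain t \<alpha> where "\<omega> \<in> space m" "\<forall>i<Suc (f' k). \<alpha> i \<le> n i" "\<forall>j. t \<in> S \<alpha> j \<omega>"
        unfolding H_def by blast
      then have "t \<in> L k \<omega>"
        unfolding L_def
        by (intro CollectI exI[of _ "\<lambda>i. if i \<le> f' k then \<alpha> i else 0"]) (auto simp: cut)
      then show "\<omega> \<in> B k" using \<open>\<omega> \<in> space m\<close> unfolding B_def by blast
    qed
    then show ?thesis
      using outer_measure_of_mono[of "H (Suc (f' k)) n" "B k" m] Hn[of "Suc (f' k)"]
        outer_measure_of_eq[OF B] by (metis less_imp_le order_less_le_trans)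
  qed
  moreover have "(INF k. emeasure m (B k)) = emeasure m (\<Inter>k. B k)"
  proof (rule INF_emeasure_decseq)
    show "decseq B" unfolding decseq_def B_def using L_dec by blast
  qed (use B in auto)
  ultimately have "c \<le> emeasure m (\<Inter>k. B k)" by (metis INF_greatest)
  moreover have "(\<Inter>k. B k) \<subseteq> {\<omega>\<in>space m. \<exists>t \<alpha>. \<forall>j. t \<in> S \<alpha> j \<omega>}"
  proof
    fix \<omega> assume \<omega>: "\<omega> \<in> (\<Inter>k. B k)"
    then have sp: "\<omega> \<in> space m" by (auto simp: B_def)
    \<comment> \<open>Compactness yields one time \<open>t\<close> common to all truncations; the
      sequence still depends on \<open>k\<close>, and Koenig's lemma removes this
      dependence.\<close>
    have "\<Inter>(range (\<lambda>k. L k \<omega>)) \<noteq> {}"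
      using \<omega> L_compact[OF sp] L_dec by (intro compact_nest) (auto simp: B_def)
    then obtain t where t: "\<And>k. t \<in> L k \<omega>" by blast
    have "\<exists>\<alpha>. \<forall>j. t \<in> S \<alpha> j \<omega>"
    proof (rule souslin_scheme_koenig)
      show "t \<in> S \<alpha> j \<omega> \<longleftrightarrow> t \<in> S \<alpha>' j \<omega>" if "\<forall>i\<le>f j. \<alpha> i = \<alpha>' i" for \<alpha> \<alpha>' j
        using dep[OF that] by simp
      show "\<exists>\<alpha>. (\<forall>i. \<alpha> i \<le> n i) \<and> (\<forall>j\<le>k. t \<in> S \<alpha> j \<omega>)" for k
        using t[of k] unfolding L_def by blast
    qed
    then show "\<omega> \<in> {\<omega>\<in>space m. \<exists>t \<alpha>. \<forall>j. t \<in> S \<alpha> j \<omega>}" using sp by blast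
  qed
  ultimately show ?thesis using B by (intro bexI[of _ "\<Inter>k. B k"]) auto
qed

text \<open>A measurable hull \<open>C\<close> and the union of countably many inner sets have equal
  measure, so what lies between them is null.\<close>

lemma completion_if_inner_approximation:
  assumes "finite_measure m" "A \<subseteq> space m"
    and inner: "\<And>c. c < outer_measure_of m A \<Longrightarrow> \<exists>B\<in>sets m. B \<subseteq> A \<and> c \<le> emeasure m B"
  shows "A \<in> sets (completion m)"
proof -
  interpret finite_measure m by fact
  obtain C where C: "C \<in> sets m" "A \<subseteq> C" "outer_measure_of m A = emeasure m C"
    using outer_measure_of_attain[OF assms(2)] by blast
  have "\<exists>B\<in>sets m. B \<subseteq> A \<and> emeasure m C \<le> emeasure m B + ennreal (1 / Suc n)" for n
  proof (cases "emeasure m C = 0")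
    case False
    have "emeasure m C - ennreal (1 / Suc n) < emeasure m C"
      using False by (intro ennreal_between) (auto simp: less_top[symmetric] zero_less_iff_neq_zero)
    then obtain B where "B \<in> sets m" "B \<subseteq> A" "emeasure m C - ennreal (1 / Suc n) \<le> emeasure m B"
      using inner C by metis
    then show ?thesis
      by (intro bexI[of _ B]) (auto simp: ennreal_minus_le_iff add.commute)
  qed auto
  then obtain B where B: "\<And>n. B n \<in> sets m" "\<And>n. B n \<subseteq> A"
    "\<And>n. emeasure m C \<le> emeasure m (B n) + ennreal (1 / Suc n)" by metis
  let ?B = "\<Union>n. B n"
  have BC: "?B \<subseteq> C" using B(2) C(2) by blast
  have bound: "measure m C \<le> measure m ?B + 1 / Suc n" for n
  proof -
    have "emeasure m C \<le> emeasure m ?B + ennreal (1 / Suc n)"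
    proof -
      have "emeasure m (B n) \<le> emeasure m ?B" using B(1) by (intro emeasure_mono) auto
      then show ?thesis using B(3)[of n] by (meson add_right_mono order_trans)
    qed
    also have "\<dots> = ennreal (measure m ?B + 1 / Suc n)"
      by (simp add: emeasure_eq_measure)
    finally show ?thesis
      unfolding emeasure_eq_measure by (subst (asm) ennreal_le_iff) auto
  qed
  have "measure m C \<le> measure m ?B"
  proof (rule field_le_epsilon)
    fix e :: real assume "0 < e"
    then obtain n where "1 / Suc n < e" by (rule nat_approx_posE)
    then show "measure m C \<le> measure m ?B + e" using bound[of n] by linarith
  qed
  then have "measure m (C - ?B) = 0"
    using finite_measure_Diff[OF C(1) _ BC] B(1) measure_nonneg[of m "C - ?B"] by simp
  then have "C - ?B \<in> null_sets m"
    using C(1) B(1) by (auto simp: null_sets_def emeasure_eq_measure)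
  then show ?thesis
    using B C by (intro sets_completionI[of A ?B "A - ?B" "C - ?B" m]) auto
qed

text \<open>Cutting the sections to the intervals \<open>{-c..c}\<close> makes them compact, as the
  capacity argument requires; countably many cuts exhaust the line.\<close>

theorem measurable_projection:
  assumes fin: "finite_measure m" and A: "A \<in> sets ((borel :: real measure) \<Otimes>\<^sub>M m)"
  shows "snd ` A \<in> sets (completion m)"
proof -
  obtain S f where Sf: "souslin_scheme m S f"
    and A_eq: "A = {(t, \<omega>). \<omega> \<in> space m \<and> (\<exists>\<alpha>. \<forall>j. t \<in> S \<alpha> j \<omega>)}"
    using souslin_pair_measure[OF A] unfolding souslin_def by blast
  define T where "T c \<alpha> j \<omega> = {-real c..real c} \<inter> S \<alpha> j \<omega>" for c :: nat and \<alpha> j \<omega>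
  have T: "souslin_scheme m (T c) f" for c
    unfolding souslin_scheme_def
  proof (intro conjI allI impI)
    show "closed_sections m (T c \<alpha> j)" for \<alpha> j
      using Sf unfolding souslin_scheme_def T_def
      by (auto intro!: closed_sections_Int closed_sections_const)
    show "T c \<alpha> j = T c \<alpha>' j" if "\<forall>i\<le>f j. \<alpha> i = \<alpha>' i" for \<alpha> \<alpha>' j
    proof -
      have "S \<alpha> j = S \<alpha>' j" using Sf that unfolding souslin_scheme_def by blast
      then show ?thesis unfolding T_def by (simp only:)
    qed
  qed
  let ?P = "\<lambda>c. {\<omega>\<in>space m. \<exists>t \<alpha>. \<forall>j. t \<in> T c \<alpha> j \<omega>}"
  have "?P c \<in> sets (completion m)" for c
  proof (rule completion_if_inner_approximation[OF fin])
    have "compact (T c \<alpha> j \<omega>)" if "\<omega> \<in> space m" for \<alpha> j \<omega>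
      using Sf that unfolding T_def souslin_scheme_def closed_sections_def by (intro compact_Int_closed) auto
    then show "\<exists>B\<in>sets m. B \<subseteq> ?P c \<and> d \<le> emeasure m B" if "d < outer_measure_of m (?P c)" for d
      by (rule souslin_inner_approximation[OF fin T]) (use that in auto)
  qed auto
  then have "(\<Union>c. ?P c) \<in> sets (completion m)" by blast
  also have "(\<Union>c. ?P c) = snd ` A"
  proof (intro set_eqI iffI)
    fix \<omega> assume "\<omega> \<in> snd ` A"
    then obtain t \<alpha> where *: "\<omega> \<in> space m" "\<forall>j. t \<in> S \<alpha> j \<omega>" unfolding A_eq by auto
    obtain c :: nat where "\<bar>t\<bar> \<le> real c" using real_arch_simple by blast
    then have "\<omega> \<in> ?P c" using * unfolding T_def by (auto simp: abs_le_iff intro!: exI[of _ t])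
    then show "\<omega> \<in> (\<Union>c. ?P c)" by blast
  qed (auto simp: A_eq T_def image_iff)
  finally show ?thesis .
qed

section \<open>Integrals and universally measurable kernels\<close>

lemma tendsto_dominated_nn_integral_le_1:
  assumes "finite_measure M" "\<And>n. u n \<in> borel_measurable M" "u' \<in> borel_measurable M"
    and "\<And>n x. x \<in> space M \<Longrightarrow> u n x \<le> (1::ennreal)"
    and "\<And>x. x \<in> space M \<Longrightarrow> (\<lambda>n. u n x) \<longlonglongrightarrow> u' x"
  shows "(\<lambda>n. \<integral>\<^sup>+x. u n x \<partial>M) \<longlonglongrightarrow> (\<integral>\<^sup>+x. u' x \<partial>M)"
proof (rule nn_integral_dominated_convergence[where w="\<lambda>_. 1"])
  interpret finite_measure M by fact
  show "(\<integral>\<^sup>+x. 1 \<partial>M) < \<infinity>" by (simp add: less_top[symmetric])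
qed (use assms in auto)

lemma measure_eq_if_continuous_integrals_eq:
  fixes M N :: "'e::metric_space measure"
  assumes M: "finite_measure M" "sets M = sets borel" and N: "finite_measure N" "sets N = sets borel"
    and eq: "\<And>f. continuous_on UNIV f \<Longrightarrow> (\<And>x. 0 \<le> f x \<and> f x \<le> (1::real)) \<Longrightarrow>
      (\<integral>\<^sup>+x. ennreal (f x) \<partial>M) = (\<integral>\<^sup>+x. ennreal (f x) \<partial>N)"
  shows "M = N"
proof (rule measure_eqI_generator_eq[where E="Collect open" and \<Omega>=UNIV and A="\<lambda>_. UNIV"])
  interpret M: finite_measure M by fact
  interpret N: finite_measure N by fact
  show "Int_stable (Collect open)" by (auto simp: Int_stable_def)
  show "sets M = sigma_sets UNIV (Collect open)" "sets N = sigma_sets UNIV (Collect open)"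
    using M N by (simp_all add: borel_def)
  fix U :: "'e set" assume "U \<in> Collect open"
  then have U: "open U" by simp
  show "emeasure M U = emeasure N U"
  proof (cases "U = UNIV")
    case True
    then show ?thesis
      using eq[of "\<lambda>_. 1"] sets_eq_imp_space_eq[OF M(2)] sets_eq_imp_space_eq[OF N(2)] by simp
  next
    case False
    \<comment> \<open>Continuous functions increasing to the indicator of \<open>U\<close>. The
      whole space is treated apart because \<open>infdist\<close> to the empty set is 0.\<close>
    define f where "f n x = min 1 (real n * infdist x (-U))" for n x
    have lim: "(\<lambda>n. ennreal (f n x)) \<longlonglongrightarrow> indicator U x" for x
    proof (cases "x \<in> U")
      case True
      then have pos: "infdist x (-U) > 0"
        using False U in_closed_iff_infdist_zero[of "-U" x] infdist_nonneg[of x "-U"]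
        by (metis ComplD Compl_empty_eq closed_Compl double_complement less_eq_real_def)
      have "eventually (\<lambda>n. f n x = 1) sequentially"
      proof -
        obtain k :: nat where k: "1 / infdist x (-U) < real k" using reals_Archimedean2 by blast
        have "f n x = 1" if "n \<ge> k" for n
        proof -
          have "1 / infdist x (-U) < real n" using k that by linarith
          then have "1 < real n * infdist x (-U)" using pos by (simp add: field_simps)
          then show ?thesis by (simp add: f_def)
        qed
        then show ?thesis by (auto simp: eventually_sequentially)
      qed
      then have "eventually (\<lambda>n. ennreal (f n x) = indicator U x) sequentially"
        by eventually_elim (use True in simp)
      then show ?thesis by (rule tendsto_eventually)
    next
      case False
      then have "infdist x (-U) = 0" by (simp add: infdist_zero)
      then show ?thesis using False by (simp add: f_def)
    qed
    have cont: "continuous_on UNIV (f n)" for n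
      unfolding f_def by (intro continuous_intros)
    have f01: "0 \<le> f n x \<and> f n x \<le> 1" for n x by (simp add: f_def infdist_nonneg)
    have conv: "(\<lambda>n. \<integral>\<^sup>+x. ennreal (f n x) \<partial>K) \<longlonglongrightarrow> emeasure K U"
      if K: "finite_measure K" "sets K = sets borel" for K
    proof -
      have "U \<in> sets K" using K U by simp
      then have "emeasure K U = (\<integral>\<^sup>+x. indicator U x \<partial>K)" by simp
      also have "(\<lambda>n. \<integral>\<^sup>+x. ennreal (f n x) \<partial>K) \<longlonglongrightarrow> \<dots>"
      proof (rule tendsto_dominated_nn_integral_le_1[OF K(1)])
        have "f n \<in> borel_measurable K" for n
          using borel_measurable_continuous_onI[OF cont] measurable_cong_sets[OF K(2) refl] by blast
        then show "(\<lambda>x. ennreal (f n x)) \<in> borel_measurable K" for n by measurable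
      qed (use lim f01 \<open>U \<in> sets K\<close> in \<open>auto simp: ennreal_le_1\<close>)
      finally show ?thesis .
    qed
    have "(\<lambda>n. \<integral>\<^sup>+x. ennreal (f n x) \<partial>M) = (\<lambda>n. \<integral>\<^sup>+x. ennreal (f n x) \<partial>N)"
      using eq[OF cont f01] by simp
    then show ?thesis using conv[OF M] conv[OF N] LIMSEQ_unique by metis
  qed
qed (use M N finite_measure.emeasure_finite[OF M(1)] in auto)

lemma nn_integral_exp_atLeast_0:
  assumes "0 < a"
  shows "(\<integral>\<^sup>+t. ennreal (exp (- a * t)) * indicator {0..} t \<partial>lborel) = ennreal (1 / a)"
proof -
  have "(\<integral>\<^sup>+t. ennreal (exp (- a * t)) * indicator {0..} t \<partial>lborel) = ennreal (0 - (- exp (- a * 0) / a))"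
  proof (rule nn_integral_FTC_atLeast)
    show "((\<lambda>t. - exp (- a * t) / a) has_real_derivative exp (- a * t)) (at t)" for t
      using assms by (auto intro!: derivative_eq_intros)
    have "((\<lambda>t. exp (- a * t)) \<longlongrightarrow> 0) at_top"
      using assms by (intro filterlim_compose[OF exp_at_bot] filterlim_tendsto_neg_mult_at_bot[OF tendsto_const])
        (auto simp: filterlim_ident)
    from tendsto_divide[OF tendsto_minus[OF this] tendsto_const, of a] assms
    show "((\<lambda>t. - exp (- a * t) / a) \<longlongrightarrow> 0) at_top" by simp
  qed auto
  then show ?thesis by simp
qed

lemma nn_integral_exp_Icc:
  assumes "c \<noteq> 0" "0 \<le> r"
  shows "(\<integral>\<^sup>+s. ennreal (exp (- c * s)) * indicator {0..r} s \<partial>lborel) = ennreal ((1 - exp (- c * r)) / c)"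
proof -
  have "(\<integral>\<^sup>+s. ennreal (exp (- c * s)) * indicator {0..r} s \<partial>lborel) =
      ennreal (- exp (- c * r) / c - (- exp (- c * 0) / c))"
    using assms by (intro nn_integral_FTC_Icc) (auto intro!: derivative_eq_intros)
  then show ?thesis using assms by (simp add: field_simps)
qed

text \<open>Shared by the Markov and the strong Markov property: once the law of \<open>Y\<close> on
  \<open>A\<close> is known to be the corresponding mixture of the kernel, all Borel integrands
  follow.\<close>

lemma kernel_integral_extend:
  assumes A: "A \<in> sets M" and fin: "finite_measure M" and Y: "Y \<in> M \<rightarrow>\<^sub>M borel" and Z: "Z \<in> M \<rightarrow>\<^sub>M S"
    and K: "K \<in> S \<rightarrow>\<^sub>M subprob_algebra (borel :: 'e::metric_space measure)" and ne: "space M \<noteq> {}"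
    and eq: "distr (density M (indicator A)) borel Y = distr (density M (indicator A)) S Z \<bind> K"
    and f: "f \<in> borel_measurable borel"
  shows "(\<integral>\<^sup>+\<omega>\<in>A. f (Y \<omega>) \<partial>M) = (\<integral>\<^sup>+\<omega>\<in>A. (\<integral>\<^sup>+y. f y \<partial>K (Z \<omega>)) \<partial>M)"
proof -
  let ?D = "density M (indicator A)"
  have "(\<integral>\<^sup>+\<omega>\<in>A. f (Y \<omega>) \<partial>M) = (\<integral>\<^sup>+y. f y \<partial>distr ?D borel Y)"
    using A Y f by (subst nn_integral_distr) (auto simp: nn_integral_density mult.commute)
  also have "\<dots> = (\<integral>\<^sup>+z. (\<integral>\<^sup>+y. f y \<partial>K z) \<partial>distr ?D S Z)"
    unfolding eq using K by (intro nn_integral_bind[OF f]) simp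
  also have "\<dots> = (\<integral>\<^sup>+\<omega>\<in>A. (\<integral>\<^sup>+y. f y \<partial>K (Z \<omega>)) \<partial>M)"
  proof -
    have "(\<lambda>z. \<integral>\<^sup>+y. f y \<partial>K z) \<in> borel_measurable S"
      using measurable_compose[OF K nn_integral_measurable_subprob_algebra[OF f]] .
    then show ?thesis
      using A Z by (subst nn_integral_distr) (auto simp: nn_integral_density mult.commute)
  qed
  finally show ?thesis .
qed

text \<open>
  As \<open>nn_integral\<close> does not distinguish \<open>\<mu>\<close> and its completion, kernels that are merely measurable
  with respect to the completion can be composed with \<open>\<mu>\<close>.
\<close>

lemma nn_integral_suminf_completion:
  assumes "\<And>n. f n \<in> borel_measurable (completion \<mu>)"
  shows "(\<integral>\<^sup>+x. (\<Sum>n. f n x) \<partial>\<mu>) = (\<Sum>n. \<integral>\<^sup>+x. f n x \<partial>\<mu>)"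
  using nn_integral_suminf[of f "completion \<mu>"] assms by (simp add: nn_integral_completion)

lemma sets_kernel_comp [simp]: "sets (kernel_comp T \<mu> K) = sets T"
  by (simp add: kernel_comp_def sets.sets_measure_of_eq)

lemma emeasure_kernel_comp:
  assumes K: "\<And>x. sets (K x) = sets T"
    and meas: "\<And>A. A \<in> sets T \<Longrightarrow> (\<lambda>x. emeasure (K x) A) \<in> borel_measurable (completion \<mu>)"
    and A: "A \<in> sets T"
  shows "emeasure (kernel_comp T \<mu> K) A = (\<integral>\<^sup>+x. emeasure (K x) A \<partial>\<mu>)"
  unfolding kernel_comp_def
proof (rule emeasure_measure_of_sigma[OF sets.sigma_algebra_axioms _ _ A])
  show "positive (sets T) (\<lambda>A. \<integral>\<^sup>+x. emeasure (K x) A \<partial>\<mu>)" by (simp add: positive_def)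
  show "countably_additive (sets T) (\<lambda>A. \<integral>\<^sup>+x. emeasure (K x) A \<partial>\<mu>)"
  proof (rule countably_additiveI)
    fix B :: "nat \<Rightarrow> _" assume B: "range B \<subseteq> sets T" "disjoint_family B" "(\<Union>i. B i) \<in> sets T"
    have "(\<Sum>i. \<integral>\<^sup>+x. emeasure (K x) (B i) \<partial>\<mu>) = (\<integral>\<^sup>+x. (\<Sum>i. emeasure (K x) (B i)) \<partial>\<mu>)"
      using B meas by (intro nn_integral_suminf_completion[symmetric]) auto
    also have "\<dots> = (\<integral>\<^sup>+x. emeasure (K x) (\<Union>i. B i) \<partial>\<mu>)"
      using B K by (intro nn_integral_cong suminf_emeasure) auto
    finally show "(\<Sum>i. \<integral>\<^sup>+x. emeasure (K x) (B i) \<partial>\<mu>) = (\<integral>\<^sup>+x. emeasure (K x) (\<Union>i. B i) \<partial>\<mu>)" .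
  qed
qed

lemma nn_integral_kernel_comp:
  assumes K: "\<And>x. sets (K x) = sets T"
    and meas: "\<And>A. A \<in> sets T \<Longrightarrow> (\<lambda>x. emeasure (K x) A) \<in> borel_measurable (completion \<mu>)"
    and f: "f \<in> borel_measurable T"
  shows "(\<integral>\<^sup>+y. f y \<partial>kernel_comp T \<mu> K) = (\<integral>\<^sup>+x. (\<integral>\<^sup>+y. f y \<partial>K x) \<partial>\<mu>)"
proof -
  let ?k = "kernel_comp T \<mu> K"
  have K_meas: "borel_measurable (K x) = (borel_measurable T :: (_ \<Rightarrow> ennreal) set)" for x
    using K by (intro measurable_cong_sets) simp_all
  have k_meas: "borel_measurable ?k = (borel_measurable T :: (_ \<Rightarrow> ennreal) set)"
    by (intro measurable_cong_sets) simp_all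
  have sp: "space (K x) = space T" for x using K by (rule sets_eq_imp_space_eq)
  have spk: "space ?k = space T" by (rule sets_eq_imp_space_eq) simp
  \<comment> \<open>Measurability of the inner integral is carried through the induction because
    additivity and monotone convergence over \<open>completion \<mu>\<close> depend on it.\<close>
  have "(\<lambda>x. \<integral>\<^sup>+y. f y \<partial>K x) \<in> borel_measurable (completion \<mu>) \<and>
      (\<integral>\<^sup>+y. f y \<partial>?k) = (\<integral>\<^sup>+x. (\<integral>\<^sup>+y. f y \<partial>K x) \<partial>\<mu>)"
    using f
  proof (induction rule: borel_measurable_induct)
    case (cong f g)
    have "(\<integral>\<^sup>+y. f y \<partial>K x) = (\<integral>\<^sup>+y. g y \<partial>K x)" for x
      using cong sp by (intro nn_integral_cong) simp
    moreover have "(\<integral>\<^sup>+y. f y \<partial>?k) = (\<integral>\<^sup>+y. g y \<partial>?k)"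
      using cong spk by (intro nn_integral_cong) simp
    ultimately show ?case using cong by simp
  next
    case (set A)
    then show ?case using meas[OF set] emeasure_kernel_comp[OF K meas set] K by simp
  next
    case (mult u c)
    have "(\<lambda>x. c * (\<integral>\<^sup>+y. u y \<partial>K x)) \<in> borel_measurable (completion \<mu>)"
      using mult by (intro borel_measurable_times_ennreal) auto
    moreover have "(\<integral>\<^sup>+x. c * (\<integral>\<^sup>+y. u y \<partial>K x) \<partial>\<mu>) = c * (\<integral>\<^sup>+x. (\<integral>\<^sup>+y. u y \<partial>K x) \<partial>\<mu>)"
      using nn_integral_cmult[of "\<lambda>x. \<integral>\<^sup>+y. u y \<partial>K x" "completion \<mu>" c] mult by (simp add: nn_integral_completion)
    moreover have "(\<integral>\<^sup>+y. c * u y \<partial>K x) = c * (\<integral>\<^sup>+y. u y \<partial>K x)" for x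
      using mult by (intro nn_integral_cmult) (simp add: K_meas)
    moreover have "(\<integral>\<^sup>+y. c * u y \<partial>?k) = c * (\<integral>\<^sup>+y. u y \<partial>?k)"
      using mult by (intro nn_integral_cmult) (simp add: k_meas)
    ultimately show ?case using mult by simp
  next
    case (add u v)
    have "(\<lambda>x. (\<integral>\<^sup>+y. u y \<partial>K x) + (\<integral>\<^sup>+y. v y \<partial>K x)) \<in> borel_measurable (completion \<mu>)"
      using add by (intro borel_measurable_add) auto
    moreover have "(\<integral>\<^sup>+x. (\<integral>\<^sup>+y. u y \<partial>K x) + (\<integral>\<^sup>+y. v y \<partial>K x) \<partial>\<mu>) =
        (\<integral>\<^sup>+x. (\<integral>\<^sup>+y. u y \<partial>K x) \<partial>\<mu>) + (\<integral>\<^sup>+x. (\<integral>\<^sup>+y. v y \<partial>K x) \<partial>\<mu>)"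
      using nn_integral_add[of "\<lambda>x. \<integral>\<^sup>+y. u y \<partial>K x" "completion \<mu>" "\<lambda>x. \<integral>\<^sup>+y. v y \<partial>K x"] add
      by (simp add: nn_integral_completion)
    moreover have "(\<integral>\<^sup>+y. v y + u y \<partial>K x) = (\<integral>\<^sup>+y. v y \<partial>K x) + (\<integral>\<^sup>+y. u y \<partial>K x)" for x
      using add by (intro nn_integral_add) (simp_all add: K_meas)
    moreover have "(\<integral>\<^sup>+y. v y + u y \<partial>?k) = (\<integral>\<^sup>+y. v y \<partial>?k) + (\<integral>\<^sup>+y. u y \<partial>?k)"
      using add by (intro nn_integral_add) (simp_all add: k_meas)
    ultimately show ?case using add by (simp add: add.commute)
  next
    case (seq V)
    have mono: "incseq (\<lambda>i y. V i y)" using seq by simp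
    have int_K: "(\<integral>\<^sup>+y. (SUP i. V i y) \<partial>K x) = (SUP i. \<integral>\<^sup>+y. V i y \<partial>K x)" for x
      using seq by (intro nn_integral_monotone_convergence_SUP) (auto simp: K_meas)
    have "incseq (\<lambda>i x. \<integral>\<^sup>+y. V i y \<partial>K x)"
      using mono by (auto simp: incseq_def le_fun_def intro!: nn_integral_mono)
    then have "(\<integral>\<^sup>+x. (SUP i. \<integral>\<^sup>+y. V i y \<partial>K x) \<partial>\<mu>) = (SUP i. \<integral>\<^sup>+x. (\<integral>\<^sup>+y. V i y \<partial>K x) \<partial>\<mu>)"
      using nn_integral_monotone_convergence_SUP[of "\<lambda>i x. \<integral>\<^sup>+y. V i y \<partial>K x" "completion \<mu>"] seq
      by (simp add: nn_integral_completion)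
    moreover have "(\<lambda>x. SUP i. \<integral>\<^sup>+y. V i y \<partial>K x) \<in> borel_measurable (completion \<mu>)"
      using seq by (intro borel_measurable_SUP) auto
    moreover have "(\<integral>\<^sup>+y. (SUP i. V i y) \<partial>?k) = (SUP i. \<integral>\<^sup>+y. V i y \<partial>?k)"
      using seq by (intro nn_integral_monotone_convergence_SUP) (auto simp: k_meas)
    ultimately show ?case using seq by (simp add: int_K image_comp SUP_apply[abs_def])
  qed
  then show ?thesis ..
qed

section \<open>Universal measurability for sigma-finite measures\<close>

text \<open>Strict positivity of \<open>h\<close> ensures that passing to the finite measure loses
  no null sets.\<close>

lemma equivalent_finite_density:
  assumes "sigma_finite_measure \<mu>"
  obtains h :: "'a \<Rightarrow> ennreal" where "h \<in> borel_measurable \<mu>" "finite_measure (density \<mu> h)"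
    "\<And>x. x \<in> space \<mu> \<Longrightarrow> 0 < h x"
proof -
  obtain h where h: "h \<in> borel_measurable \<mu>" "integral\<^sup>N \<mu> h \<noteq> \<infinity>" "\<forall>x\<in>space \<mu>. 0 < h x \<and> h x < \<infinity>"
    using sigma_finite_measure.Ex_finite_integrable_function[OF assms] by blast
  moreover have "emeasure (density \<mu> h) (space (density \<mu> h)) = integral\<^sup>N \<mu> h"
    using h(1) by (simp add: emeasure_density cong: nn_integral_cong)
  ultimately show thesis by (intro that[of h] finite_measureI) auto
qed

text \<open>The universal completion refers to probability measures only. A nonzero sigma-finite
  measure has the null sets of a probability measure, namely of a normalized finite density; for the
  zero measure every subset of the space is null.\<close>

lemma universal_completion_sets:
  assumes \<mu>: "sigma_finite_measure \<mu>" and S: "sets \<mu> = sets S"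
  shows "sets (universal_completion S) \<subseteq> sets (completion \<mu>)"
proof -
  have sp: "space \<mu> = space S" using S by (rule sets_eq_imp_space_eq)
  let ?G = "{A. A \<subseteq> space S \<and> (\<forall>\<mu>. prob_space \<mu> \<and> sets \<mu> = sets S \<longrightarrow> A \<in> sets (completion \<mu>))}"
  have "A \<in> sets (completion \<mu>)" if A: "A \<in> ?G" for A
  proof (cases "emeasure \<mu> (space \<mu>) = 0")
    case True
    then have "space \<mu> \<in> null_sets \<mu>" by (simp add: null_sets_def)
    then show ?thesis using A sp by (intro null_sets_completion) auto
  next
    case False
    obtain h where h: "h \<in> borel_measurable \<mu>" "finite_measure (density \<mu> h)"
      "\<And>x. x \<in> space \<mu> \<Longrightarrow> 0 < h x"
      using equivalent_finite_density[OF \<mu>] by blast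
    let ?d = "density \<mu> h"
    have null: "null_sets ?d = null_sets \<mu>"
    proof -
      have "(AE x in \<mu>. x \<in> N \<longrightarrow> h x = 0) \<longleftrightarrow> (AE x in \<mu>. x \<notin> N)" for N
        using h(3) by (intro AE_cong) (auto simp: zero_less_iff_neq_zero)
      then show ?thesis
        using h(1) AE_iff_null_sets[of _ \<mu>] null_setsD2[of _ \<mu>]
        by (intro set_eqI) (simp only: null_sets_density_iff[OF h(1)], blast)
    qed
    let ?c = "emeasure ?d (space ?d)"
    have c: "?c \<noteq> 0" "?c \<noteq> \<infinity>"
    proof -
      have "space ?d \<notin> null_sets ?d" unfolding null using False by (auto simp: null_sets_def)
      then show "?c \<noteq> 0" by (auto simp: null_sets_def)
      show "?c \<noteq> \<infinity>" using finite_measure.emeasure_finite[OF h(2)] by simp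
    qed
    let ?p = "scale_measure (1 / ?c) ?d"
    have "prob_space ?p"
      using c by (intro prob_spaceI) (simp add: space_scale_measure ennreal_divide_times divide_eq_1_ennreal)
    moreover have "sets ?p = sets S" by (simp add: S)
    ultimately have "A \<in> sets (completion ?p)" using A by blast
    then obtain B N N' where B: "A = B \<union> N" "N \<subseteq> N'" "N' \<in> null_sets ?p" "B \<in> sets ?p"
      by (rule sets_completionE)
    have "N' \<in> null_sets ?d"
      using B(3) c by (auto simp: null_sets_def ennreal_divide_eq_0_iff)
    then show ?thesis using B null by (intro sets_completionI[of A B N N']) auto
  qed
  then have "sigma_sets (space S) ?G \<subseteq> sets (completion \<mu>)"
    using sets.sigma_sets_subset[of ?G "completion \<mu>"] sp by auto
  then show ?thesis unfolding universal_completion_def by (subst sets_measure_of) auto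
qed

lemma universally_measurable:
  assumes "sigma_finite_measure \<mu>" "sets \<mu> = sets S" and f: "f \<in> borel_measurable (universal_completion S)"
  shows "f \<in> borel_measurable (completion \<mu>)"
proof -
  have "space (universal_completion S) = space (completion \<mu>)"
    using sets_eq_imp_space_eq[OF assms(2)] by (simp add: universal_completion_def space_measure_of_conv)
  then show ?thesis
    using f universal_completion_sets[OF assms(1,2)] by (auto simp: measurable_def)
qed

section \<open>Measurability of the paths and stopping times\<close>

text \<open>Rounding up strictly, with floor plus one instead of a ceiling, makes
  \<open>dyad n t\<close> approach \<open>t\<close> from the right. It also turns the event that
  \<open>dyad n T\<close> has a given value into a difference of events of the form
  \<open>T < u\<close>.\<close>

definition dyad :: "nat \<Rightarrow> real \<Rightarrow> real" where
  "dyad n t = (real_of_int \<lfloor>2 ^ n * t\<rfloor> + 1) / 2 ^ n"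

lemma dyad_gt: "t < dyad n t"
proof -
  have "2 ^ n * t < real_of_int \<lfloor>2 ^ n * t\<rfloor> + 1" by linarith
  then show ?thesis unfolding dyad_def by (simp add: field_simps)
qed

lemma dyad_le: "dyad n t \<le> t + (1 / 2) ^ n"
proof -
  have "real_of_int \<lfloor>2 ^ n * t\<rfloor> + 1 \<le> 2 ^ n * t + 1" by linarith
  then show ?thesis unfolding dyad_def by (simp add: field_simps power_divide)
qed

lemma dyad_at_right: "filterlim (\<lambda>n. dyad n t + d) (at_right (t + d)) sequentially"
  unfolding filterlim_at
proof
  show "\<forall>\<^sub>F n in sequentially. dyad n t + d \<in> {t + d<..} \<and> dyad n t + d \<noteq> t + d"
    using dyad_gt by (auto simp: less_imp_neq order_less_imp_not_eq2)
  have "(\<lambda>n. (1 / 2 :: real) ^ n) \<longlonglongrightarrow> 0" by (rule LIMSEQ_power_zero) simp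
  then have "(\<lambda>n. t + (1 / 2) ^ n) \<longlonglongrightarrow> t" using tendsto_add[OF tendsto_const] by fastforce
  then have "(\<lambda>n. dyad n t) \<longlonglongrightarrow> t"
    by (rule tendsto_sandwich[OF always_eventually always_eventually tendsto_const, rotated 2])
      (use dyad_gt dyad_le less_imp_le in blast)+
  then show "(\<lambda>n. dyad n t + d) \<longlonglongrightarrow> t + d" by (intro tendsto_intros)
qed

lemma dyad_measurable [measurable]: "dyad n \<in> borel_measurable borel"
  unfolding dyad_def by measurable

context right_process
begin

lemma sets_P [simp, measurable_cong]: "sets (P x) = sets F"
  using P_kernel by (auto simp: is_kernel_def)

lemma space_P [simp]: "space (P x) = space F"
  by (rule sets_eq_imp_space_eq) simp

sublocale P: prob_space "P x" for x
  by (rule prob)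

lemma measurable_Ft_F: "0 \<le> t \<Longrightarrow> f \<in> Ft t \<rightarrow>\<^sub>M N \<Longrightarrow> f \<in> F \<rightarrow>\<^sub>M N"
  using Ft_subalgebra[of t] Ft_space[of t] by (auto simp: measurable_def)

lemma X_measurable: "0 \<le> t \<Longrightarrow> X t \<in> borel_measurable F"
  using measurable_Ft_F adapted by blast

lemma X_dyad_tendsto:
  assumes "\<omega> \<in> space F" "0 \<le> t" "0 \<le> d"
  shows "(\<lambda>n. X (dyad n t + d) \<omega>) \<longlonglongrightarrow> X (t + d) \<omega>"
  using filterlim_compose[OF _ dyad_at_right]
    paths_right_continuous[of \<omega> "t + d", unfolded continuous_within] assms by fastforce

text \<open>A dyadic approximation uses countably many random variables, and right-continuity gives
  the limit. The approximating time may overshoot \<open>t\<close>, where \<open>X\<close> is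
  unknown to \<open>m\<close>, hence the cutoff; since \<open>s < t\<close> is strict, it is
  eventually inactive. The extended horizon includes infinity.\<close>

lemma progressively_measurable:
  fixes t :: ereal
  assumes sp: "space m = space F" and X: "\<And>s. 0 \<le> s \<Longrightarrow> ereal s < t \<Longrightarrow> X s \<in> borel_measurable m"
  shows "(\<lambda>(s, \<omega>). if 0 \<le> s \<and> ereal s < t then X s \<omega> else 0) \<in> borel_measurable (borel \<Otimes>\<^sub>M m)"
proof (rule borel_measurable_LIMSEQ_metric)
  fix n
  define g where "g k z = (if 0 \<le> k \<and> ereal ((real_of_int k + 1) / 2 ^ n) < t
    then X ((real_of_int k + 1) / 2 ^ n) (snd z) else 0)" for k and z :: "real \<times> 'w"
  have "g k \<in> borel_measurable (borel \<Otimes>\<^sub>M m)" for k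
  proof (cases "0 \<le> k \<and> ereal ((real_of_int k + 1) / 2 ^ n) < t")
    case True
    then have "X ((real_of_int k + 1) / 2 ^ n) \<in> borel_measurable m" by (intro X) auto
    then have "(\<lambda>z. X ((real_of_int k + 1) / 2 ^ n) (snd z)) \<in> borel_measurable (borel \<Otimes>\<^sub>M m)"
      by measurable
    then show ?thesis using True by (simp add: g_def[abs_def])
  next
    case False
    then have "g k = (\<lambda>_. 0)" unfolding g_def by auto
    then show ?thesis by simp
  qed
  then have "(\<lambda>z. g \<lfloor>2 ^ n * fst z\<rfloor> z) \<in> borel_measurable (borel \<Otimes>\<^sub>M m)"
    by (rule measurable_compose_countable) measurable
  moreover have "0 \<le> 2 ^ n * a \<longleftrightarrow> 0 \<le> a" for a :: real
    by (metis mult_le_cancel_left_pos mult_zero_right zero_less_numeral zero_less_power)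
  then have "(\<lambda>z. g \<lfloor>2 ^ n * fst z\<rfloor> z) =
    (\<lambda>(s, \<omega>). if 0 \<le> s \<and> ereal (dyad n s) < t then X (dyad n s) \<omega> else 0)"
    by (auto simp: g_def dyad_def fun_eq_iff)
  ultimately show "(\<lambda>(s, \<omega>). if 0 \<le> s \<and> ereal (dyad n s) < t then X (dyad n s) \<omega> else 0)
    \<in> borel_measurable (borel \<Otimes>\<^sub>M m)" by simp
next
  fix z :: "real \<times> 'w" assume "z \<in> space (borel \<Otimes>\<^sub>M m)"
  then obtain s \<omega> where z: "z = (s, \<omega>)" "\<omega> \<in> space F" by (auto simp: space_pair_measure sp)
  show "(\<lambda>n. (\<lambda>(s, \<omega>). if 0 \<le> s \<and> ereal (dyad n s) < t then X (dyad n s) \<omega> else 0) z)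
    \<longlonglongrightarrow> (\<lambda>(s, \<omega>). if 0 \<le> s \<and> ereal s < t then X s \<omega> else 0) z"
  proof (cases "0 \<le> s \<and> ereal s < t")
    case True
    have "(\<lambda>n. dyad n s) \<longlonglongrightarrow> s"
      using dyad_at_right[of s 0] by (simp add: filterlim_at)
    then have "(\<lambda>n. ereal (dyad n s)) \<longlonglongrightarrow> ereal s" by simp
    then have "eventually (\<lambda>n. ereal (dyad n s) < t) sequentially"
      using True by (intro order_tendstoD(2)) auto
    then have "eventually (\<lambda>n. X (dyad n s) \<omega> =
        (if 0 \<le> s \<and> ereal (dyad n s) < t then X (dyad n s) \<omega> else 0)) sequentially"
      by eventually_elim (use True in simp)
    moreover have "(\<lambda>n. X (dyad n s) \<omega>) \<longlonglongrightarrow> X s \<omega>"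
      using X_dyad_tendsto[of \<omega> s 0] z True by simp
    ultimately show ?thesis using True by (simp add: z) (rule Lim_transform_eventually; simp)
  next
    case False
    have *: "\<not> (0 \<le> s \<and> ereal (dyad n s) < t)" for n
      using False dyad_gt[of s n] by (metis ereal_less_eq(3) less_imp_le order_le_less_trans)
    show ?thesis unfolding z prod.case if_not_P[OF *] if_not_P[OF False] by (rule tendsto_const)
  qed
qed

lemma X_random_time_measurable:
  assumes "\<tau> \<in> borel_measurable F" "\<And>\<omega>. \<omega> \<in> space F \<Longrightarrow> 0 \<le> \<tau> \<omega>"
  shows "(\<lambda>\<omega>. X (\<tau> \<omega>) \<omega>) \<in> borel_measurable F"
proof -
  have "(\<lambda>(s, \<omega>). if 0 \<le> s \<and> ereal s < \<infinity> then X s \<omega> else 0) \<in> borel_measurable (borel \<Otimes>\<^sub>M F)"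
    by (intro progressively_measurable X_measurable) auto
  moreover have "(\<lambda>\<omega>. (\<tau> \<omega>, \<omega>)) \<in> F \<rightarrow>\<^sub>M borel \<Otimes>\<^sub>M F" using assms by measurable
  ultimately have "(\<lambda>\<omega>. case (\<tau> \<omega>, \<omega>) of (s, \<omega>) \<Rightarrow> if 0 \<le> s \<and> ereal s < \<infinity> then X s \<omega> else 0)
      \<in> borel_measurable F"
    by (rule measurable_compose[rotated])
  then show ?thesis by (rule measurable_cong[THEN iffD1, rotated]) (simp add: assms)
qed

text \<open>The restriction of a stopping time to an event \<open>\<Lambda> \<subseteq> {T < \<infinity>}\<close> of the stopped \<open>\<sigma>\<close>-algebra;
  the values of \<open>T\<close> outside of \<open>\<Lambda>\<close> are irrelevant.\<close>

definition stopping_time_on :: "('w \<Rightarrow> real) \<Rightarrow> 'w set \<Rightarrow> bool" where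
  "stopping_time_on T \<Lambda> \<longleftrightarrow> \<Lambda> \<subseteq> space F \<and> (\<forall>\<omega>\<in>\<Lambda>. 0 \<le> T \<omega>) \<and>
     (\<forall>t>0. {\<omega>\<in>\<Lambda>. T \<omega> < t} \<in> sets (Ft t))"

lemma stopping_time_on_less:
  assumes "stopping_time_on T \<Lambda>" "u \<le> t" "0 \<le> t"
  shows "{\<omega>\<in>\<Lambda>. T \<omega> < u} \<in> sets (Ft t)"
proof (cases "0 < u")
  case True
  then show ?thesis
    using assms Ft_mono[of u t] unfolding stopping_time_on_def by auto
next
  case False
  then have "{\<omega>\<in>\<Lambda>. T \<omega> < u} = {}" using assms unfolding stopping_time_on_def by force
  then show ?thesis by (metis sets.empty_sets)
qed

lemma stopping_time_on_sets:
  assumes "stopping_time_on T \<Lambda>"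
  shows "\<Lambda> \<in> sets F"
proof -
  have "\<Lambda> = (\<Union>n. {\<omega>\<in>\<Lambda>. T \<omega> < real n})" by (auto simp: reals_Archimedean2)
  also have "\<dots> \<in> sets F"
    using stopping_time_on_less[OF assms order_refl] Ft_subalgebra
    by (intro sets.countable_UN) (meson image_subsetI of_nat_0_le_iff subsetD)
  finally show ?thesis .
qed

lemma stopping_time_on_measurable:
  assumes "stopping_time_on T \<Lambda>"
  shows "(\<lambda>\<omega>. if \<omega> \<in> \<Lambda> then T \<omega> else 0) \<in> borel_measurable F"
proof (rule borel_measurableI_less)
  fix a :: real
  note \<Lambda> = stopping_time_on_sets[OF assms]
  have "{\<omega>\<in>\<Lambda>. T \<omega> < a} \<in> sets F"
    using stopping_time_on_less[OF assms, of a "max a 0"] Ft_subalgebra[of "max a 0"] by auto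
  moreover have "{\<omega>\<in>space F. (if \<omega> \<in> \<Lambda> then T \<omega> else 0) < a} =
      {\<omega>\<in>\<Lambda>. T \<omega> < a} \<union> (if 0 < a then space F - \<Lambda> else {})"
    using sets.sets_into_space[OF \<Lambda>] by auto
  ultimately show "{\<omega>\<in>space F. (if \<omega> \<in> \<Lambda> then T \<omega> else 0) < a} \<in> sets F"
    using \<Lambda> by auto
qed

lemma stopped_measurable:
  assumes st: "stopping_time_on T \<Lambda>" and "0 \<le> d" "0 < t"
  shows "(\<lambda>\<omega>. if \<omega> \<in> \<Lambda> \<and> T \<omega> + d < t then X (T \<omega> + d) \<omega> else 0) \<in> borel_measurable (Ft t)"
proof -
  \<comment> \<open>The default \<open>-1\<close> is a time at which the progressively measurable
    map is 0, which reproduces the \<open>else\<close> branch of the goal.\<close>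
  define T' where "T' \<omega> = (if \<omega> \<in> \<Lambda> \<and> T \<omega> + d < t then T \<omega> + d else -1)" for \<omega>
  have pos: "0 \<le> T \<omega>" if "\<omega> \<in> \<Lambda>" for \<omega> using st that by (auto simp: stopping_time_on_def)
  have sp: "space (Ft t) = space F" using assms by (simp add: Ft_space)
  have "T' \<in> borel_measurable (Ft t)"
  proof (rule borel_measurableI_less)
    fix a :: real
    have *: "{\<omega>\<in>\<Lambda>. T \<omega> < u - d} \<in> sets (Ft t)" if "u \<le> t" for u
      by (rule stopping_time_on_less[OF st]) (use assms that in linarith)+
    have "{\<omega>\<in>space (Ft t). T' \<omega> < a} =
        {\<omega>\<in>\<Lambda>. T \<omega> < min t a - d} \<union> (if -1 < a then space (Ft t) - {\<omega>\<in>\<Lambda>. T \<omega> < t - d} else {})"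
      using st pos assms unfolding T'_def sp stopping_time_on_def by (auto simp: less_diff_eq)
    then show "{\<omega>\<in>space (Ft t). T' \<omega> < a} \<in> sets (Ft t)"
      using *[of "min t a"] *[of t] by auto
  qed
  then have "(\<lambda>\<omega>. (T' \<omega>, \<omega>)) \<in> Ft t \<rightarrow>\<^sub>M borel \<Otimes>\<^sub>M Ft t" by measurable
  moreover have "(\<lambda>(s, \<omega>). if 0 \<le> s \<and> ereal s < ereal t then X s \<omega> else 0)
      \<in> borel_measurable (borel \<Otimes>\<^sub>M Ft t)"
  proof (rule progressively_measurable[OF sp])
    fix s assume "0 \<le> s" "ereal s < ereal t"
    then show "X s \<in> borel_measurable (Ft t)"
      using adapted[of s] Ft_mono[of s t] Ft_space[of s] sp by (auto simp: measurable_def)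
  qed
  ultimately have "(\<lambda>\<omega>. case (T' \<omega>, \<omega>) of (s, \<omega>) \<Rightarrow> if 0 \<le> s \<and> ereal s < ereal t then X s \<omega> else 0)
      \<in> borel_measurable (Ft t)"
    by (rule measurable_compose)
  also have "(\<lambda>\<omega>. case (T' \<omega>, \<omega>) of (s, \<omega>) \<Rightarrow> if 0 \<le> s \<and> ereal s < ereal t then X s \<omega> else 0) =
      (\<lambda>\<omega>. if \<omega> \<in> \<Lambda> \<and> T \<omega> + d < t then X (T \<omega> + d) \<omega> else 0)"
    using pos assms by (auto simp: T'_def fun_eq_iff)
  finally show ?thesis .
qed

text \<open>This is what makes iteration possible: the event of a prescribed visit becomes the
  domain of the next stopping time. With \<open>d = 0\<close> it restricts \<open>T\<close> to paths
  stopped in \<open>B\<close>.\<close>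

lemma stopping_time_on_add:
  assumes st: "stopping_time_on T \<Lambda>" and d: "0 \<le> d" and B: "B \<in> sets borel"
  shows "stopping_time_on (\<lambda>\<omega>. T \<omega> + d) {\<omega>\<in>\<Lambda>. X (T \<omega> + d) \<omega> \<in> B}"
  unfolding stopping_time_on_def
proof (intro conjI allI impI)
  fix t :: real assume t: "0 < t"
  let ?g = "\<lambda>\<omega>. if \<omega> \<in> \<Lambda> \<and> T \<omega> + d < t then X (T \<omega> + d) \<omega> else 0"
  have "?g -` B \<inter> space (Ft t) \<in> sets (Ft t)"
    by (rule measurable_sets[OF stopped_measurable[OF st d t] B])
  moreover have "{\<omega>\<in>\<Lambda>. T \<omega> < t - d} \<in> sets (Ft t)"
    by (rule stopping_time_on_less[OF st]) (use d t in linarith)+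
  moreover have "{\<omega> \<in> {\<omega>\<in>\<Lambda>. X (T \<omega> + d) \<omega> \<in> B}. T \<omega> + d < t} =
      (?g -` B \<inter> space (Ft t)) \<inter> {\<omega>\<in>\<Lambda>. T \<omega> < t - d}"
    using st t by (auto simp: stopping_time_on_def Ft_space less_diff_eq split: if_splits)
  ultimately show "{\<omega> \<in> {\<omega>\<in>\<Lambda>. X (T \<omega> + d) \<omega> \<in> B}. T \<omega> + d < t} \<in> sets (Ft t)" by auto
qed (use st d in \<open>auto simp: stopping_time_on_def\<close>)

end

section \<open>The strong Markov property\<close>

locale convolution_process = right_process \<nu> F Ft X \<theta> P
  for \<nu> :: "real \<Rightarrow> 'e::{banach, second_countable_topology} measure"
    and F :: "'w measure" and Ft :: "real \<Rightarrow> 'w measure" and X :: "real \<Rightarrow> 'w \<Rightarrow> 'e"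
    and \<theta> :: "real \<Rightarrow> 'w \<Rightarrow> 'w" and P :: "'e \<Rightarrow> 'w measure" +
  assumes conv: "convolution_semigroup \<nu>"
begin

section \<open>The translation semigroup and its Feller property\<close>

lemma prob_nu: "0 \<le> t \<Longrightarrow> prob_space (\<nu> t)"
  and sets_nu: "0 \<le> t \<Longrightarrow> sets (\<nu> t) = sets borel"
  using conv by (auto simp: convolution_semigroup_def)

lemma add_measurable_nu: "0 \<le> t \<Longrightarrow> (\<lambda>y. x + y) \<in> \<nu> t \<rightarrow>\<^sub>M borel"
  by (simp add: measurable_cong_sets[OF sets_nu refl])

lemma sets_transition [simp]: "sets (transition \<nu> t x) = sets borel"
  by (simp add: transition_def)

lemma space_transition [simp]: "space (transition \<nu> t x) = UNIV"
  by (simp add: transition_def)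

lemma prob_transition: "0 \<le> t \<Longrightarrow> prob_space (transition \<nu> t x)"
  unfolding transition_def
  by (rule prob_space.prob_space_distr[OF prob_nu add_measurable_nu])

lemma transition_measurable: "0 \<le> t \<Longrightarrow> transition \<nu> t \<in> borel \<rightarrow>\<^sub>M subprob_algebra borel"
  unfolding transition_def[abs_def]
proof (rule measurable_distr2)
  show "(\<lambda>(x :: 'e, y). x + y) \<in> borel_measurable (borel \<Otimes>\<^sub>M borel)" by measurable
  assume "0 \<le> t"
  then show "(\<lambda>_. \<nu> t) \<in> borel \<rightarrow>\<^sub>M subprob_algebra borel"
    by (intro measurable_const)
      (auto simp: space_subprob_algebra sets_nu intro!: prob_space_imp_subprob_space prob_nu)
qed

lemma nn_integral_transition:
  "0 \<le> t \<Longrightarrow> f \<in> borel_measurable borel \<Longrightarrow>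
    (\<integral>\<^sup>+y. f y \<partial>transition \<nu> t x) = (\<integral>\<^sup>+y. f (x + y) \<partial>\<nu> t)"
  unfolding transition_def by (rule nn_integral_distr[OF add_measurable_nu]) auto

lemma nn_integral_transition_measurable:
  "0 \<le> t \<Longrightarrow> f \<in> borel_measurable borel \<Longrightarrow>
    (\<lambda>x. \<integral>\<^sup>+y. f y \<partial>transition \<nu> t x) \<in> borel_measurable borel"
  by (rule measurable_compose[OF transition_measurable nn_integral_measurable_subprob_algebra])

lemma markov_integral:
  assumes "0 \<le> s" "0 \<le> t" and A: "A \<in> sets (Ft s)" and f: "f \<in> borel_measurable borel"
  shows "(\<integral>\<^sup>+\<omega>\<in>A. f (X (s + t) \<omega>) \<partial>P x) = (\<integral>\<^sup>+\<omega>\<in>A. (\<integral>\<^sup>+y. f y \<partial>transition \<nu> t (X s \<omega>)) \<partial>P x)"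
proof (rule kernel_integral_extend[where S=borel])
  let ?D = "density (P x) (indicator A)"
  show AF: "A \<in> sets (P x)" using A Ft_subalgebra[OF \<open>0 \<le> s\<close>] by auto
  show Y: "X (s + t) \<in> P x \<rightarrow>\<^sub>M borel" and Z: "X s \<in> P x \<rightarrow>\<^sub>M borel"
    using X_measurable assms by (simp_all cong: measurable_cong_sets)
  show "distr ?D borel (X (s + t)) = distr ?D borel (X s) \<bind> transition \<nu> t"
  proof (rule measure_eqI)
    fix B assume "B \<in> sets (distr ?D borel (X (s + t)))"
    then have B: "B \<in> sets borel" by simp
    have m: "(\<lambda>y. emeasure (transition \<nu> t y) B) \<in> borel_measurable borel"
      using measurable_compose[OF transition_measurable[OF \<open>0 \<le> t\<close>] measurable_emeasure_subprob_algebra[OF B]] .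
    have S: "X (s + t) -` B \<inter> space (P x) \<in> sets (P x)" by (rule measurable_sets[OF Y B])
    have "emeasure (distr ?D borel (X (s + t))) B = emeasure ?D (X (s + t) -` B \<inter> space (P x))"
      using B Y by (subst emeasure_distr) auto
    also have "\<dots> = emeasure (P x) (A \<inter> (X (s + t) -` B \<inter> space (P x)))"
      by (rule emeasure_restricted[OF AF S])
    also have "A \<inter> (X (s + t) -` B \<inter> space (P x)) = {\<omega>\<in>A. X (s + t) \<omega> \<in> B}"
      using sets.sets_into_space[OF AF] by auto
    also have "emeasure (P x) \<dots> = (\<integral>\<^sup>+\<omega>\<in>A. emeasure (transition \<nu> t (X s \<omega>)) B \<partial>P x)"
      by (rule markov) fact+
    also have "\<dots> = (\<integral>\<^sup>+z. emeasure (transition \<nu> t z) B \<partial>distr ?D borel (X s))"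
      using AF Z m by (subst nn_integral_distr) (auto simp: nn_integral_density mult.commute)
    also have "\<dots> = emeasure (distr ?D borel (X s) \<bind> transition \<nu> t) B"
      using B transition_measurable[OF \<open>0 \<le> t\<close>] by (subst emeasure_bind) auto
    finally show "emeasure (distr ?D borel (X (s + t))) B = emeasure (distr ?D borel (X s) \<bind> transition \<nu> t) B" .
  qed simp
qed (use assms transition_measurable P.not_empty P.finite_measure_axioms in auto)

text \<open>The starting point enters only through the translated integrand
  \<open>f (x n + z)\<close>, so dominated convergence under \<open>\<nu> t\<close> suffices. This
  Feller property replaces an assumed strong Markov property.\<close>

lemma transition_continuous:
  assumes t: "0 \<le> t" and f: "continuous_on UNIV f" "\<And>x. 0 \<le> f x \<and> f x \<le> (1::real)" and x: "x \<longlonglongrightarrow> y"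
  shows "(\<lambda>n. \<integral>\<^sup>+z. ennreal (f z) \<partial>transition \<nu> t (x n)) \<longlonglongrightarrow> (\<integral>\<^sup>+z. ennreal (f z) \<partial>transition \<nu> t y)"
proof -
  interpret prob_space "\<nu> t" using t by (rule prob_nu)
  have [measurable]: "f \<in> borel_measurable borel" by (rule borel_measurable_continuous_onI[OF f(1)])
  note [measurable_cong] = sets_nu[OF t]
  have "(\<lambda>n. \<integral>\<^sup>+z. ennreal (f (x n + z)) \<partial>\<nu> t) \<longlonglongrightarrow> (\<integral>\<^sup>+z. ennreal (f (y + z)) \<partial>\<nu> t)"
  proof (rule tendsto_dominated_nn_integral_le_1[OF finite_measure_axioms])
    fix z
    have "(\<lambda>n. f (x n + z)) \<longlonglongrightarrow> f (y + z)"
      using f(1) x by (intro continuous_on_tendsto_compose[OF f(1)] tendsto_intros) auto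
    then show "(\<lambda>n. ennreal (f (x n + z))) \<longlonglongrightarrow> ennreal (f (y + z))" by (intro tendsto_intros)
  qed (use f(2) in \<open>auto simp: ennreal_le_1\<close>)
  then show ?thesis by (simp add: nn_integral_transition t)
qed

section \<open>From dyadic times to stopping times\<close>

text \<open>The rounded time has countably many values. On each piece \<open>\<Lambda>' k\<close> it
  is the constant \<open>r k\<close>, and as rounding goes upward, the piece is already known at
  time \<open>r k\<close>; the simple Markov property applies there.\<close>

lemma strong_markov_dyadic:
  assumes st: "stopping_time_on T \<Lambda>" and d: "0 \<le> d" and f: "f \<in> borel_measurable borel"
  shows "(\<integral>\<^sup>+\<omega>\<in>\<Lambda>. f (X (dyad n (T \<omega>) + d) \<omega>) \<partial>P x) =
    (\<integral>\<^sup>+\<omega>\<in>\<Lambda>. (\<integral>\<^sup>+y. f y \<partial>transition \<nu> d (X (dyad n (T \<omega>)) \<omega>)) \<partial>P x)"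
proof -
  define r where "r k = (real k + 1) / 2 ^ n" for k
  define \<Lambda>' where "\<Lambda>' k = {\<omega>\<in>\<Lambda>. dyad n (T \<omega>) = r k}" for k
  have r: "0 \<le> r k" for k by (simp add: r_def)
  have disj: "disjoint_family \<Lambda>'"
    by (auto simp: disjoint_family_on_def \<Lambda>'_def r_def)
  have ex: "\<exists>k. \<omega> \<in> \<Lambda>' k" if "\<omega> \<in> \<Lambda>" for \<omega>
  proof -
    have "0 \<le> T \<omega>" using st that by (simp add: stopping_time_on_def)
    then show ?thesis
      using that by (intro exI[of _ "nat \<lfloor>2 ^ n * T \<omega>\<rfloor>"]) (simp add: \<Lambda>'_def r_def dyad_def)
  qed
  have \<Lambda>': "\<Lambda>' k \<in> sets (Ft (r k))" for k
  proof -
    have "\<Lambda>' k = {\<omega>\<in>\<Lambda>. T \<omega> < r k} - {\<omega>\<in>\<Lambda>. T \<omega> < real k / 2 ^ n}"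
    proof -
      have "dyad n t = r k \<longleftrightarrow> t < r k \<and> \<not> t < real k / 2 ^ n" for t
      proof -
        have "dyad n t = r k \<longleftrightarrow> \<lfloor>2 ^ n * t\<rfloor> = int k"
          by (auto simp: dyad_def r_def)
        also have "\<dots> \<longleftrightarrow> real k \<le> 2 ^ n * t \<and> 2 ^ n * t < real k + 1"
          by (simp add: floor_eq_iff)
        also have "\<dots> \<longleftrightarrow> t < r k \<and> \<not> t < real k / 2 ^ n"
          by (auto simp: r_def field_simps)
        finally show ?thesis .
      qed
      then show ?thesis by (auto simp: \<Lambda>'_def)
    qed
    moreover have "real k / 2 ^ n \<le> r k" by (simp add: r_def divide_right_mono)
    ultimately show ?thesis
      using stopping_time_on_less[OF st _ r] by auto
  qed
  have \<Lambda>'F: "\<Lambda>' k \<in> sets F" for k using \<Lambda>' Ft_subalgebra[OF r] by blast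
  have split: "(\<integral>\<^sup>+\<omega>\<in>\<Lambda>. g (dyad n (T \<omega>)) \<omega> \<partial>P x) = (\<Sum>k. \<integral>\<^sup>+\<omega>\<in>\<Lambda>' k. g (r k) \<omega> \<partial>P x)"
    if g: "\<And>t. 0 \<le> t \<Longrightarrow> g t \<in> borel_measurable F" for g :: "real \<Rightarrow> _ \<Rightarrow> ennreal"
  proof -
    have "(\<integral>\<^sup>+\<omega>\<in>\<Lambda>. g (dyad n (T \<omega>)) \<omega> \<partial>P x) = (\<integral>\<^sup>+\<omega>. (\<Sum>k. g (r k) \<omega> * indicator (\<Lambda>' k) \<omega>) \<partial>P x)"
    proof (rule nn_integral_cong)
      fix \<omega>
      show "g (dyad n (T \<omega>)) \<omega> * indicator \<Lambda> \<omega> = (\<Sum>k. g (r k) \<omega> * indicator (\<Lambda>' k) \<omega>)"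
      proof (cases "\<omega> \<in> \<Lambda>")
        case True
        then obtain k where k: "\<omega> \<in> \<Lambda>' k" using ex by blast
        then show ?thesis
          using suminf_cmult_indicator[OF disj k, of "\<lambda>k. g (r k) \<omega>"] True by (simp add: \<Lambda>'_def)
      next
        case False
        then show ?thesis by (simp add: \<Lambda>'_def)
      qed
    qed
    also have "\<dots> = (\<Sum>k. \<integral>\<^sup>+\<omega>\<in>\<Lambda>' k. g (r k) \<omega> \<partial>P x)"
    proof (rule nn_integral_suminf)
      fix k
      have "g (r k) \<in> borel_measurable (P x)" using g[OF r] by (simp cong: measurable_cong_sets)
      then show "(\<lambda>\<omega>. g (r k) \<omega> * indicator (\<Lambda>' k) \<omega>) \<in> borel_measurable (P x)"
        using \<Lambda>'F by measurable
    qed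
    finally show ?thesis .
  qed
  have "(\<integral>\<^sup>+\<omega>\<in>\<Lambda>. f (X (dyad n (T \<omega>) + d) \<omega>) \<partial>P x) =
      (\<Sum>k. \<integral>\<^sup>+\<omega>\<in>\<Lambda>' k. f (X (r k + d) \<omega>) \<partial>P x)"
    by (rule split) (use d in \<open>auto intro!: measurable_compose[OF X_measurable f]\<close>)
  also have "\<dots> = (\<Sum>k. \<integral>\<^sup>+\<omega>\<in>\<Lambda>' k. (\<integral>\<^sup>+y. f y \<partial>transition \<nu> d (X (r k) \<omega>)) \<partial>P x)"
    using markov_integral[OF r d \<Lambda>' f] by simp
  also have "\<dots> = (\<integral>\<^sup>+\<omega>\<in>\<Lambda>. (\<integral>\<^sup>+y. f y \<partial>transition \<nu> d (X (dyad n (T \<omega>)) \<omega>)) \<partial>P x)"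
    by (rule split[symmetric])
      (use measurable_compose[OF X_measurable nn_integral_transition_measurable[OF d f]] in blast)
  finally show ?thesis .
qed

text \<open>Dyadic times decrease to \<open>T\<close>. For bounded continuous integrands the left
  side converges by right-continuity of the paths and the right side by the Feller property; such
  integrands determine the law.\<close>

theorem strong_markov:
  assumes st: "stopping_time_on T \<Lambda>" and d: "0 \<le> d" and f: "f \<in> borel_measurable borel"
  shows "(\<integral>\<^sup>+\<omega>\<in>\<Lambda>. f (X (T \<omega> + d) \<omega>) \<partial>P x) =
    (\<integral>\<^sup>+\<omega>\<in>\<Lambda>. (\<integral>\<^sup>+y. f y \<partial>transition \<nu> d (X (T \<omega>) \<omega>)) \<partial>P x)"
proof -
  \<comment> \<open>The values of \<open>T\<close> off \<open>\<Lambda>\<close> are arbitrary, so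
    measurability on all of \<open>F\<close> is available only after resetting them.\<close>
  define T' where "T' \<omega> = (if \<omega> \<in> \<Lambda> then T \<omega> else 0)" for \<omega>
  have \<Lambda>: "\<Lambda> \<in> sets F" by (rule stopping_time_on_sets[OF st])
  have T'_pos: "0 \<le> T' \<omega>" for \<omega> using st by (simp add: T'_def stopping_time_on_def)
  have T'_eq: "(\<integral>\<^sup>+\<omega>\<in>\<Lambda>. g (T' \<omega>) \<omega> \<partial>P x) = (\<integral>\<^sup>+\<omega>\<in>\<Lambda>. g (T \<omega>) \<omega> \<partial>P x)"
    for g :: "real \<Rightarrow> _ \<Rightarrow> ennreal"
    by (rule nn_integral_cong) (simp add: T'_def split: split_indicator)
  have T'm: "T' \<in> borel_measurable F"
    unfolding T'_def[abs_def] by (rule stopping_time_on_measurable[OF st])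
  have XTm: "(\<lambda>\<omega>. X (T' \<omega> + e) \<omega>) \<in> borel_measurable F" if "0 \<le> e" for e
    using T'm T'_pos that by (intro X_random_time_measurable) auto
  have XDm: "(\<lambda>\<omega>. X (dyad n (T' \<omega>) + e) \<omega>) \<in> borel_measurable F" if "0 \<le> e" for e n
  proof (rule X_random_time_measurable)
    show "0 \<le> dyad n (T' \<omega>) + e" for \<omega>
      using that dyad_gt[of "T' \<omega>" n] T'_pos[of \<omega>] by simp
  qed (use T'm in measurable)
  let ?D = "density (P x) (indicator \<Lambda>)"
  have fin_D: "finite_measure ?D"
    using P.finite_measure_restricted[of \<Lambda> x] \<Lambda> by simp
  have conv1: "(\<lambda>n. \<integral>\<^sup>+\<omega>\<in>\<Lambda>. u n \<omega> \<partial>P x) \<longlonglongrightarrow> (\<integral>\<^sup>+\<omega>\<in>\<Lambda>. u' \<omega> \<partial>P x)"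
    if "\<And>n. u n \<in> borel_measurable F" "u' \<in> borel_measurable F" "\<And>n \<omega>. u n \<omega> \<le> 1"
      "\<And>\<omega>. \<omega> \<in> space F \<Longrightarrow> (\<lambda>n. u n \<omega>) \<longlonglongrightarrow> u' \<omega>" for u and u' :: "_ \<Rightarrow> ennreal"
  proof (rule tendsto_dominated_nn_integral_le_1)
    show "(\<lambda>\<omega>. u n \<omega> * indicator \<Lambda> \<omega>) \<in> borel_measurable (P x)" for n using that(1)[of n] \<Lambda> by measurable
    show "(\<lambda>\<omega>. u' \<omega> * indicator \<Lambda> \<omega>) \<in> borel_measurable (P x)" using that(2) \<Lambda> by measurable
    show "u n \<omega> * indicator \<Lambda> \<omega> \<le> 1" for n \<omega> using that(3)[of n \<omega>] by (simp split: split_indicator)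
    show "(\<lambda>n. u n \<omega> * indicator \<Lambda> \<omega>) \<longlonglongrightarrow> u' \<omega> * indicator \<Lambda> \<omega>" if "\<omega> \<in> space (P x)" for \<omega>
      using \<open>\<And>\<omega>. \<omega> \<in> space F \<Longrightarrow> (\<lambda>n. u n \<omega>) \<longlonglongrightarrow> u' \<omega>\<close>[of \<omega>] that by (auto split: split_indicator)
  qed (rule P.finite_measure_axioms)
  have cont_eq: "(\<integral>\<^sup>+\<omega>\<in>\<Lambda>. ennreal (g (X (T' \<omega> + d) \<omega>)) \<partial>P x) =
      (\<integral>\<^sup>+\<omega>\<in>\<Lambda>. (\<integral>\<^sup>+y. ennreal (g y) \<partial>transition \<nu> d (X (T' \<omega>) \<omega>)) \<partial>P x)"
    if g: "continuous_on UNIV g" "\<And>x. 0 \<le> g x \<and> g x \<le> (1::real)" for g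
  proof (rule LIMSEQ_unique)
    have gm [measurable]: "g \<in> borel_measurable borel" by (rule borel_measurable_continuous_onI[OF g(1)])
    have Pg: "(\<lambda>y. \<integral>\<^sup>+z. ennreal (g z) \<partial>transition \<nu> d y) \<in> borel_measurable borel"
      by (rule nn_integral_transition_measurable[OF d]) measurable
    show "(\<lambda>n. \<integral>\<^sup>+\<omega>\<in>\<Lambda>. ennreal (g (X (dyad n (T' \<omega>) + d) \<omega>)) \<partial>P x) \<longlonglongrightarrow>
        (\<integral>\<^sup>+\<omega>\<in>\<Lambda>. ennreal (g (X (T' \<omega> + d) \<omega>)) \<partial>P x)"
    proof (rule conv1)
      fix \<omega> assume \<omega>: "\<omega> \<in> space F"
      show "(\<lambda>n. ennreal (g (X (dyad n (T' \<omega>) + d) \<omega>))) \<longlonglongrightarrow> ennreal (g (X (T' \<omega> + d) \<omega>))"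
        using g(1) X_dyad_tendsto[OF \<omega> T'_pos d]
        by (intro tendsto_ennrealI continuous_on_tendsto_compose[OF g(1)]) auto
    qed (use XDm[OF d] XTm[OF d] g(2) gm in \<open>auto simp: ennreal_le_1 intro: measurable_compose\<close>)
    have "(\<lambda>n. \<integral>\<^sup>+\<omega>\<in>\<Lambda>. (\<integral>\<^sup>+y. ennreal (g y) \<partial>transition \<nu> d (X (dyad n (T' \<omega>)) \<omega>)) \<partial>P x) \<longlonglongrightarrow>
        (\<integral>\<^sup>+\<omega>\<in>\<Lambda>. (\<integral>\<^sup>+y. ennreal (g y) \<partial>transition \<nu> d (X (T' \<omega>) \<omega>)) \<partial>P x)"
    proof (rule conv1)
      show "(\<lambda>\<omega>. \<integral>\<^sup>+y. ennreal (g y) \<partial>transition \<nu> d (X (dyad n (T' \<omega>)) \<omega>)) \<in> borel_measurable F" for n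
        using measurable_compose[OF XDm[of 0 n] Pg] by simp
      show "(\<lambda>\<omega>. \<integral>\<^sup>+y. ennreal (g y) \<partial>transition \<nu> d (X (T' \<omega>) \<omega>)) \<in> borel_measurable F"
        using measurable_compose[OF XTm[of 0] Pg] by simp
      show "(\<integral>\<^sup>+y. ennreal (g y) \<partial>transition \<nu> d (X (dyad n (T' \<omega>)) \<omega>)) \<le> 1" for n \<omega>
      proof -
        interpret prob_space "transition \<nu> d (X (dyad n (T' \<omega>)) \<omega>)" by (rule prob_transition[OF d])
        show ?thesis
          using nn_integral_mono[of "transition \<nu> d (X (dyad n (T' \<omega>)) \<omega>)" "\<lambda>y. ennreal (g y)" "\<lambda>_. 1"]
            g(2) emeasure_space_1 by simp
      qed
      fix \<omega> assume \<omega>: "\<omega> \<in> space F"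
      show "(\<lambda>n. \<integral>\<^sup>+y. ennreal (g y) \<partial>transition \<nu> d (X (dyad n (T' \<omega>)) \<omega>)) \<longlonglongrightarrow>
          (\<integral>\<^sup>+y. ennreal (g y) \<partial>transition \<nu> d (X (T' \<omega>) \<omega>))"
        using X_dyad_tendsto[OF \<omega> T'_pos, of 0] by (intro transition_continuous d g) simp_all
    qed
    moreover have "(\<integral>\<^sup>+\<omega>\<in>\<Lambda>. (\<integral>\<^sup>+y. ennreal (g y) \<partial>transition \<nu> d (X (dyad n (T' \<omega>)) \<omega>)) \<partial>P x) =
        (\<integral>\<^sup>+\<omega>\<in>\<Lambda>. ennreal (g (X (dyad n (T' \<omega>) + d) \<omega>)) \<partial>P x)" for n
    proof -
      have "(\<lambda>y. ennreal (g y)) \<in> borel_measurable borel" by measurable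
      note strong_markov_dyadic[OF st d this, where n=n and x=x]
      then show ?thesis
        using T'_eq[of "\<lambda>t \<omega>. ennreal (g (X (dyad n t + d) \<omega>))"]
          T'_eq[of "\<lambda>t \<omega>. \<integral>\<^sup>+y. ennreal (g y) \<partial>transition \<nu> d (X (dyad n t) \<omega>)"] by simp
    qed
    ultimately show "(\<lambda>n. \<integral>\<^sup>+\<omega>\<in>\<Lambda>. ennreal (g (X (dyad n (T' \<omega>) + d) \<omega>)) \<partial>P x) \<longlonglongrightarrow>
        (\<integral>\<^sup>+\<omega>\<in>\<Lambda>. (\<integral>\<^sup>+y. ennreal (g y) \<partial>transition \<nu> d (X (T' \<omega>) \<omega>)) \<partial>P x)"
      by simp
  qed
  have Y: "(\<lambda>\<omega>. X (T' \<omega> + d) \<omega>) \<in> borel_measurable (P x)" using XTm[OF d] by (simp cong: measurable_cong_sets)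
  have Z: "(\<lambda>\<omega>. X (T' \<omega>) \<omega>) \<in> borel_measurable (P x)" using XTm[of 0] by (simp cong: measurable_cong_sets)
  let ?M = "distr ?D borel (\<lambda>\<omega>. X (T' \<omega> + d) \<omega>)"
  let ?N = "distr ?D borel (\<lambda>\<omega>. X (T' \<omega>) \<omega>) \<bind> transition \<nu> d"
  have "?M = ?N"
  proof (rule measure_eq_if_continuous_integrals_eq)
    show "finite_measure ?M" using fin_D Y by (intro finite_measure.finite_measure_distr) auto
    show sN: "sets ?N = sets borel" by simp
    have "emeasure ?N (space ?N) = (\<integral>\<^sup>+z. 1 \<partial>distr ?D borel (\<lambda>\<omega>. X (T' \<omega>) \<omega>))"
    proof -
      have "emeasure ?N (space ?N) = emeasure ?N UNIV" by (simp add: sets_eq_imp_space_eq[OF sN])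
      also have "\<dots> = (\<integral>\<^sup>+z. emeasure (transition \<nu> d z) UNIV \<partial>distr ?D borel (\<lambda>\<omega>. X (T' \<omega>) \<omega>))"
        using transition_measurable[OF d] by (subst emeasure_bind) auto
      also have "\<dots> = (\<integral>\<^sup>+z. 1 \<partial>distr ?D borel (\<lambda>\<omega>. X (T' \<omega>) \<omega>))"
        using prob_space.emeasure_space_1[OF prob_transition[OF d]] by simp
      finally show ?thesis .
    qed
    also have "\<dots> < \<infinity>"
    proof -
      have "finite_measure (distr ?D borel (\<lambda>\<omega>. X (T' \<omega>) \<omega>))"
        using fin_D Z by (intro finite_measure.finite_measure_distr) auto
      from finite_measure.emeasure_finite[OF this] show ?thesis by (simp add: less_top[symmetric])
    qed
    finally show "finite_measure ?N" by (intro finite_measureI) simp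
    fix g :: "'e \<Rightarrow> real" assume g: "continuous_on UNIV g" "\<And>x. 0 \<le> g x \<and> g x \<le> 1"
    have gm [measurable]: "g \<in> borel_measurable borel" by (rule borel_measurable_continuous_onI[OF g(1)])
    have gm': "(\<lambda>y. ennreal (g y)) \<in> borel_measurable borel" by measurable
    have Pg: "(\<lambda>y. \<integral>\<^sup>+z. ennreal (g z) \<partial>transition \<nu> d y) \<in> borel_measurable borel"
      by (rule nn_integral_transition_measurable[OF d gm'])
    have "(\<integral>\<^sup>+y. ennreal (g y) \<partial>?M) = (\<integral>\<^sup>+\<omega>\<in>\<Lambda>. ennreal (g (X (T' \<omega> + d) \<omega>)) \<partial>P x)"
      using Y gm' \<Lambda> by (subst nn_integral_distr) (auto simp: nn_integral_density mult.commute)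
    also have "\<dots> = (\<integral>\<^sup>+\<omega>\<in>\<Lambda>. (\<integral>\<^sup>+y. ennreal (g y) \<partial>transition \<nu> d (X (T' \<omega>) \<omega>)) \<partial>P x)"
      by (rule cont_eq[OF g])
    also have "\<dots> = (\<integral>\<^sup>+z. (\<integral>\<^sup>+y. ennreal (g y) \<partial>transition \<nu> d z) \<partial>distr ?D borel (\<lambda>\<omega>. X (T' \<omega>) \<omega>))"
      using Z Pg \<Lambda> by (subst nn_integral_distr) (auto simp: nn_integral_density mult.commute)
    also have "\<dots> = (\<integral>\<^sup>+y. ennreal (g y) \<partial>?N)"
      using transition_measurable[OF d] by (intro nn_integral_bind[OF gm', symmetric]) simp
    finally show "(\<integral>\<^sup>+y. ennreal (g y) \<partial>?M) = (\<integral>\<^sup>+y. ennreal (g y) \<partial>?N)" .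
  qed simp
  then have "(\<integral>\<^sup>+\<omega>\<in>\<Lambda>. f (X (T' \<omega> + d) \<omega>) \<partial>P x) =
      (\<integral>\<^sup>+\<omega>\<in>\<Lambda>. (\<integral>\<^sup>+y. f y \<partial>transition \<nu> d (X (T' \<omega>) \<omega>)) \<partial>P x)"
    using \<Lambda> Y Z f transition_measurable[OF d] P.not_empty P.finite_measure_axioms
    by (intro kernel_integral_extend[where S=borel]) auto
  then show ?thesis
    using T'_eq[of "\<lambda>t \<omega>. f (X (t + d) \<omega>)"] T'_eq[of "\<lambda>t \<omega>. \<integral>\<^sup>+y. f y \<partial>transition \<nu> d (X t \<omega>)"]
    by simp
qed

text \<open>
  An element \<open>(d, B)\<close> of the list prescribes \<open>X \<in> B\<close> after a further time \<open>d\<close>.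
\<close>

primrec visits :: "(real \<times> 'e set) list \<Rightarrow> real \<Rightarrow> 'w \<Rightarrow> bool" where
  "visits [] t \<omega> \<longleftrightarrow> True"
| "visits (p # l) t \<omega> \<longleftrightarrow> X (t + fst p) \<omega> \<in> snd p \<and> visits l (t + fst p) \<omega>"

primrec visit_prob :: "(real \<times> 'e set) list \<Rightarrow> 'e \<Rightarrow> ennreal" where
  "visit_prob [] y = 1"
| "visit_prob (p # l) y = (\<integral>\<^sup>+z. indicator (snd p) z * visit_prob l z \<partial>transition \<nu> (fst p) y)"

definition admissible :: "(real \<times> 'e set) list \<Rightarrow> bool" where
  "admissible l \<longleftrightarrow> (\<forall>p\<in>set l. 0 \<le> fst p \<and> snd p \<in> sets borel)"

lemma visit_prob_measurable: "admissible l \<Longrightarrow> visit_prob l \<in> borel_measurable borel"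
proof (induction l)
  case Nil
  then show ?case by simp
next
  case (Cons p l)
  then have "visit_prob l \<in> borel_measurable borel" "snd p \<in> sets borel" "0 \<le> fst p"
    by (auto simp: admissible_def)
  then have "(\<lambda>z. indicator (snd p) z * visit_prob l z) \<in> borel_measurable borel" by measurable
  then show ?case
    using nn_integral_transition_measurable[OF \<open>0 \<le> fst p\<close>] by simp
qed

text \<open>The pair \<open>(T, \<Lambda>)\<close> varies in the induction: the first visit is
  absorbed into the new time \<open>T + d\<close> and the smaller domain, and the tail is left to
  the induction hypothesis.\<close>

lemma strong_markov_visits:
  assumes "stopping_time_on T \<Lambda>" "admissible l"
  shows "emeasure (P x) {\<omega>\<in>\<Lambda>. visits l (T \<omega>) \<omega>} = (\<integral>\<^sup>+\<omega>\<in>\<Lambda>. visit_prob l (X (T \<omega>) \<omega>) \<partial>P x)"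
  using assms
proof (induction l arbitrary: T \<Lambda>)
  case Nil
  then show ?case using stopping_time_on_sets[OF Nil(1)] by simp
next
  case (Cons p l)
  obtain d B where p: "p = (d, B)" by (cases p)
  have adm: "admissible l" "0 \<le> d" "B \<in> sets borel"
    using Cons.prems(2) by (auto simp: admissible_def p)
  let ?\<Lambda> = "{\<omega>\<in>\<Lambda>. X (T \<omega> + d) \<omega> \<in> B}"
  let ?f = "\<lambda>z. indicator B z * visit_prob l z"
  have "{\<omega>\<in>\<Lambda>. visits (p # l) (T \<omega>) \<omega>} = {\<omega>\<in>?\<Lambda>. visits l (T \<omega> + d) \<omega>}"
    by (auto simp: p)
  then have "emeasure (P x) {\<omega>\<in>\<Lambda>. visits (p # l) (T \<omega>) \<omega>} =
      (\<integral>\<^sup>+\<omega>\<in>?\<Lambda>. visit_prob l (X (T \<omega> + d) \<omega>) \<partial>P x)"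
    using Cons.IH[OF stopping_time_on_add[OF Cons.prems(1) adm(2,3)] adm(1)] by simp
  also have "\<dots> = (\<integral>\<^sup>+\<omega>\<in>\<Lambda>. ?f (X (T \<omega> + d) \<omega>) \<partial>P x)"
    by (rule nn_integral_cong) (simp split: split_indicator)
  also have "\<dots> = (\<integral>\<^sup>+\<omega>\<in>\<Lambda>. (\<integral>\<^sup>+z. ?f z \<partial>transition \<nu> d (X (T \<omega>) \<omega>)) \<partial>P x)"
    using adm visit_prob_measurable[OF adm(1)] by (intro strong_markov Cons.prems(1)) auto
  finally show ?case by (simp add: p)
qed

lemma stopping_time_on_0: "stopping_time_on (\<lambda>_. 0) (space F)"
  using Ft_space sets.top by (auto simp: stopping_time_on_def) (metis less_imp_le sets.top)

text \<open>With \<open>T = 0\<close> and normality, \<open>visit_prob\<close> is identified as a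
  finite-dimensional distribution under \<open>P y\<close>; the strong Markov formula thereby
  becomes a statement about the laws \<open>P y\<close>.\<close>

lemma emeasure_visits:
  assumes "admissible l"
  shows "emeasure (P y) {\<omega>\<in>space F. visits l 0 \<omega>} = visit_prob l y"
proof -
  have "emeasure (P y) {\<omega>\<in>space F. visits l 0 \<omega>} = (\<integral>\<^sup>+\<omega>\<in>space F. visit_prob l (X 0 \<omega>) \<partial>P y)"
    by (rule strong_markov_visits[OF stopping_time_on_0 assms])
  also have "\<dots> = (\<integral>\<^sup>+\<omega>. visit_prob l y \<partial>P y)"
  proof (rule nn_integral_cong_AE)
    show "AE \<omega> in P y. visit_prob l (X 0 \<omega>) * indicator (space F) \<omega> = visit_prob l y"
      using normal[of y] AE_space by eventually_elim simp
  qed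
  also have "\<dots> = visit_prob l y" using P.emeasure_space_1[of y] by simp
  finally show ?thesis .
qed

lemma visits_cylinder:
  assumes "finite J" "J \<subseteq> {0..}" "\<And>i. B i \<in> sets borel"
  shows "\<exists>l. admissible l \<and> (\<forall>t \<omega>. visits l t \<omega> \<longleftrightarrow> (\<forall>i\<in>J. X (t + i) \<omega> \<in> B i))"
proof -
  \<comment> \<open>Here \<open>s\<close> is the last time already used; along a sorted list
    absolute times turn into nonnegative gaps \<open>u - s\<close>.\<close>
  have "\<exists>l. admissible l \<and> (\<forall>t \<omega>. visits l (t + s) \<omega> \<longleftrightarrow> (\<forall>i\<in>set ts. X (t + i) \<omega> \<in> B i))"
    if "sorted ts" "\<forall>u\<in>set ts. s \<le> u" for s ts
    using that
  proof (induction ts arbitrary: s)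
    case Nil
    then show ?case by (intro exI[of _ "[]"]) (simp add: admissible_def)
  next
    case (Cons u ts)
    then obtain l where l: "admissible l"
      "\<And>t \<omega>. visits l (t + u) \<omega> \<longleftrightarrow> (\<forall>i\<in>set ts. X (t + i) \<omega> \<in> B i)"
      by fastforce
    show ?case
      using l Cons.prems assms(3) by (intro exI[of _ "(u - s, B u) # l"]) (auto simp: admissible_def)
  qed
  from this[of "sorted_list_of_set J" 0] show ?thesis using assms by auto
qed

section \<open>Path space without completion\<close>

definition cylinders :: "'w set set" where
  "cylinders = {{\<omega>\<in>space F. \<forall>i\<in>J. X i \<omega> \<in> B i} | J B.
     finite J \<and> J \<subseteq> {0..} \<and> (\<forall>i. B i \<in> sets borel)}"

text \<open>For events of \<open>F\<close> the map from \<open>y\<close> to \<open>P y A\<close> is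
  merely universally measurable, and the axioms do not control preimages under shifts. On the
  sigma-algebra generated by the process both can be proved Borel or measurable by
  induction.\<close>

definition path_algebra :: "'w measure" where
  "path_algebra = sigma (space F) cylinders"

lemma cylinders_closed: "cylinders \<subseteq> Pow (space F)"
  by (auto simp: cylinders_def)

lemma space_path_algebra [simp]: "space path_algebra = space F"
  by (simp add: path_algebra_def space_measure_of_conv)

lemma sets_path_algebra: "sets path_algebra = sigma_sets (space F) cylinders"
  using cylinders_closed by (simp add: path_algebra_def)

lemma cylinders_sets: "cylinders \<subseteq> sets F"
proof
  fix C assume "C \<in> cylinders"
  then obtain J B where C: "C = {\<omega>\<in>space F. \<forall>i\<in>J. X i \<omega> \<in> B i}"
    and J: "finite J" "J \<subseteq> {0..}" and B: "\<And>i. B i \<in> sets borel"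
    by (auto simp: cylinders_def)
  have "{\<omega>\<in>space F. X i \<omega> \<in> B i} \<in> sets F" if "i \<in> J" for i
    using measurable_sets[OF X_measurable[of i] B] that J
    by (auto simp: vimage_def Int_def conj_commute)
  then show "C \<in> sets F"
    unfolding C using J by (intro sets.sets_Collect_finite_All) auto
qed

lemma path_algebra_sets: "sets path_algebra \<subseteq> sets F"
  using sets.sigma_sets_subset[OF cylinders_sets] by (simp add: sets_path_algebra)

lemma X_measurable_path_algebra:
  assumes "0 \<le> t"
  shows "X t \<in> borel_measurable path_algebra"
proof (rule measurableI)
  fix B :: "'e set" assume "B \<in> sets borel"
  then have "{\<omega>\<in>space F. \<forall>i\<in>{t}. X i \<omega> \<in> B} \<in> cylinders"
    unfolding cylinders_def using assms by (intro CollectI exI[of _ "{t}"] exI[of _ "\<lambda>_. B"]) auto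
  moreover have "{\<omega>\<in>space F. \<forall>i\<in>{t}. X i \<omega> \<in> B} = X t -` B \<inter> space path_algebra" by auto
  ultimately show "X t -` B \<inter> space path_algebra \<in> sets path_algebra"
    unfolding sets_path_algebra by auto
qed simp

lemma Int_stable_cylinders: "Int_stable cylinders"
proof (rule Int_stableI)
  fix C D assume "C \<in> cylinders" "D \<in> cylinders"
  then obtain J B K B' where C: "C = {\<omega>\<in>space F. \<forall>i\<in>J. X i \<omega> \<in> B i}"
      "finite J" "J \<subseteq> {0..}" "\<And>i. B i \<in> sets borel"
    and D: "D = {\<omega>\<in>space F. \<forall>i\<in>K. X i \<omega> \<in> B' i}" "finite K" "K \<subseteq> {0..}" "\<And>i. B' i \<in> sets borel"
    unfolding cylinders_def by blast
  \<comment> \<open>Each family constrains only its own index set; elsewhere its values are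
    arbitrary and must be replaced by \<open>UNIV\<close>.\<close>
  let ?B = "\<lambda>i. (if i \<in> J then B i else UNIV) \<inter> (if i \<in> K then B' i else UNIV)"
  have "C \<inter> D = {\<omega>\<in>space F. \<forall>i\<in>J \<union> K. X i \<omega> \<in> ?B i}" unfolding C D by auto
  moreover have "\<forall>i. ?B i \<in> sets borel" using C D by auto
  ultimately show "C \<inter> D \<in> cylinders"
    unfolding cylinders_def mem_Collect_eq using C(2,3) D(2,3) by (intro exI[of _ "J \<union> K"] exI[of _ ?B]) simp
qed

text \<open>Dynkin induction from the cylinders, where the formula is that of
  \<open>strong_markov_visits\<close>. The three claims travel together because complements and
  disjoint unions subtract and sum integrals, which needs both measurability claims.\<close>

lemma strong_markov_paths:
  assumes st: "stopping_time_on T \<Lambda>" and A: "A \<in> sets path_algebra"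
  shows "(\<lambda>y. emeasure (P y) A) \<in> borel_measurable borel"
    and "{\<omega>\<in>\<Lambda>. \<theta> (T \<omega>) \<omega> \<in> A} \<in> sets F"
    and "emeasure (P x) {\<omega>\<in>\<Lambda>. \<theta> (T \<omega>) \<omega> \<in> A} = (\<integral>\<^sup>+\<omega>\<in>\<Lambda>. emeasure (P (X (T \<omega>) \<omega>)) A \<partial>P x)"
proof -
  have \<Lambda>: "\<Lambda> \<in> sets F" by (rule stopping_time_on_sets[OF st])
  have pos: "0 \<le> T \<omega>" and \<omega>F: "\<omega> \<in> space F" if "\<omega> \<in> \<Lambda>" for \<omega>
    using st that by (auto simp: stopping_time_on_def)
  define T' where "T' \<omega> = (if \<omega> \<in> \<Lambda> then T \<omega> else 0)" for \<omega>
  have XT: "(\<lambda>\<omega>. X (T' \<omega> + e) \<omega>) \<in> borel_measurable F" if "0 \<le> e" for e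
    using stopping_time_on_measurable[OF st] pos that
    by (intro X_random_time_measurable) (auto simp: T'_def[abs_def])
  have intg: "(\<integral>\<^sup>+\<omega>\<in>\<Lambda>. g (X (T \<omega>) \<omega>) \<partial>P x) = (\<integral>\<^sup>+\<omega>. g (X (T' \<omega>) \<omega>) * indicator \<Lambda> \<omega> \<partial>P x)"
    for g :: "'e \<Rightarrow> ennreal"
    by (rule nn_integral_cong) (simp add: T'_def split: split_indicator)
  have gm: "(\<lambda>\<omega>. g (X (T' \<omega>) \<omega>) * indicator \<Lambda> \<omega>) \<in> borel_measurable (P x)"
    if "g \<in> borel_measurable borel" for g :: "'e \<Rightarrow> ennreal"
    using measurable_compose[OF XT[of 0] that] \<Lambda> by simp
  define Good where "Good A \<longleftrightarrow> (\<lambda>y. emeasure (P y) A) \<in> borel_measurable borel \<and>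
    {\<omega>\<in>\<Lambda>. \<theta> (T \<omega>) \<omega> \<in> A} \<in> sets F \<and>
    emeasure (P x) {\<omega>\<in>\<Lambda>. \<theta> (T \<omega>) \<omega> \<in> A} = (\<integral>\<^sup>+\<omega>\<in>\<Lambda>. emeasure (P (X (T \<omega>) \<omega>)) A \<partial>P x)" for A
  have "Good A"
    using Int_stable_cylinders cylinders_closed A[unfolded sets_path_algebra]
  proof (induction rule: sigma_sets_induct_disjoint)
    case (basic C)
    then obtain J B where C: "C = {\<omega>\<in>space F. \<forall>i\<in>J. X i \<omega> \<in> B i}"
      and J: "finite J" "J \<subseteq> {0..}" and B: "\<And>i. B i \<in> sets borel"
      by (auto simp: cylinders_def)
    obtain l where l: "admissible l" "\<And>t \<omega>. visits l t \<omega> \<longleftrightarrow> (\<forall>i\<in>J. X (t + i) \<omega> \<in> B i)"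
      using visits_cylinder[of J B, OF J B] by blast
    have C_eq: "C = {\<omega>\<in>space F. visits l 0 \<omega>}" by (simp add: C l(2))
    have shifted: "{\<omega>\<in>\<Lambda>. \<theta> (T \<omega>) \<omega> \<in> C} = {\<omega>\<in>\<Lambda>. visits l (T \<omega>) \<omega>}"
    proof -
      have "\<theta> (T \<omega>) \<omega> \<in> C \<longleftrightarrow> visits l (T \<omega>) \<omega>" if "\<omega> \<in> \<Lambda>" for \<omega>
      proof -
        have "X i (\<theta> (T \<omega>) \<omega>) = X (T \<omega> + i) \<omega>" if "i \<in> J" for i
          using shift[of \<omega> i "T \<omega>"] \<omega>F pos J that \<open>\<omega> \<in> \<Lambda>\<close> by (auto simp: add.commute)
        then show ?thesis using shift_space[of \<omega> "T \<omega>"] \<omega>F pos that by (simp add: C l(2))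
      qed
      then show ?thesis by blast
    qed
    have "{\<omega>\<in>\<Lambda>. visits l (T \<omega>) \<omega>} \<in> sets F"
    proof -
      have "{\<omega>\<in>space F. X (T' \<omega> + i) \<omega> \<in> B i} \<in> sets F" if "i \<in> J" for i
        using measurable_sets[OF XT[of i] B] that J by (auto simp: vimage_def Int_def conj_commute)
      then have "{\<omega>\<in>space F. \<forall>i\<in>J. X (T' \<omega> + i) \<omega> \<in> B i} \<in> sets F"
        using J by (intro sets.sets_Collect_finite_All) auto
      moreover have "{\<omega>\<in>\<Lambda>. visits l (T \<omega>) \<omega>} = \<Lambda> \<inter> {\<omega>\<in>space F. \<forall>i\<in>J. X (T' \<omega> + i) \<omega> \<in> B i}"
        using \<omega>F by (auto simp: l(2) T'_def)
      ultimately show ?thesis using \<Lambda> by simp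
    qed
    then show ?case
      using visit_prob_measurable[OF l(1)] strong_markov_visits[OF st l(1)]
      unfolding Good_def shifted by (simp add: C_eq emeasure_visits[OF l(1)])
  next
    case empty
    then show ?case by (simp add: Good_def)
  next
    case (compl A)
    then have A: "(\<lambda>y. emeasure (P y) A) \<in> borel_measurable borel"
      "{\<omega>\<in>\<Lambda>. \<theta> (T \<omega>) \<omega> \<in> A} \<in> sets F"
      "emeasure (P x) {\<omega>\<in>\<Lambda>. \<theta> (T \<omega>) \<omega> \<in> A} = (\<integral>\<^sup>+\<omega>\<in>\<Lambda>. emeasure (P (X (T \<omega>) \<omega>)) A \<partial>P x)"
      by (auto simp: Good_def)
    have AF: "A \<in> sets F" using compl path_algebra_sets by (auto simp: sets_path_algebra)
    have c: "emeasure (P y) (space F - A) = 1 - emeasure (P y) A" for y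
      using emeasure_Diff[of "P y" A "space F"] AF sets.sets_into_space[OF AF] P.emeasure_space_1[of y]
      by (simp add: P.emeasure_finite)
    have S: "{\<omega>\<in>\<Lambda>. \<theta> (T \<omega>) \<omega> \<in> space F - A} = \<Lambda> - {\<omega>\<in>\<Lambda>. \<theta> (T \<omega>) \<omega> \<in> A}"
      using shift_space \<omega>F pos by auto
    have "emeasure (P x) (\<Lambda> - {\<omega>\<in>\<Lambda>. \<theta> (T \<omega>) \<omega> \<in> A}) =
        emeasure (P x) \<Lambda> - emeasure (P x) {\<omega>\<in>\<Lambda>. \<theta> (T \<omega>) \<omega> \<in> A}"
      using \<Lambda> A(2) by (intro emeasure_Diff) (auto simp: P.emeasure_finite)
    also have "\<dots> = (\<integral>\<^sup>+\<omega>. indicator \<Lambda> \<omega> \<partial>P x) -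
        (\<integral>\<^sup>+\<omega>. emeasure (P (X (T' \<omega>) \<omega>)) A * indicator \<Lambda> \<omega> \<partial>P x)"
      using \<Lambda> by (simp add: A(3) intg[of "\<lambda>y. emeasure (P y) A"])
    also have "\<dots> = (\<integral>\<^sup>+\<omega>. indicator \<Lambda> \<omega> - emeasure (P (X (T' \<omega>) \<omega>)) A * indicator \<Lambda> \<omega> \<partial>P x)"
    proof (rule nn_integral_diff[symmetric])
      show "(\<integral>\<^sup>+\<omega>. emeasure (P (X (T' \<omega>) \<omega>)) A * indicator \<Lambda> \<omega> \<partial>P x) \<noteq> \<infinity>"
        using A(3) P.emeasure_finite by (metis intg[of "\<lambda>y. emeasure (P y) A"] infinity_ennreal_def)
      show "AE \<omega> in P x. emeasure (P (X (T' \<omega>) \<omega>)) A * indicator \<Lambda> \<omega> \<le> indicator \<Lambda> \<omega>"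
        using P.emeasure_le_1 by (auto split: split_indicator)
    qed (use \<Lambda> gm[OF A(1)] in auto)
    also have "\<dots> = (\<integral>\<^sup>+\<omega>\<in>\<Lambda>. emeasure (P (X (T \<omega>) \<omega>)) (space F - A) \<partial>P x)"
      unfolding c by (rule nn_integral_cong) (simp add: T'_def split: split_indicator)
    finally have "emeasure (P x) {\<omega>\<in>\<Lambda>. \<theta> (T \<omega>) \<omega> \<in> space F - A} = \<dots>" unfolding S .
    then show ?case using A \<Lambda> unfolding Good_def S c by auto
  next
    case (union A)
    then have A: "\<And>n. (\<lambda>y. emeasure (P y) (A n)) \<in> borel_measurable borel"
      "\<And>n. {\<omega>\<in>\<Lambda>. \<theta> (T \<omega>) \<omega> \<in> A n} \<in> sets F"
      "\<And>n. emeasure (P x) {\<omega>\<in>\<Lambda>. \<theta> (T \<omega>) \<omega> \<in> A n} = (\<integral>\<^sup>+\<omega>\<in>\<Lambda>. emeasure (P (X (T \<omega>) \<omega>)) (A n) \<partial>P x)"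
      by (auto simp: Good_def)
    have AF: "A n \<in> sets F" for n using union path_algebra_sets by (auto simp: sets_path_algebra)
    have c: "emeasure (P y) (\<Union>n. A n) = (\<Sum>n. emeasure (P y) (A n))" for y
      using AF union(1) by (intro suminf_emeasure[symmetric]) auto
    have S: "{\<omega>\<in>\<Lambda>. \<theta> (T \<omega>) \<omega> \<in> (\<Union>n. A n)} = (\<Union>n. {\<omega>\<in>\<Lambda>. \<theta> (T \<omega>) \<omega> \<in> A n})" by auto
    have "emeasure (P x) (\<Union>n. {\<omega>\<in>\<Lambda>. \<theta> (T \<omega>) \<omega> \<in> A n}) =
        (\<Sum>n. emeasure (P x) {\<omega>\<in>\<Lambda>. \<theta> (T \<omega>) \<omega> \<in> A n})"
      using A(2) union(1) by (intro suminf_emeasure[symmetric]) (auto simp: disjoint_family_on_def)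
    also have "\<dots> = (\<Sum>n. \<integral>\<^sup>+\<omega>. emeasure (P (X (T' \<omega>) \<omega>)) (A n) * indicator \<Lambda> \<omega> \<partial>P x)"
      by (simp only: A(3) intg[of "\<lambda>y. emeasure (P y) (A n)" for n])
    also have "\<dots> = (\<integral>\<^sup>+\<omega>. (\<Sum>n. emeasure (P (X (T' \<omega>) \<omega>)) (A n) * indicator \<Lambda> \<omega>) \<partial>P x)"
      using gm[OF A(1)] by (intro nn_integral_suminf[symmetric])
    also have "\<dots> = (\<integral>\<^sup>+\<omega>\<in>\<Lambda>. emeasure (P (X (T \<omega>) \<omega>)) (\<Union>n. A n) \<partial>P x)"
      unfolding c by (rule nn_integral_cong) (simp add: T'_def split: split_indicator)
    finally have "emeasure (P x) {\<omega>\<in>\<Lambda>. \<theta> (T \<omega>) \<omega> \<in> (\<Union>n. A n)} = \<dots>" unfolding S .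
    moreover have "(\<lambda>y. \<Sum>n. emeasure (P y) (A n)) \<in> borel_measurable borel" using A(1) by measurable
    ultimately show ?case using A(2) unfolding Good_def S c by auto
  qed
  then show "(\<lambda>y. emeasure (P y) A) \<in> borel_measurable borel"
    and "{\<omega>\<in>\<Lambda>. \<theta> (T \<omega>) \<omega> \<in> A} \<in> sets F"
    and "emeasure (P x) {\<omega>\<in>\<Lambda>. \<theta> (T \<omega>) \<omega> \<in> A} = (\<integral>\<^sup>+\<omega>\<in>\<Lambda>. emeasure (P (X (T \<omega>) \<omega>)) A \<partial>P x)"
    by (auto simp: Good_def)
qed

section \<open>Regular points and the fine closure\<close>

lemma hitting_set_measurable:
  fixes t :: ereal
  assumes sp: "space m = space F" and X: "\<And>s. 0 \<le> s \<Longrightarrow> ereal s < t \<Longrightarrow> X s \<in> borel_measurable m"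
    and M: "M \<in> sets borel"
  shows "{(s, \<omega>). \<omega> \<in> space F \<and> 0 < s \<and> ereal s < t \<and> X s \<omega> \<in> M} \<in> sets (borel \<Otimes>\<^sub>M m)"
proof -
  let ?g = "\<lambda>(s, \<omega>). if 0 \<le> s \<and> ereal s < t then X s \<omega> else 0"
  have "?g -` M \<inter> space (borel \<Otimes>\<^sub>M m) \<in> sets (borel \<Otimes>\<^sub>M m)"
    by (rule measurable_sets[OF progressively_measurable[OF sp X] M])
  moreover have "{z \<in> space (borel \<Otimes>\<^sub>M m). 0 < fst z \<and> ereal (fst z) < t} \<in> sets (borel \<Otimes>\<^sub>M m)"
    by measurable
  moreover have "{(s, \<omega>). \<omega> \<in> space F \<and> 0 < s \<and> ereal s < t \<and> X s \<omega> \<in> M} =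
      (?g -` M \<inter> space (borel \<Otimes>\<^sub>M m)) \<inter> {z \<in> space (borel \<Otimes>\<^sub>M m). 0 < fst z \<and> ereal (fst z) < t}"
    by (auto simp: space_pair_measure sp split: if_splits)
  ultimately show ?thesis by auto
qed

text \<open>The event is an uncountable union over times, but it is the projection of a jointly
  measurable set of times and paths.\<close>

lemma hit_before_completion:
  assumes "finite_measure m" and sp: "space m = space F" and "M \<in> sets borel"
    and X: "\<And>s. 0 \<le> s \<Longrightarrow> s < t \<Longrightarrow> X s \<in> borel_measurable m"
  shows "{\<omega>\<in>space F. \<exists>s. 0 < s \<and> s < t \<and> X s \<omega> \<in> M} \<in> sets (completion m)"
proof -
  have "snd ` {(s, \<omega>). \<omega> \<in> space F \<and> 0 < s \<and> ereal s < ereal t \<and> X s \<omega> \<in> M} \<in> sets (completion m)"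
    by (intro measurable_projection hitting_set_measurable) (use assms in auto)
  also have "snd ` {(s, \<omega>). \<omega> \<in> space F \<and> 0 < s \<and> ereal s < ereal t \<and> X s \<omega> \<in> M} =
      {\<omega>\<in>space F. \<exists>s. 0 < s \<and> s < t \<and> X s \<omega> \<in> M}"
    by (auto simp: image_iff)
  finally show ?thesis .
qed

text \<open>For each initial law, projection is applied to the measure restricted to
  \<open>Ft t\<close> instead of \<open>F\<close>. The event is then a set of \<open>Ft t\<close> up
  to a null set, which is the form that \<open>Ft_augmented\<close> asks for. The strict bound
  \<open>s < t\<close> keeps all times involved below \<open>t\<close>.\<close>

lemma hit_before_adapted:
  assumes M: "M \<in> sets borel" and t: "0 < t"
  shows "{\<omega>\<in>space F. \<exists>s. 0 < s \<and> s < t \<and> X s \<omega> \<in> M} \<in> sets (Ft t)" (is "?A \<in> _")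
proof (rule Ft_augmented)
  show "\<forall>\<mu>. prob_space \<mu> \<and> sets \<mu> = sets borel \<longrightarrow> ?A \<in> sigma_sets (space F)
      (sets (Ft t) \<union> null_sets (completion (kernel_comp F \<mu> P)))"
  proof (intro allI impI)
    fix \<mu> :: "'e measure" assume "prob_space \<mu> \<and> sets \<mu> = sets borel"
    then interpret \<mu>: prob_space \<mu> by simp
    let ?m = "kernel_comp F \<mu> P"
    have sets_m: "sets ?m = sets F" and space_m: "space ?m = space F"
      by (simp_all add: kernel_comp_def sets.sets_measure_of_eq space_measure_of_conv)
    have fin: "finite_measure ?m"
    proof (rule finite_measureI)
      have "(\<integral>\<^sup>+x. emeasure (P x) (space F) \<partial>\<mu>) = 1"
        using P.emeasure_space_1 \<mu>.emeasure_space_1 by simp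
      then show "emeasure ?m (space ?m) \<noteq> \<infinity>"
        unfolding kernel_comp_def by (simp add: emeasure_measure_of_conv)
    qed
    have sub: "subalgebra ?m (Ft t)"
      using Ft_space[of t] Ft_subalgebra[of t] t by (simp add: subalgebra_def space_m sets_m)
    let ?r = "restr_to_subalg ?m (Ft t)"
    have "?A \<in> sets (completion ?r)"
    proof (rule hit_before_completion)
      have "emeasure ?r (space ?r) = emeasure ?m (space ?m)"
        using emeasure_restr_to_subalg[OF sub sets.top] Ft_space[of t] t
        by (simp add: space_restr_to_subalg space_m)
      then show "finite_measure ?r"
        using finite_measure.emeasure_finite[OF fin] by (intro finite_measureI) simp
      fix s assume s: "0 \<le> s" "s < t"
      have "X s \<in> borel_measurable (Ft t)"
        using adapted[of s] Ft_mono[of s t] Ft_space[of s] Ft_space[of t] s by (auto simp: measurable_def)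
      then show "X s \<in> borel_measurable ?r"
        by (simp add: measurable_cong_sets[OF sets_restr_to_subalg[OF sub] refl])
    qed (simp_all add: space_restr_to_subalg space_m M)
    then obtain S N N' where A: "?A = S \<union> N" "N \<subseteq> N'" "N' \<in> null_sets ?r" "S \<in> sets ?r"
      by (rule sets_completionE)
    have "N \<in> null_sets (completion ?m)"
      using A(2,3) null_sets_restr_to_subalg[OF sub] null_sets_completion_iff2 by blast
    moreover have "S \<in> sets (Ft t)" using A(4) sets_restr_to_subalg[OF sub] by simp
    ultimately show "?A \<in> sigma_sets (space F) (sets (Ft t) \<union> null_sets (completion ?m))"
      unfolding A(1) by (intro sigma_sets_Un sigma_sets.Basic) auto
  qed
qed (use t in auto)

lemma hitting_time_less_iff:
  "hitting_time X M \<omega> < ereal t \<longleftrightarrow> (\<exists>s. 0 < s \<and> s < t \<and> X s \<omega> \<in> M)"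
  unfolding hitting_time_def INF_less_iff by auto

lemma hitting_time_nonneg: "0 \<le> hitting_time X M \<omega>"
  unfolding hitting_time_def by (rule INF_greatest) auto

section \<open>Regular points\<close>

text \<open>The event that the hitting time vanishes; \<open>y\<close> is regular for
  \<open>M\<close> when this event has full measure under \<open>P y\<close>.\<close>

definition hits_at_once :: "'e set \<Rightarrow> 'w set" where
  "hits_at_once M = {\<omega>\<in>space F. \<forall>e>0. \<exists>s. 0 < s \<and> s < e \<and> X s \<omega> \<in> M}"

lemma hits_at_once_eq:
  "hits_at_once M = (\<Inter>n. {\<omega>\<in>space F. \<exists>s. 0 < s \<and> s < 1 / real (Suc n) \<and> X s \<omega> \<in> M})"
proof (intro set_eqI iffI)
  fix \<omega> assume \<omega>: "\<omega> \<in> (\<Inter>n. {\<omega>\<in>space F. \<exists>s. 0 < s \<and> s < 1 / real (Suc n) \<and> X s \<omega> \<in> M})"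
  have "\<exists>s. 0 < s \<and> s < e \<and> X s \<omega> \<in> M" if "0 < e" for e
  proof -
    obtain n where n: "1 / real (Suc n) < e" using \<open>0 < e\<close> by (rule nat_approx_posE)
    have "\<exists>s. 0 < s \<and> s < 1 / real (Suc n) \<and> X s \<omega> \<in> M" using \<omega> by blast
    then show ?thesis using n by (meson order_less_trans)
  qed
  then show "\<omega> \<in> hits_at_once M" using \<omega> by (auto simp: hits_at_once_def)
next
  fix \<omega> assume "\<omega> \<in> hits_at_once M"
  moreover have "0 < 1 / real (Suc n)" for n by simp
  ultimately show "\<omega> \<in> (\<Inter>n. {\<omega>\<in>space F. \<exists>s. 0 < s \<and> s < 1 / real (Suc n) \<and> X s \<omega> \<in> M})"
    unfolding hits_at_once_def by blast
qed

lemma hits_at_once_completion: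
  assumes "finite_measure m" "space m = space F" "M \<in> sets borel"
    and "\<And>s. 0 \<le> s \<Longrightarrow> X s \<in> borel_measurable m"
  shows "hits_at_once M \<in> sets (completion m)"
  unfolding hits_at_once_eq
  by (rule sets.countable_INT) (auto intro!: hit_before_completion assms)

text \<open>
  By the strong Markov property, the law of the process after time \<open>T\<close> is the mixture of the laws
  \<open>P\<^sup>y\<close> with \<open>y = X\<^sub>T\<close>; hence almost every such \<open>y\<close> is regular for \<open>M\<close> if \<open>M\<close> is hit at once after \<open>T\<close>.
\<close>

lemma regular_after_stopping_time:
  assumes M: "M \<in> sets borel" and st: "stopping_time_on T \<Lambda>"
    and once: "\<And>\<omega>. \<omega> \<in> \<Lambda> \<Longrightarrow> \<theta> (T \<omega>) \<omega> \<in> hits_at_once M"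
    and irregular: "\<And>\<omega> A. \<omega> \<in> \<Lambda> \<Longrightarrow> A \<in> sets path_algebra \<Longrightarrow> A \<subseteq> hits_at_once M \<Longrightarrow>
      emeasure (P (X (T \<omega>) \<omega>)) A < 1"
  shows "emeasure (P x) \<Lambda> = 0"
proof -
  have \<Lambda>: "\<Lambda> \<in> sets F" by (rule stopping_time_on_sets[OF st])
  have pos: "0 \<le> T \<omega>" and \<omega>F: "\<omega> \<in> space F" if "\<omega> \<in> \<Lambda>" for \<omega>
    using st that by (auto simp: stopping_time_on_def)
  \<comment> \<open>The identity off \<open>\<Lambda>\<close> makes the shift a total measurable
    map; restricting the measure to \<open>\<Lambda>\<close> discards that part.\<close>
  define \<phi> where "\<phi> \<omega> = (if \<omega> \<in> \<Lambda> then \<theta> (T \<omega>) \<omega> else \<omega>)" for \<omega>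
  let ?D = "density (P x) (indicator \<Lambda>)"
  have \<phi>: "\<phi> \<in> F \<rightarrow>\<^sub>M path_algebra"
  proof (rule measurableI)
    show "\<phi> \<omega> \<in> space path_algebra" if "\<omega> \<in> space F" for \<omega>
      using shift_space pos that by (simp add: \<phi>_def)
    fix A assume A: "A \<in> sets path_algebra"
    then have "A \<in> sets F" using path_algebra_sets by blast
    moreover have "\<phi> -` A \<inter> space F = {\<omega>\<in>\<Lambda>. \<theta> (T \<omega>) \<omega> \<in> A} \<union> (A - \<Lambda>)"
      using \<omega>F sets.sets_into_space[OF \<open>A \<in> sets F\<close>] by (auto simp: \<phi>_def split: if_splits)
    ultimately show "\<phi> -` A \<inter> space F \<in> sets F" using strong_markov_paths(2)[OF st A] \<Lambda> by simp
  qed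
  \<comment> \<open>The law of the shifted paths. \<open>hits_at_once M\<close> lies only in its
    completion and is replaced by an inner set \<open>S\<close> of \<open>path_algebra\<close>; this
    is why irregularity is assumed for measurable subsets.\<close>
  define m where "m = distr ?D path_algebra \<phi>"
  have m_sets [simp]: "sets m = sets path_algebra" "space m = space F" by (simp_all add: m_def)
  have m_eq: "emeasure m A = emeasure (P x) {\<omega>\<in>\<Lambda>. \<theta> (T \<omega>) \<omega> \<in> A}" if A: "A \<in> sets path_algebra" for A
  proof -
    have S: "\<phi> -` A \<inter> space F \<in> sets F" by (rule measurable_sets[OF \<phi> A])
    have "emeasure m A = emeasure ?D (\<phi> -` A \<inter> space F)"
      unfolding m_def using \<phi> A by (subst emeasure_distr) (auto cong: measurable_cong_sets)
    also have "\<dots> = emeasure (P x) (\<Lambda> \<inter> (\<phi> -` A \<inter> space F))"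
      using \<Lambda> S by (intro emeasure_restricted) auto
    also have "\<Lambda> \<inter> (\<phi> -` A \<inter> space F) = {\<omega>\<in>\<Lambda>. \<theta> (T \<omega>) \<omega> \<in> A}"
      using \<omega>F by (auto simp: \<phi>_def)
    finally show ?thesis .
  qed
  have "finite_measure m"
  proof (rule finite_measureI)
    have "space F \<in> sets path_algebra" using sets.top[of path_algebra] by simp
    then show "emeasure m (space m) \<noteq> \<infinity>" using m_eq P.emeasure_finite by simp
  qed
  then have "hits_at_once M \<in> sets (completion m)"
    using M X_measurable_path_algebra
    by (intro hits_at_once_completion) (simp_all add: measurable_cong_sets[OF m_sets(1) refl])
  then obtain S N N' where A: "hits_at_once M = S \<union> N" "N \<subseteq> N'" "N' \<in> null_sets m" "S \<in> sets m"
    by (rule sets_completionE)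
  have Sp: "S \<in> sets path_algebra" "N' \<in> sets path_algebra" using A by auto
  have "{\<omega>\<in>\<Lambda>. \<theta> (T \<omega>) \<omega> \<in> S \<union> N'} = \<Lambda>" using once A(1,2) by blast
  then have "emeasure (P x) \<Lambda> = emeasure m (S \<union> N')" using m_eq Sp by simp
  also have "\<dots> = emeasure m S" using A by (intro emeasure_Un_null_set)
  also have "\<dots> = (\<integral>\<^sup>+\<omega>\<in>\<Lambda>. emeasure (P (X (T \<omega>) \<omega>)) S \<partial>P x)"
    using m_eq[OF Sp(1)] strong_markov_paths(3)[OF st Sp(1)] by simp
  \<comment> \<open>On \<open>\<Lambda>\<close> the integrand on the right is strictly below 1, so
    equality of the integrals leaves no mass for \<open>\<Lambda>\<close>.\<close>
  finally have eq: "(\<integral>\<^sup>+\<omega>. indicator \<Lambda> \<omega> \<partial>P x) = (\<integral>\<^sup>+\<omega>\<in>\<Lambda>. emeasure (P (X (T \<omega>) \<omega>)) S \<partial>P x)"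
    using \<Lambda> by simp
  define T' where "T' \<omega> = (if \<omega> \<in> \<Lambda> then T \<omega> else 0)" for \<omega>
  have XT: "(\<lambda>\<omega>. X (T' \<omega>) \<omega>) \<in> borel_measurable F"
    using stopping_time_on_measurable[OF st] pos
    by (intro X_random_time_measurable) (auto simp: T'_def[abs_def])
  have "(\<lambda>\<omega>. emeasure (P (X (T' \<omega>) \<omega>)) S * indicator \<Lambda> \<omega>) \<in> borel_measurable (P x)"
    using measurable_compose[OF XT strong_markov_paths(1)[OF st Sp(1)]] \<Lambda> by simp
  also have "(\<lambda>\<omega>. emeasure (P (X (T' \<omega>) \<omega>)) S * indicator \<Lambda> \<omega>) =
      (\<lambda>\<omega>. emeasure (P (X (T \<omega>) \<omega>)) S * indicator \<Lambda> \<omega>)"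
    by (auto simp: fun_eq_iff T'_def split: split_indicator)
  finally have meas: "(\<lambda>\<omega>. emeasure (P (X (T \<omega>) \<omega>)) S * indicator \<Lambda> \<omega>) \<in> borel_measurable (P x)" .
  have lt: "emeasure (P (X (T \<omega>) \<omega>)) S < 1" if "\<omega> \<in> \<Lambda>" for \<omega>
    using irregular[OF that Sp(1)] A(1) by blast
  have "AE \<omega> in P x. indicator \<Lambda> \<omega> \<le> emeasure (P (X (T \<omega>) \<omega>)) S * indicator \<Lambda> \<omega>"
  proof (rule ccontr)
    assume *: "\<not> ?thesis"
    have "(\<integral>\<^sup>+\<omega>\<in>\<Lambda>. emeasure (P (X (T \<omega>) \<omega>)) S \<partial>P x) < (\<integral>\<^sup>+\<omega>. indicator \<Lambda> \<omega> \<partial>P x)"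
    proof (rule nn_integral_less[OF meas _ _ _ *])
      show "(\<integral>\<^sup>+\<omega>\<in>\<Lambda>. emeasure (P (X (T \<omega>) \<omega>)) S \<partial>P x) \<noteq> \<infinity>"
        unfolding eq[symmetric] using \<Lambda> P.emeasure_finite by simp
      show "AE \<omega> in P x. emeasure (P (X (T \<omega>) \<omega>)) S * indicator \<Lambda> \<omega> \<le> indicator \<Lambda> \<omega>"
        using P.emeasure_le_1 by (auto split: split_indicator)
    qed (use \<Lambda> in auto)
    then show False using eq by simp
  qed
  then have "AE \<omega> in P x. \<omega> \<notin> \<Lambda>"
    by eventually_elim (use lt in \<open>force simp: not_le[symmetric] split: split_indicator_asm\<close>)
  moreover have "{\<omega>\<in>space (P x). \<not> \<omega> \<notin> \<Lambda>} = \<Lambda>" using \<omega>F by auto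
  ultimately show ?thesis using AE_iff_measurable[of \<Lambda> "P x" "\<lambda>\<omega>. \<omega> \<notin> \<Lambda>"] \<Lambda> by simp
qed

text \<open>Since \<open>\<beta> > 0\<close>, a path that does not hit \<open>M\<close> before
  \<open>t\<close> contributes at most \<open>exp (- \<beta> * t) < 1\<close>. An expectation of at
  least 1 excludes such paths almost surely, and countably many \<open>t\<close> suffice.\<close>

lemma regular_if_hitting_op_ge_1:
  assumes M: "M \<in> sets borel" and \<beta>: "0 < \<beta>" and ge: "1 \<le> hitting_op X P \<beta> M (\<lambda>_. 1) y"
  shows "AE \<omega> in P y. \<omega> \<in> hits_at_once M"
proof -
  have "AE \<omega> in P y. \<exists>s. 0 < s \<and> s < t \<and> X s \<omega> \<in> M" if t: "0 < t" for t
  proof -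
    define A where "A = {\<omega>\<in>space F. \<exists>s. 0 < s \<and> s < t \<and> X s \<omega> \<in> M}"
    have A: "A \<in> sets F"
      using hit_before_adapted[OF M t] Ft_subalgebra[of t] t by (auto simp: A_def)
    define c where "c = exp (- \<beta> * t)"
    have c: "0 < c" "c < 1" using \<beta> t by (auto simp: c_def)
    have "hitting_op X P \<beta> M (\<lambda>_. 1) y \<le> (\<integral>\<^sup>+\<omega>. indicator A \<omega> + ennreal c * indicator (space F - A) \<omega> \<partial>P y)"
      unfolding hitting_op_def
    proof (rule nn_integral_mono)
      fix \<omega> assume "\<omega> \<in> space (P y)"
      then have \<omega>: "\<omega> \<in> space F" by simp
      show "(if hitting_time X M \<omega> < \<infinity> then let T = real_of_ereal (hitting_time X M \<omega>)
          in ennreal (exp (- \<beta> * T)) * 1 else 0) \<le> indicator A \<omega> + ennreal c * indicator (space F - A) \<omega>"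
      proof (cases "hitting_time X M \<omega> < \<infinity>")
        case True
        then obtain T where T: "hitting_time X M \<omega> = ereal T" "0 \<le> T"
          using hitting_time_nonneg[of M \<omega>] by (cases "hitting_time X M \<omega>") auto
        show ?thesis
        proof (cases "\<omega> \<in> A")
          case True
          then show ?thesis using T \<beta> by (simp add: ennreal_le_1)
        next
          case False
          then have "\<not> hitting_time X M \<omega> < ereal t"
            using \<omega> unfolding hitting_time_less_iff A_def by blast
          then have "t \<le> T" by (simp add: T)
          then have "exp (- \<beta> * T) \<le> c" using \<beta> by (simp add: c_def)
          then show ?thesis using T False \<omega> by (simp add: ennreal_leI)
        qed
      qed simp
    qed
    also have "\<dots> = emeasure (P y) A + ennreal c * emeasure (P y) (space F - A)"
      using A by (simp add: nn_integral_add nn_integral_cmult)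
    also have "\<dots> = ennreal (measure (P y) A + c * (1 - measure (P y) A))"
    proof -
      have "measure (P y) (space F - A) = 1 - measure (P y) A"
        using P.prob_compl[of A y] A by simp
      moreover have "0 \<le> 1 - measure (P y) A" by simp
      ultimately show ?thesis
        using c by (simp only: P.emeasure_eq_measure ennreal_mult ennreal_plus mult_nonneg_nonneg
          measure_nonneg less_imp_le)
    qed
    finally have "1 \<le> measure (P y) A + c * (1 - measure (P y) A)"
      using ge by (metis ennreal_1 ennreal_le_iff2 not_one_le_zero order_trans)
    then have "(1 - c) * (1 - measure (P y) A) \<le> 0" by (simp add: algebra_simps)
    then have "measure (P y) A = 1" using c P.prob_le_1[of y A] by (simp add: mult_le_0_iff)
    then have "AE \<omega> in P y. \<omega> \<in> A" using A by (subst P.AE_in_set_eq_1) auto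
    then show ?thesis by eventually_elim (simp add: A_def)
  qed
  then have "AE \<omega> in P y. \<forall>n. \<exists>s. 0 < s \<and> s < 1 / real (Suc n) \<and> X s \<omega> \<in> M"
    unfolding AE_all_countable by simp
  then show ?thesis using AE_space
    by eventually_elim (simp add: hits_at_once_eq)
qed

section \<open>Fine neighbourhoods along paths\<close>

text \<open>Right-continuity of excessive functions at time 0 settles the generating sets. Arbitrary
  unions cause no null-set problem, because one member containing the fixed point \<open>y\<close>
  is enough.\<close>

lemma finely_open_path:
  assumes \<beta>: "0 < \<beta>" and U: "openin (fine_topology \<nu> \<beta>) U" and y: "y \<in> U"
  shows "AE \<omega> in P y. \<exists>e>0. \<forall>s. 0 < s \<and> s < e \<longrightarrow> X s \<omega> \<in> U"
proof -
  have "generate_topology_on {u -` G | u G. excessive \<nu> \<beta> u \<and> open G} U"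
    using U unfolding fine_topology_def openin_topology_generated_by_iff .
  then show ?thesis using y
  proof induction
    case Empty
    then show ?case by simp
  next
    case (Int A B)
    then have "AE \<omega> in P y. \<exists>e>0. \<forall>s. 0 < s \<and> s < e \<longrightarrow> X s \<omega> \<in> A"
      "AE \<omega> in P y. \<exists>e>0. \<forall>s. 0 < s \<and> s < e \<longrightarrow> X s \<omega> \<in> B" by auto
    then show ?case
    proof eventually_elim
      case (elim \<omega>)
      then obtain e e' where "0 < e" "\<forall>s. 0 < s \<and> s < e \<longrightarrow> X s \<omega> \<in> A"
        "0 < e'" "\<forall>s. 0 < s \<and> s < e' \<longrightarrow> X s \<omega> \<in> B" by blast
      then show ?case by (intro exI[of _ "min e e'"]) auto
    qed
  next
    case (UN K)
    then obtain k where "k \<in> K" "y \<in> k" by blast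
    from UN.IH[OF this] show ?case by eventually_elim (use \<open>k \<in> K\<close> in blast)
  next
    case (Basis A)
    then obtain u G where A: "A = u -` G" "excessive \<nu> \<beta> u" "open G" by blast
    show ?case
      using excessive_right_continuous[OF \<beta> A(2), of y] normal[of y]
    proof eventually_elim
      case (elim \<omega>)
      then have "((\<lambda>s. u (X s \<omega>)) \<longlongrightarrow> u y) (at_right 0)" by (auto simp: continuous_within)
      then have "eventually (\<lambda>s. u (X s \<omega>) \<in> G) (at_right 0)"
        using A(3) Basis.prems unfolding A(1) by (auto dest: topological_tendstoD)
      then show ?case unfolding A(1) eventually_at_right_field by (auto intro: exI)
    qed
  qed
qed

lemma topspace_fine_topology: "topspace (fine_topology \<nu> \<beta>) = UNIV"
proof -
  have "excessive \<nu> \<beta> (\<lambda>_. 0)" by (simp add: excessive_def kernel_op_def)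
  then show ?thesis
    unfolding fine_topology_def by (auto intro!: exI[of _ "UNIV"] exI[of _ "\<lambda>_. 0"])
qed

text \<open>Almost every path stays in \<open>U\<close> for a short while and meets \<open>M\<close>
  during it. One such path provides a common point, and the conclusion no longer mentions the
  path.\<close>

lemma fine_closure_if_regular:
  assumes \<beta>: "0 < \<beta>" and y: "AE \<omega> in P y. \<omega> \<in> hits_at_once M"
  shows "y \<in> fine_topology \<nu> \<beta> closure_of M"
  unfolding in_closure_of
proof (intro conjI allI impI)
  show "y \<in> topspace (fine_topology \<nu> \<beta>)" by (simp add: topspace_fine_topology)
  fix U assume U: "y \<in> U \<and> openin (fine_topology \<nu> \<beta>) U"
  have "AE \<omega> in P y. \<exists>z. z \<in> M \<and> z \<in> U"
    using y finely_open_path[OF \<beta> conjunct2[OF U] conjunct1[OF U]]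
  proof (eventually_elim)
    case (elim \<omega>)
    then show ?case unfolding hits_at_once_def by blast
  qed
  then show "\<exists>z. z \<in> M \<and> z \<in> U"
    by (simp only: P.AE_const)
qed

text \<open>The set \<open>W\<close> is Borel so that stopping in \<open>W\<close> is again a
  stopping event; it will be a Borel part of the irregular points outside \<open>M\<close>.\<close>

lemma not_hit_irregular_outside:
  assumes M: "M \<in> sets borel" and W: "W \<in> sets borel" "W \<inter> M = {}"
    and irregular: "\<And>y. y \<in> W \<Longrightarrow> hitting_op X P \<beta> M (\<lambda>_. 1) y < 1"
  shows "hitting_op X P \<beta> M (indicator W) x = 0"
proof -
  define T where "T \<omega> = real_of_ereal (hitting_time X M \<omega>)" for \<omega>
  define \<Lambda> where "\<Lambda> = {\<omega>\<in>space F. hitting_time X M \<omega> < \<infinity>}"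
  have T: "hitting_time X M \<omega> = ereal (T \<omega>)" "0 \<le> T \<omega>" if "\<omega> \<in> \<Lambda>" for \<omega>
    using that hitting_time_nonneg[of M \<omega>] unfolding T_def \<Lambda>_def
    by (cases "hitting_time X M \<omega>"; simp)+
  have "stopping_time_on T \<Lambda>"
    unfolding stopping_time_on_def
  proof (intro conjI ballI allI impI)
    show "\<Lambda> \<subseteq> space F" by (auto simp: \<Lambda>_def)
    show "0 \<le> T \<omega>" if "\<omega> \<in> \<Lambda>" for \<omega> by (rule T(2)[OF that])
    fix t :: real assume t: "0 < t"
    have "{\<omega>\<in>\<Lambda>. T \<omega> < t} = {\<omega>\<in>space F. hitting_time X M \<omega> < ereal t}"
    proof (intro set_eqI iffI)
      fix \<omega> assume "\<omega> \<in> {\<omega>\<in>\<Lambda>. T \<omega> < t}"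
      then show "\<omega> \<in> {\<omega>\<in>space F. hitting_time X M \<omega> < ereal t}"
        using T(1)[of \<omega>] by (simp add: \<Lambda>_def)
    next
      fix \<omega> assume \<omega>: "\<omega> \<in> {\<omega>\<in>space F. hitting_time X M \<omega> < ereal t}"
      then have "\<omega> \<in> \<Lambda>" by (auto simp: \<Lambda>_def intro: order_less_trans)
      then show "\<omega> \<in> {\<omega>\<in>\<Lambda>. T \<omega> < t}" using \<omega> T(1)[of \<omega>] by simp
    qed
    then show "{\<omega>\<in>\<Lambda>. T \<omega> < t} \<in> sets (Ft t)"
      using hit_before_adapted[OF M t] by (simp add: hitting_time_less_iff)
  qed
  from stopping_time_on_add[OF this order_refl W(1)]
  have st: "stopping_time_on T {\<omega>\<in>\<Lambda>. X (T \<omega>) \<omega> \<in> W}" by simp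
  have "emeasure (P x) {\<omega>\<in>\<Lambda>. X (T \<omega>) \<omega> \<in> W} = 0"
  proof (rule regular_after_stopping_time[OF M st])
    fix \<omega> assume \<omega>: "\<omega> \<in> {\<omega>\<in>\<Lambda>. X (T \<omega>) \<omega> \<in> W}"
    then have \<omega>\<Lambda>: "\<omega> \<in> \<Lambda>" by simp
    then have \<omega>F: "\<omega> \<in> space F" by (simp add: \<Lambda>_def)
    note T' = T[OF \<omega>\<Lambda>]
    show "\<theta> (T \<omega>) \<omega> \<in> hits_at_once M"
      unfolding hits_at_once_def
    proof (intro CollectI conjI allI impI shift_space \<omega>F T'(2))
      fix e :: real assume e: "0 < e"
      then obtain s where s: "0 < s" "s < T \<omega> + e" "X s \<omega> \<in> M"
        using hitting_time_less_iff[of M \<omega> "T \<omega> + e"] T' by auto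
      have "\<not> s < T \<omega>"
        using hitting_time_less_iff[of M \<omega> "T \<omega>"] T' s(1,3) by auto
      \<comment> \<open>The infimum is not attained, because the position at time \<open>T\<close>
        lies in \<open>W\<close>, which is disjoint from \<open>M\<close>. Hence hits occur at times
        strictly after \<open>T\<close> and arbitrarily close to it.\<close>
      moreover have "s \<noteq> T \<omega>" using s(3) W(2) \<omega> by auto
      ultimately have "0 < s - T \<omega>" by simp
      moreover have "X (s - T \<omega>) (\<theta> (T \<omega>) \<omega>) = X s \<omega>"
        using shift[OF \<omega>F, of "s - T \<omega>" "T \<omega>"] T'(2) calculation by simp
      ultimately show "\<exists>s. 0 < s \<and> s < e \<and> X s (\<theta> (T \<omega>) \<omega>) \<in> M"
        using s by (intro exI[of _ "s - T \<omega>"]) auto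
    qed
    fix A assume A: "A \<in> sets path_algebra" "A \<subseteq> hits_at_once M"
    let ?y = "X (T \<omega>) \<omega>"
    have "emeasure (P ?y) A = (\<integral>\<^sup>+\<omega>. indicator A \<omega> \<partial>P ?y)"
      using A path_algebra_sets by auto
    \<comment> \<open>On \<open>hits_at_once M\<close> the hitting time is 0 and the discount factor
      is 1, so the hitting operator dominates the probability of any measurable part of this
      event.\<close>
    also have "\<dots> \<le> hitting_op X P \<beta> M (\<lambda>_. 1) ?y"
      unfolding hitting_op_def
    proof (rule nn_integral_mono)
      fix \<omega>'
      show "indicator A \<omega>' \<le> (if hitting_time X M \<omega>' < \<infinity> then let T = real_of_ereal (hitting_time X M \<omega>')
          in ennreal (exp (- \<beta> * T)) * 1 else 0)"
      proof (cases "\<omega>' \<in> A")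
        case True
        then have "\<omega>' \<in> hits_at_once M" using A(2) by blast
        then have "hitting_time X M \<omega>' < ereal e" if "0 < e" for e
          using that unfolding hitting_time_less_iff hits_at_once_def by blast
        then have "hitting_time X M \<omega>' \<le> 0 + ereal e" if "0 < e" for e
          using that unfolding add_0 by (blast intro: less_imp_le)
        then have "hitting_time X M \<omega>' \<le> 0" by (rule ereal_le_epsilon2)
        then have "hitting_time X M \<omega>' = 0" using hitting_time_nonneg[of M \<omega>'] by simp
        then show ?thesis by (simp split: split_indicator)
      qed simp
    qed
    also have "\<dots> < 1" using \<omega> by (intro irregular) auto
    finally show "emeasure (P ?y) A < 1" .
  qed
  then have ae: "AE \<omega> in P x. \<omega> \<notin> {\<omega>\<in>\<Lambda>. X (T \<omega>) \<omega> \<in> W}"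
    using stopping_time_on_sets[OF st] by (intro AE_not_in) (simp add: null_sets_def)
  have "hitting_op X P \<beta> M (indicator W) x = (\<integral>\<^sup>+\<omega>. 0 \<partial>P x)"
    unfolding hitting_op_def
  proof (rule nn_integral_cong_AE)
    show "AE \<omega> in P x. (if hitting_time X M \<omega> < \<infinity> then let T = real_of_ereal (hitting_time X M \<omega>)
        in ennreal (exp (- \<beta> * T)) * indicator W (X T \<omega>) else 0) = 0"
      using ae AE_space by eventually_elim (auto simp: \<Lambda>_def T_def Let_def)
  qed
  then show ?thesis by simp
qed

section \<open>The resolvent and the domination principle\<close>

text \<open>Translation invariance: all starting points are represented on the single space
  \<open>P 0\<close>, where joint measurability in time and position comes from the paths.\<close>

lemma nn_integral_transition_eq_process:
  assumes t: "0 \<le> t" and f: "f \<in> borel_measurable borel"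
  shows "(\<integral>\<^sup>+y. f y \<partial>transition \<nu> t x) = (\<integral>\<^sup>+\<omega>. f (x + X t \<omega>) \<partial>P 0)"
proof -
  let ?g = "\<lambda>y. f (x + y)"
  have g: "?g \<in> borel_measurable borel" using f by measurable
  have sF: "space F \<in> sets (Ft 0)" using Ft_space[of 0] sets.top[of "Ft 0"] by simp
  have "(\<integral>\<^sup>+\<omega>. f (x + X t \<omega>) \<partial>P 0) = (\<integral>\<^sup>+\<omega>\<in>space F. ?g (X (0 + t) \<omega>) \<partial>P 0)"
    by (rule nn_integral_cong) simp
  also have "\<dots> = (\<integral>\<^sup>+\<omega>\<in>space F. (\<integral>\<^sup>+y. ?g y \<partial>transition \<nu> t (X 0 \<omega>)) \<partial>P 0)"
    by (rule markov_integral[OF order_refl t sF g])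
  also have "\<dots> = (\<integral>\<^sup>+\<omega>. (\<integral>\<^sup>+y. ?g y \<partial>transition \<nu> t 0) \<partial>P 0)"
  proof (rule nn_integral_cong_AE)
    show "AE \<omega> in P 0. (\<integral>\<^sup>+y. ?g y \<partial>transition \<nu> t (X 0 \<omega>)) * indicator (space F) \<omega> =
        (\<integral>\<^sup>+y. ?g y \<partial>transition \<nu> t 0)"
      using normal[of 0] AE_space by eventually_elim simp
  qed
  also have "\<dots> = (\<integral>\<^sup>+y. ?g y \<partial>transition \<nu> t 0)" using P.emeasure_space_1[of 0] by simp
  also have "\<dots> = (\<integral>\<^sup>+y. f y \<partial>transition \<nu> t x)"
    using t f g by (simp add: nn_integral_transition)
  finally show ?thesis ..
qed

lemma chapman_kolmogorov:
  assumes s: "0 \<le> s" and t: "0 \<le> t" and f: "f \<in> borel_measurable borel"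
  shows "(\<integral>\<^sup>+y. (\<integral>\<^sup>+z. f z \<partial>transition \<nu> t y) \<partial>transition \<nu> s x) = (\<integral>\<^sup>+z. f z \<partial>transition \<nu> (s + t) x)"
proof -
  interpret t: prob_space "\<nu> t" using t by (rule prob_nu)
  note [measurable_cong] = sets_nu[OF t] sets_nu[OF s]
  note [measurable] = f
  have "(\<integral>\<^sup>+y. (\<integral>\<^sup>+z. f z \<partial>transition \<nu> t y) \<partial>transition \<nu> s x) = (\<integral>\<^sup>+y. (\<integral>\<^sup>+z. f (x + (y + z)) \<partial>\<nu> t) \<partial>\<nu> s)"
    using nn_integral_transition[OF s nn_integral_transition_measurable[OF t f]]
      nn_integral_transition[OF t f] by (simp add: add.assoc)
  also have "\<dots> = (\<integral>\<^sup>+p. f (x + (fst p + snd p)) \<partial>(\<nu> s \<Otimes>\<^sub>M \<nu> t))"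
    by (subst t.nn_integral_fst[symmetric]) simp_all
  also have "\<dots> = (\<integral>\<^sup>+w. f (x + w) \<partial>distr (\<nu> s \<Otimes>\<^sub>M \<nu> t) borel (\<lambda>(x, y). x + y))"
    by (subst nn_integral_distr) (simp_all add: case_prod_beta)
  also have "distr (\<nu> s \<Otimes>\<^sub>M \<nu> t) borel (\<lambda>(x, y). x + y) = \<nu> (s + t)"
    using conv s t by (simp add: convolution_semigroup_def)
  finally show ?thesis using s t f by (simp add: nn_integral_transition)
qed

text \<open>Written in the shape of \<open>progressively_measurable\<close> at horizon infinity,
  which supplies joint measurability.\<close>

definition path_map :: "real \<times> 'w \<Rightarrow> 'e" where
  "path_map = (\<lambda>(s, \<omega>). if 0 \<le> s \<and> ereal s < \<infinity> then X s \<omega> else 0)"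

lemma path_map_measurable [measurable]: "path_map \<in> borel_measurable (borel \<Otimes>\<^sub>M P 0)"
  unfolding path_map_def by (intro progressively_measurable) (auto intro: X_measurable cong: measurable_cong_sets)

text \<open>A version of \<open>(t, x) \<mapsto> P\<^sub>t f x\<close> that is measurable on all of \<open>\<real> \<times> E\<close>.\<close>

definition semigroup :: "('e \<Rightarrow> ennreal) \<Rightarrow> real \<Rightarrow> 'e \<Rightarrow> ennreal" where
  "semigroup f t x = (\<integral>\<^sup>+\<omega>. f (x + path_map (t, \<omega>)) \<partial>P 0)"

lemma semigroup_eq:
  "0 \<le> t \<Longrightarrow> f \<in> borel_measurable borel \<Longrightarrow> semigroup f t x = (\<integral>\<^sup>+y. f y \<partial>transition \<nu> t x)"
  by (simp add: semigroup_def nn_integral_transition_eq_process path_map_def)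

lemma semigroup_measurable [measurable (raw)]:
  assumes [measurable]: "f \<in> borel_measurable borel" "g \<in> borel_measurable N" "h \<in> borel_measurable N"
  shows "(\<lambda>z. semigroup f (g z) (h z)) \<in> borel_measurable N"
  unfolding semigroup_def by measurable

text \<open>\<open>resolvent\<close> is given by a set function under \<open>measure_of\<close>. Its
  representation as the image of a weighted product measure shows that the set function is a measure
  and provides the integration formula.\<close>

lemma resolvent_eq_distr:
  "resolvent \<nu> \<alpha> x = distr (density (lborel \<Otimes>\<^sub>M P 0) (\<lambda>z. ennreal (exp (- \<alpha> * fst z)) * indicator {0..} (fst z)))
     borel (\<lambda>z. x + path_map z)" (is "_ = ?R")
proof -
  have "emeasure ?R A = (\<integral>\<^sup>+t\<in>{0..}. ennreal (exp (- \<alpha> * t)) * emeasure (transition \<nu> t x) A \<partial>lborel)"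
    if A: "A \<in> sets borel" for A
  proof -
    have [measurable]: "A \<in> sets borel" by fact
    let ?w = "\<lambda>t. ennreal (exp (- \<alpha> * t)) * indicator {0..} t"
    have "emeasure ?R A = (\<integral>\<^sup>+y. indicator A y \<partial>?R)" using A by simp
    also have "\<dots> = (\<integral>\<^sup>+z. ?w (fst z) * indicator A (x + path_map z) \<partial>(lborel \<Otimes>\<^sub>M P 0))"
      by (subst nn_integral_distr) (simp_all add: nn_integral_density)
    also have "\<dots> = (\<integral>\<^sup>+t. (\<integral>\<^sup>+\<omega>. ?w t * indicator A (x + path_map (t, \<omega>)) \<partial>P 0) \<partial>lborel)"
      by (subst P.nn_integral_fst[symmetric]) simp_all
    also have "\<dots> = (\<integral>\<^sup>+t. ?w t * semigroup (indicator A) t x \<partial>lborel)"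
      unfolding semigroup_def by (intro nn_integral_cong nn_integral_cmult) measurable
    also have "\<dots> = (\<integral>\<^sup>+t\<in>{0..}. ennreal (exp (- \<alpha> * t)) * emeasure (transition \<nu> t x) A \<partial>lborel)"
      using A by (intro nn_integral_cong) (simp add: semigroup_eq split: split_indicator)
    finally show ?thesis .
  qed
  then have "resolvent \<nu> \<alpha> x = measure_of UNIV (sets borel) (emeasure ?R)"
    unfolding resolvent_def using sets.sigma_sets_eq[of "borel :: 'e measure"]
    by (intro measure_of_eq) auto
  also have "\<dots> = measure_of (space ?R) (sets ?R) (emeasure ?R)" by simp
  also have "\<dots> = ?R" by (rule measure_of_of_measure)
  finally show ?thesis .
qed

lemma sets_resolvent [simp]: "sets (resolvent \<nu> \<alpha> x) = sets borel"
  by (simp add: resolvent_eq_distr)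

lemma space_resolvent [simp]: "space (resolvent \<nu> \<alpha> x) = UNIV"
  by (simp add: resolvent_eq_distr)

section \<open>Algebra of the resolvent\<close>

abbreviation U :: "real \<Rightarrow> ('e \<Rightarrow> ennreal) \<Rightarrow> 'e \<Rightarrow> ennreal" where
  "U \<alpha> \<equiv> kernel_op (resolvent \<nu> \<alpha>)"

lemma U_eq_process:
  assumes [measurable]: "f \<in> borel_measurable borel"
  shows "U \<alpha> f x = (\<integral>\<^sup>+z. ennreal (exp (- \<alpha> * fst z)) * indicator {0..} (fst z) * f (x + path_map z) \<partial>(lborel \<Otimes>\<^sub>M P 0))"
  unfolding kernel_op_def resolvent_eq_distr
  by (subst nn_integral_distr) (simp_all add: nn_integral_density)

lemma U_eq:
  assumes [measurable]: "f \<in> borel_measurable borel"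
  shows "U \<alpha> f x = (\<integral>\<^sup>+t. ennreal (exp (- \<alpha> * t)) * indicator {0..} t * semigroup f t x \<partial>lborel)"
proof -
  have "U \<alpha> f x = (\<integral>\<^sup>+t. (\<integral>\<^sup>+\<omega>. ennreal (exp (- \<alpha> * t)) * indicator {0..} t * f (x + path_map (t, \<omega>)) \<partial>P 0) \<partial>lborel)"
    unfolding U_eq_process[OF assms] by (subst P.nn_integral_fst[symmetric]) simp_all
  also have "\<dots> = (\<integral>\<^sup>+t. ennreal (exp (- \<alpha> * t)) * indicator {0..} t * semigroup f t x \<partial>lborel)"
    unfolding semigroup_def by (intro nn_integral_cong nn_integral_cmult) measurable
  finally show ?thesis .
qed

lemma U_measurable [measurable]:
  assumes [measurable]: "f \<in> borel_measurable borel"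
  shows "U \<alpha> f \<in> borel_measurable borel"
proof -
  have "(\<lambda>x. \<integral>\<^sup>+t. ennreal (exp (- \<alpha> * t)) * indicator {0..} t * semigroup f t x \<partial>lborel) \<in> borel_measurable borel"
    by measurable
  then show ?thesis by (simp add: U_eq[OF assms, abs_def])
qed

lemma U_mono: "(\<And>y. f y \<le> g y) \<Longrightarrow> U \<alpha> f x \<le> U \<alpha> g x"
  unfolding kernel_op_def by (intro nn_integral_mono) simp

lemma U_add:
  "f \<in> borel_measurable borel \<Longrightarrow> g \<in> borel_measurable borel \<Longrightarrow> U \<alpha> (\<lambda>y. f y + g y) x = U \<alpha> f x + U \<alpha> g x"
  unfolding kernel_op_def by (intro nn_integral_add) (simp_all cong: measurable_cong_sets)

lemma U_cmult: "f \<in> borel_measurable borel \<Longrightarrow> U \<alpha> (\<lambda>y. c * f y) x = c * U \<alpha> f x"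
  unfolding kernel_op_def by (intro nn_integral_cmult) (simp cong: measurable_cong_sets)

lemma U_indicator: "A \<in> sets borel \<Longrightarrow> U \<alpha> (indicator A) x = emeasure (resolvent \<nu> \<alpha> x) A"
  unfolding kernel_op_def by simp

lemma U_one:
  assumes "0 < \<alpha>"
  shows "U \<alpha> (\<lambda>_. 1) x = ennreal (1 / \<alpha>)"
proof -
  have "semigroup (\<lambda>_. 1) t x = 1" for t
    using P.emeasure_space_1[of 0] by (simp add: semigroup_def)
  then show ?thesis using nn_integral_exp_atLeast_0[OF assms] by (simp add: U_eq)
qed

lemma U_le:
  assumes "0 < \<alpha>" "\<And>y. f y \<le> c"
  shows "U \<alpha> f x \<le> c * ennreal (1 / \<alpha>)"
  using U_mono[of f "\<lambda>_. c" \<alpha> x] U_cmult[of "\<lambda>_. 1" \<alpha> c x] U_one[OF assms(1), of x] assms(2) by simp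

text \<open>Chapman-Kolmogorov leaves a semigroup factor depending on \<open>s + t\<close> alone.
  Commutation follows by exchanging the integrals, the resolvent equation by substituting
  \<open>r = s + t\<close>.\<close>

lemma U_U_eq:
  assumes f [measurable]: "f \<in> borel_measurable borel"
  shows "U \<gamma> (U \<alpha> f) x = (\<integral>\<^sup>+s. \<integral>\<^sup>+t. ennreal (exp (- \<gamma> * s)) * indicator {0..} s *
    (ennreal (exp (- \<alpha> * t)) * indicator {0..} t * semigroup f (s + t) x) \<partial>lborel \<partial>lborel)"
proof -
  have "U \<gamma> (U \<alpha> f) x = (\<integral>\<^sup>+s. ennreal (exp (- \<gamma> * s)) * indicator {0..} s * semigroup (U \<alpha> f) s x \<partial>lborel)"
    by (rule U_eq) measurable
  also have "\<dots> = (\<integral>\<^sup>+s. \<integral>\<^sup>+t. ennreal (exp (- \<gamma> * s)) * indicator {0..} s *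
    (ennreal (exp (- \<alpha> * t)) * indicator {0..} t * semigroup f (s + t) x) \<partial>lborel \<partial>lborel)"
  proof (rule nn_integral_cong)
    fix s :: real
    show "ennreal (exp (- \<gamma> * s)) * indicator {0..} s * semigroup (U \<alpha> f) s x =
      (\<integral>\<^sup>+t. ennreal (exp (- \<gamma> * s)) * indicator {0..} s *
        (ennreal (exp (- \<alpha> * t)) * indicator {0..} t * semigroup f (s + t) x) \<partial>lborel)"
    proof (cases "0 \<le> s")
      case s: True
      interpret s: prob_space "transition \<nu> s x" using s by (rule prob_transition)
      interpret pair_sigma_finite lborel "transition \<nu> s x" by standard
      have "semigroup (U \<alpha> f) s x = (\<integral>\<^sup>+y. U \<alpha> f y \<partial>transition \<nu> s x)"
        by (rule semigroup_eq[OF s]) measurable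
      also have "\<dots> = (\<integral>\<^sup>+y. (\<integral>\<^sup>+t. ennreal (exp (- \<alpha> * t)) * indicator {0..} t * semigroup f t y \<partial>lborel) \<partial>transition \<nu> s x)"
        by (simp add: U_eq)
      also have "\<dots> = (\<integral>\<^sup>+t. (\<integral>\<^sup>+y. ennreal (exp (- \<alpha> * t)) * indicator {0..} t * semigroup f t y \<partial>transition \<nu> s x) \<partial>lborel)"
      proof (rule Fubini')
        have "(\<lambda>p. ennreal (exp (- \<alpha> * fst p)) * indicator {0..} (fst p) * semigroup f (fst p) (snd p)) \<in> borel_measurable (borel \<Otimes>\<^sub>M borel)"
          by measurable
        then show "(\<lambda>(t, y). ennreal (exp (- \<alpha> * t)) * indicator {0..} t * semigroup f t y)
            \<in> borel_measurable (lborel \<Otimes>\<^sub>M transition \<nu> s x)"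
          by (simp add: case_prod_beta cong: measurable_cong_sets sets_pair_measure_cong)
      qed
      also have "\<dots> = (\<integral>\<^sup>+t. ennreal (exp (- \<alpha> * t)) * indicator {0..} t * semigroup f (s + t) x \<partial>lborel)"
      proof (rule nn_integral_cong)
        fix t :: real
        show "(\<integral>\<^sup>+y. ennreal (exp (- \<alpha> * t)) * indicator {0..} t * semigroup f t y \<partial>transition \<nu> s x) =
          ennreal (exp (- \<alpha> * t)) * indicator {0..} t * semigroup f (s + t) x"
        proof (cases "0 \<le> t")
          case t: True
          have "(\<integral>\<^sup>+y. ennreal (exp (- \<alpha> * t)) * semigroup f t y \<partial>transition \<nu> s x) =
              ennreal (exp (- \<alpha> * t)) * (\<integral>\<^sup>+y. (\<integral>\<^sup>+z. f z \<partial>transition \<nu> t y) \<partial>transition \<nu> s x)"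
            unfolding semigroup_eq[OF t f]
            using nn_integral_transition_measurable[OF t f]
            by (intro nn_integral_cmult) (simp cong: measurable_cong_sets)
          then show ?thesis
            using s t f by (simp add: chapman_kolmogorov semigroup_eq)
        qed simp
      qed
      finally show ?thesis by (subst nn_integral_cmult) simp_all
    qed simp
  qed
  finally show ?thesis .
qed

lemma U_commute:
  assumes f [measurable]: "f \<in> borel_measurable borel"
  shows "U \<gamma> (U \<alpha> f) x = U \<alpha> (U \<gamma> f) x"
proof -
  show ?thesis
    unfolding U_U_eq[OF f]
    by (subst lborel_pair.Fubini') (auto simp: ac_simps intro!: nn_integral_cong)
qed

text \<open>With \<open>r = s + t\<close> and \<open>c = \<gamma> - \<alpha>\<close>, the integral
  over \<open>s\<close> in \<open>{0..r}\<close> yields \<open>(1 - exp (- c * r)) / c\<close>. The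
  additive form remains meaningful when potentials are infinite.\<close>

lemma resolvent_equation:
  assumes f [measurable]: "f \<in> borel_measurable borel" and \<alpha>: "\<alpha> < \<gamma>"
  shows "U \<alpha> f x = ennreal (\<gamma> - \<alpha>) * U \<gamma> (U \<alpha> f) x + U \<gamma> f x"
proof -
  define c where "c = \<gamma> - \<alpha>"
  have c: "0 < c" using \<alpha> by (simp add: c_def)
  let ?h = "\<lambda>r. semigroup f r x"
  let ?k = "\<lambda>s r. ennreal (exp (- \<gamma> * s)) * indicator {0..} s *
    (ennreal (exp (- \<alpha> * (r - s))) * indicator {0..} (r - s) * ?h r)"
  have h [measurable]: "?h \<in> borel_measurable borel" by measurable
  have "U \<gamma> (U \<alpha> f) x = (\<integral>\<^sup>+s. \<integral>\<^sup>+t. ennreal (exp (- \<gamma> * s)) * indicator {0..} s *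
    (ennreal (exp (- \<alpha> * t)) * indicator {0..} t * ?h (s + t)) \<partial>lborel \<partial>lborel)"
    by (rule U_U_eq[OF f])
  also have "\<dots> = (\<integral>\<^sup>+s. \<integral>\<^sup>+r. ?k s r \<partial>lborel \<partial>lborel)"
  proof (rule nn_integral_cong)
    fix s :: real
    show "(\<integral>\<^sup>+t. ennreal (exp (- \<gamma> * s)) * indicator {0..} s *
      (ennreal (exp (- \<alpha> * t)) * indicator {0..} t * ?h (s + t)) \<partial>lborel) =
      (\<integral>\<^sup>+r. ?k s r \<partial>lborel)"
      by (subst (2) nn_integral_real_affine[where c=1 and t=s]) simp_all
  qed
  also have "\<dots> = (\<integral>\<^sup>+r. \<integral>\<^sup>+s. ?k s r \<partial>lborel \<partial>lborel)"
    by (rule lborel_pair.Fubini') simp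
  also have "\<dots> = (\<integral>\<^sup>+r. ennreal ((1 - exp (- c * r)) / c) * (ennreal (exp (- \<alpha> * r)) * indicator {0..} r * ?h r) \<partial>lborel)"
  proof (rule nn_integral_cong)
    fix r :: real
    have "(\<integral>\<^sup>+s. ?k s r \<partial>lborel) =
      (\<integral>\<^sup>+s. (ennreal (exp (- c * s)) * indicator {0..r} s) * (ennreal (exp (- \<alpha> * r)) * ?h r) \<partial>lborel)"
    proof (rule nn_integral_cong)
      fix s :: real
      have "exp (- \<gamma> * s) * exp (- \<alpha> * (r - s)) = exp (- c * s) * exp (- \<alpha> * r)"
        by (simp add: exp_add[symmetric] c_def algebra_simps)
      then have "ennreal (exp (- \<gamma> * s)) * ennreal (exp (- \<alpha> * (r - s))) =
          ennreal (exp (- c * s)) * ennreal (exp (- \<alpha> * r))"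
        by (simp add: ennreal_mult[symmetric])
      then show "?k s r =
        (ennreal (exp (- c * s)) * indicator {0..r} s) * (ennreal (exp (- \<alpha> * r)) * ?h r)"
        by (auto simp: mult.assoc[symmetric] split: split_indicator)
    qed
    also have "\<dots> = (\<integral>\<^sup>+s. ennreal (exp (- c * s)) * indicator {0..r} s \<partial>lborel) * (ennreal (exp (- \<alpha> * r)) * ?h r)"
      by (rule nn_integral_multc) simp
    also have "\<dots> = ennreal ((1 - exp (- c * r)) / c) * (ennreal (exp (- \<alpha> * r)) * indicator {0..} r * ?h r)"
    proof (cases "0 \<le> r")
      case True
      then show ?thesis using nn_integral_exp_Icc[of c r] c by simp
    next
      case False
      then show ?thesis by simp
    qed
    finally show "(\<integral>\<^sup>+s. ?k s r \<partial>lborel) =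
      ennreal ((1 - exp (- c * r)) / c) * (ennreal (exp (- \<alpha> * r)) * indicator {0..} r * ?h r)" .
  qed
  finally have "ennreal c * U \<gamma> (U \<alpha> f) x + U \<gamma> f x =
      (\<integral>\<^sup>+r. ennreal c * (ennreal ((1 - exp (- c * r)) / c) * (ennreal (exp (- \<alpha> * r)) * indicator {0..} r * ?h r)) \<partial>lborel) +
      (\<integral>\<^sup>+r. ennreal (exp (- \<gamma> * r)) * indicator {0..} r * ?h r \<partial>lborel)"
    by (simp add: nn_integral_cmult U_eq)
  also have "\<dots> = (\<integral>\<^sup>+r. ennreal c * (ennreal ((1 - exp (- c * r)) / c) * (ennreal (exp (- \<alpha> * r)) * indicator {0..} r * ?h r)) +
      ennreal (exp (- \<gamma> * r)) * indicator {0..} r * ?h r \<partial>lborel)"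
    by (rule nn_integral_add[symmetric]) simp_all
  also have "\<dots> = (\<integral>\<^sup>+r. ennreal (exp (- \<alpha> * r)) * indicator {0..} r * ?h r \<partial>lborel)"
  proof (rule nn_integral_cong)
    fix r :: real
    show "ennreal c * (ennreal ((1 - exp (- c * r)) / c) * (ennreal (exp (- \<alpha> * r)) * indicator {0..} r * ?h r)) +
      ennreal (exp (- \<gamma> * r)) * indicator {0..} r * ?h r = ennreal (exp (- \<alpha> * r)) * indicator {0..} r * ?h r"
    proof (cases "0 \<le> r")
      case True
      then have e: "0 \<le> 1 - exp (- c * r)" using c by simp
      have "c * ((1 - exp (- c * r)) / c) * exp (- \<alpha> * r) + exp (- \<gamma> * r) = exp (- \<alpha> * r)"
      proof -
        have "exp (- c * r) * exp (- \<alpha> * r) = exp (- \<gamma> * r)"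
          by (simp add: exp_add[symmetric] c_def algebra_simps)
        then show ?thesis using c by (simp add: left_diff_distrib)
      qed
      then have "ennreal c * ennreal ((1 - exp (- c * r)) / c) * ennreal (exp (- \<alpha> * r)) + ennreal (exp (- \<gamma> * r)) =
          ennreal (exp (- \<alpha> * r))"
        using c e by (simp add: ennreal_mult[symmetric] ennreal_plus[symmetric] del: ennreal_plus)
      then show ?thesis using True by (simp add: mult.assoc[symmetric] distrib_right[symmetric])
    qed simp
  qed
  also have "\<dots> = U \<alpha> f x" by (simp add: U_eq)
  finally show ?thesis by (simp add: c_def)
qed

lemma U_eq_add:
  assumes "f \<in> borel_measurable borel" "0 < \<alpha>"
  shows "U \<beta> f x = ennreal \<alpha> * U (\<beta> + \<alpha>) (U \<beta> f) x + U (\<beta> + \<alpha>) f x"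
  using resolvent_equation[OF assms(1), of \<beta> "\<beta> + \<alpha>" x] assms(2) by simp

lemma U_supermedian:
  assumes "f \<in> borel_measurable borel" "0 < \<alpha>"
  shows "ennreal \<alpha> * U (\<beta> + \<alpha>) (U \<beta> f) x \<le> U \<beta> f x"
  using U_eq_add[OF assms, of \<beta> x] by simp

text \<open>Boundedness of \<open>f\<close> makes all potentials finite, so the resolvent equation
  may be written as a difference; its second term is at most \<open>1 / (\<beta> + \<alpha>)\<close>
  and vanishes in the limit.\<close>

lemma excessive_U:
  assumes f: "f \<in> borel_measurable borel" "\<And>y. f y \<le> 1" and \<beta>: "0 < \<beta>"
  shows "excessive \<nu> \<beta> (U \<beta> f)"
  unfolding excessive_def
proof (intro conjI allI impI)
  show "U \<beta> f \<in> borel_measurable borel" using f by measurable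
  show "ennreal \<alpha> * U (\<beta> + \<alpha>) (U \<beta> f) x \<le> U \<beta> f x" if "0 < \<alpha>" for \<alpha> x
    by (rule U_supermedian[OF f(1) that])
  fix x
  have fin: "U \<beta> f x \<noteq> \<infinity>"
    using U_le[of \<beta> f 1 x, OF \<beta> f(2)] by (auto simp: top_unique)
  have lim: "((\<lambda>\<alpha>. U (\<beta> + \<alpha>) f x) \<longlongrightarrow> 0) at_top"
  proof (rule tendsto_sandwich[OF _ _ tendsto_const])
    show "\<forall>\<^sub>F \<alpha> in at_top. U (\<beta> + \<alpha>) f x \<le> ennreal (1 / (\<beta> + \<alpha>))"
      using eventually_gt_at_top[of 0]
    proof eventually_elim
      case (elim \<alpha>)
      then show ?case using U_le[of "\<beta> + \<alpha>" f 1 x] f(2) \<beta> by simp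
    qed
    have "((\<lambda>\<alpha>. 1 / (\<beta> + \<alpha>)) \<longlongrightarrow> 0) at_top"
      by (intro tendsto_divide_0[OF tendsto_const] filterlim_at_top_imp_at_infinity
        filterlim_tendsto_add_at_top[OF tendsto_const filterlim_ident])
    from tendsto_ennrealI[OF this] show "((\<lambda>\<alpha>. ennreal (1 / (\<beta> + \<alpha>))) \<longlongrightarrow> 0) at_top" by simp
  qed simp
  have "((\<lambda>\<alpha>. U \<beta> f x - U (\<beta> + \<alpha>) f x) \<longlongrightarrow> U \<beta> f x - 0) at_top"
    by (intro tendsto_diff_ennreal_general tendsto_const lim) simp
  moreover have "\<forall>\<^sub>F \<alpha> in at_top. U \<beta> f x - U (\<beta> + \<alpha>) f x = ennreal \<alpha> * U (\<beta> + \<alpha>) (U \<beta> f) x"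
    using eventually_gt_at_top[of 0]
  proof eventually_elim
    case (elim \<alpha>)
    have "U (\<beta> + \<alpha>) f x \<noteq> \<infinity>" using U_le[of "\<beta> + \<alpha>" f 1 x] f(2) \<beta> elim by (auto simp: top_unique)
    then show ?case
      using U_eq_add[OF f(1) elim, of \<beta> x] by (metis ennreal_add_diff_cancel_right infinity_ennreal_def)
  qed
  ultimately show "((\<lambda>\<alpha>. ennreal \<alpha> * U (\<beta> + \<alpha>) (U \<beta> f) x) \<longlongrightarrow> U \<beta> f x) at_top"
    by (simp add: tendsto_cong)
qed

section \<open>Small times and large resolvent parameters\<close>

text \<open>Under \<open>P 0\<close> almost every path leaves 0 continuously, so its translate by
  \<open>y\<close> is eventually in the open set \<open>G\<close>; dominated convergence does the
  rest.\<close>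

lemma semigroup_open_at_0:
  assumes G: "open G" "y \<in> G" and t: "\<And>n. 0 \<le> t n" "t \<longlonglongrightarrow> 0"
  shows "(\<lambda>n. semigroup (indicator G) (t n) y) \<longlonglongrightarrow> 1"
proof -
  have [measurable]: "G \<in> sets borel" using G by simp
  have "(\<lambda>n. \<integral>\<^sup>+\<omega>. indicator G (y + path_map (t n, \<omega>)) \<partial>P 0) \<longlonglongrightarrow> (\<integral>\<^sup>+\<omega>. 1 \<partial>P 0)"
  proof (rule nn_integral_dominated_convergence[where w="\<lambda>_. 1"])
    show "AE \<omega> in P 0. (\<lambda>n. indicator G (y + path_map (t n, \<omega>))) \<longlonglongrightarrow> (1::ennreal)"
      using normal[of 0] AE_space
    proof eventually_elim
      case (elim \<omega>)
      \<comment> \<open>The times \<open>t n\<close> may equal 0, so the limit is needed within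
        \<open>{0..}\<close>, not only from strictly positive times.\<close>
      have right: "((\<lambda>s. X s \<omega>) \<longlongrightarrow> X 0 \<omega>) (at 0 within {0..})"
      proof -
        have "((\<lambda>s. X s \<omega>) \<longlongrightarrow> X 0 \<omega>) (at_right 0)"
          using paths_right_continuous[of \<omega> 0] elim by (simp add: continuous_within)
        then show ?thesis
          by (simp add: at_within_Ici_at_right)
      qed
      have "(\<lambda>n. X (t n) \<omega>) \<longlonglongrightarrow> X 0 \<omega>"
        using continuous_within_tendsto_compose'[of 0 "{0..}" "\<lambda>s. X s \<omega>" t sequentially] right t
        by (simp add: continuous_within)
      then have "(\<lambda>n. y + X (t n) \<omega>) \<longlonglongrightarrow> y + 0" using elim by (intro tendsto_intros) simp
      then have "eventually (\<lambda>n. y + X (t n) \<omega> \<in> G) sequentially"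
        using G by (intro topological_tendstoD) auto
      then have "eventually (\<lambda>n. indicator G (y + path_map (t n, \<omega>)) = (1::ennreal)) sequentially"
        by eventually_elim (use t in \<open>simp add: path_map_def\<close>)
      then show ?case by (rule tendsto_eventually)
    qed
  qed (use P.emeasure_space_1[of 0] in \<open>auto split: split_indicator\<close>)
  then show ?thesis using P.emeasure_space_1[of 0] by (simp add: semigroup_def)
qed

lemma semigroup_le_1: "(\<And>y. f y \<le> 1) \<Longrightarrow> semigroup f t x \<le> 1"
  using nn_integral_mono[of "P 0" "\<lambda>\<omega>. f (x + path_map (t, \<omega>))" "\<lambda>_. 1"] P.emeasure_space_1[of 0]
  by (simp add: semigroup_def)

text \<open>Rescaling time by \<open>Suc n\<close> cancels the prefactor and turns the weight into
  \<open>exp (- s)\<close> times a factor tending to 1. The semigroup is then evaluated at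
  \<open>s / Suc n\<close>, and \<open>exp (- s)\<close> dominates.\<close>

lemma scaled_U_open:
  fixes \<beta> :: real
  assumes G: "open G" "y \<in> G" and \<beta>: "0 < \<beta>"
  shows "(\<lambda>n. ennreal (Suc n) * U (\<beta> + Suc n) (indicator G) y) \<longlonglongrightarrow> 1"
proof -
  have Gm [measurable]: "G \<in> sets borel" using G by simp
  let ?w = "\<lambda>s. ennreal (exp (- 1 * s)) * indicator {0..} s"
  let ?v = "\<lambda>n s. ?w s * (ennreal (exp (- \<beta> * (s / Suc n))) * semigroup (indicator G) (s / Suc n) y)"
  have eq: "ennreal (Suc n) * U (\<beta> + Suc n) (indicator G) y = (\<integral>\<^sup>+s. ?v n s \<partial>lborel)" for n
  proof -
    have "ennreal (Suc n) * U (\<beta> + Suc n) (indicator G) y = ennreal (Suc n) * (ennreal \<bar>1 / Suc n\<bar> *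
      (\<integral>\<^sup>+s. ennreal (exp (- (\<beta> + Suc n) * (0 + 1 / Suc n * s))) * indicator {0..} (0 + 1 / Suc n * s) *
        semigroup (indicator G) (0 + 1 / Suc n * s) y \<partial>lborel))"
      by (subst U_eq, simp, subst nn_integral_real_affine[where c="1 / Suc n" and t=0]) (simp_all del: of_nat_Suc)
    also have "\<dots> = (\<integral>\<^sup>+s. ennreal (exp (- (\<beta> + Suc n) * (0 + 1 / Suc n * s))) * indicator {0..} (0 + 1 / Suc n * s) *
        semigroup (indicator G) (0 + 1 / Suc n * s) y \<partial>lborel)"
      by (simp add: mult.assoc[symmetric] ennreal_mult[symmetric] del: of_nat_Suc)
    also have "\<dots> = (\<integral>\<^sup>+s. ?v n s \<partial>lborel)"
    proof (rule nn_integral_cong)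
      fix s :: real
      have "- (\<beta> + Suc n) * (0 + 1 / Suc n * s) = - 1 * s + - \<beta> * (s / Suc n)"
        by (simp add: field_simps)
      then have "ennreal (exp (- (\<beta> + Suc n) * (0 + 1 / Suc n * s))) =
          ennreal (exp (- 1 * s)) * ennreal (exp (- \<beta> * (s / Suc n)))"
        by (simp only: exp_add ennreal_mult exp_ge_zero)
      moreover have "indicator {0..} (0 + 1 / Suc n * s) = (indicator {0..} s :: ennreal)"
        by (simp add: zero_le_divide_iff split: split_indicator)
      ultimately show "ennreal (exp (- (\<beta> + Suc n) * (0 + 1 / Suc n * s))) * indicator {0..} (0 + 1 / Suc n * s) *
        semigroup (indicator G) (0 + 1 / Suc n * s) y = ?v n s"
        by (simp add: ac_simps)
    qed
    finally show ?thesis .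
  qed
  have "(\<lambda>n. \<integral>\<^sup>+s. ?v n s \<partial>lborel) \<longlonglongrightarrow> (\<integral>\<^sup>+s. ?w s \<partial>lborel)"
  proof (rule nn_integral_dominated_convergence[where w="?w"])
    show "AE s in lborel. ?v n s \<le> ?w s" for n
    proof (rule AE_I2)
      fix s :: real
      have "ennreal (exp (- \<beta> * (s / Suc n))) * semigroup (indicator G) (s / Suc n) y \<le> 1 * 1" if "0 \<le> s"
        using \<beta> that by (intro mult_mono semigroup_le_1) (auto simp: ennreal_le_1 split: split_indicator)
      then show "?v n s \<le> ?w s"
        using mult_left_mono[of _ 1 "?w s"] by (cases "0 \<le> s") auto
    qed
    show "(\<integral>\<^sup>+s. ?w s \<partial>lborel) < \<infinity>" using nn_integral_exp_atLeast_0[of 1] by simp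
    show "AE s in lborel. (\<lambda>n. ?v n s) \<longlonglongrightarrow> ?w s"
    proof (rule AE_I2)
      fix s :: real
      show "(\<lambda>n. ?v n s) \<longlonglongrightarrow> ?w s"
      proof (cases "0 \<le> s")
        case s: True
        have lim: "(\<lambda>n. s / real (Suc n)) \<longlonglongrightarrow> 0"
          by (rule LIMSEQ_Suc[OF lim_const_over_n])
        have "(\<lambda>n. ennreal (exp (- \<beta> * (s / Suc n)))) \<longlonglongrightarrow> ennreal (exp (- \<beta> * 0))"
          by (intro tendsto_intros lim)
        moreover have "(\<lambda>n. semigroup (indicator G) (s / Suc n) y) \<longlonglongrightarrow> 1"
          using s lim by (intro semigroup_open_at_0 G) auto
        ultimately have "(\<lambda>n. ?v n s) \<longlonglongrightarrow> ?w s * (ennreal (exp (- \<beta> * 0)) * 1)"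
          by (intro tendsto_mult_ennreal tendsto_const) (auto split: split_indicator)
        then show ?thesis by simp
      qed simp
    qed
  qed simp_all
  moreover have "(\<integral>\<^sup>+s. ?w s \<partial>lborel) = 1" using nn_integral_exp_atLeast_0[of 1] by simp
  ultimately show ?thesis unfolding eq by (simp only:)
qed

text \<open>
  The minimum \<open>w\<close> of \<open>u\<close> and \<open>U\<^sub>\<beta> 1\<^sub>A\<close> satisfies \<open>\<alpha> U\<^sub>\<beta>\<^sub>+\<^sub>\<alpha> w + 1\<^sub>A U\<^sub>\<beta>\<^sub>+\<^sub>\<alpha> 1\<^sub>A \<le> w\<close>. Apply \<open>U\<^sub>\<beta>\<close> and use the
  resolvent equation.
\<close>

lemma domination_approx:
  assumes u [measurable]: "u \<in> borel_measurable borel" and A [measurable]: "A \<in> sets borel"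
    and \<beta>: "0 < \<beta>" and \<alpha>: "0 < \<alpha>"
    and sm: "\<And>x. ennreal \<alpha> * U (\<beta> + \<alpha>) u x \<le> u x"
    and le: "\<And>y. y \<in> A \<Longrightarrow> U \<beta> (indicator A) y \<le> u y"
  shows "ennreal \<alpha> * U \<beta> (\<lambda>y. indicator A y * U (\<beta> + \<alpha>) (indicator A) y) x \<le> u x"
proof -
  let ?p = "U \<beta> (indicator A)"
  let ?V = "U (\<beta> + \<alpha>)"
  let ?g = "\<lambda>y. indicator A y * ?V (indicator A) y"
  define w where "w y = min (u y) (?p y)" for y
  have w [measurable]: "w \<in> borel_measurable borel" unfolding w_def by measurable
  have w_p: "w y \<le> ?p y" and w_u: "w y \<le> u y" for y by (simp_all add: w_def)
  have aVw: "ennreal \<alpha> * ?V w y \<le> w y" for y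
    unfolding w_def[of y]
  proof (rule min.boundedI)
    show "ennreal \<alpha> * ?V w y \<le> u y"
      using mult_left_mono[OF U_mono[of w u "\<beta> + \<alpha>" y, OF w_u], of "ennreal \<alpha>"] sm[of y] by simp
    show "ennreal \<alpha> * ?V w y \<le> ?p y"
      using mult_left_mono[OF U_mono[of w ?p "\<beta> + \<alpha>" y, OF w_p], of "ennreal \<alpha>"]
        U_supermedian[of "indicator A" \<alpha> \<beta> y] \<alpha> by simp
  qed
  have key: "ennreal \<alpha> * ?V w y + ?g y \<le> w y" for y
  proof (cases "y \<in> A")
    case True
    have "ennreal \<alpha> * ?V w y + ?V (indicator A) y \<le> ennreal \<alpha> * ?V ?p y + ?V (indicator A) y"
      using w_p by (intro add_right_mono mult_left_mono U_mono) auto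
    also have "\<dots> = ?p y" using U_eq_add[of "indicator A" \<alpha> \<beta> y] \<alpha> by simp
    also have "\<dots> = w y" using le[OF True] by (simp add: w_def min_absorb2)
    finally show ?thesis using True by simp
  qed (use aVw in simp)
  have "ennreal \<alpha> * ?V (U \<beta> w) x + U \<beta> ?g x = U \<beta> (\<lambda>y. ennreal \<alpha> * ?V w y + ?g y) x"
    by (simp add: U_add U_cmult U_commute[OF w])
  also have "\<dots> \<le> U \<beta> w x" by (rule U_mono[OF key])
  also have "\<dots> = ennreal \<alpha> * ?V (U \<beta> w) x + ?V w x" by (rule U_eq_add[OF w \<alpha>])
  finally have "ennreal \<alpha> * ?V (U \<beta> w) x + U \<beta> ?g x \<le> ennreal \<alpha> * ?V (U \<beta> w) x + ?V w x" .
  \<comment> \<open>The common term must be finite to be cancelled. This is the reason for capping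
    \<open>u\<close>, which may be infinite, by the potential \<open>?p\<close>, bounded by
    \<open>1 / \<beta>\<close>.\<close>
  moreover have "ennreal \<alpha> * ?V (U \<beta> w) x \<noteq> \<infinity>"
  proof -
    have "indicator A y \<le> (1 :: ennreal)" for y by (simp split: split_indicator)
    then have "?p y \<le> ennreal (1 / \<beta>)" for y using U_le[OF \<beta>, of "indicator A" 1 y] by simp
    then have "w y \<le> ennreal (1 / \<beta>)" for y using w_p order_trans by blast
    then have Uw: "U \<beta> w y \<le> ennreal (1 / \<beta>) * ennreal (1 / \<beta>)" for y by (rule U_le[OF \<beta>])
    have "?V (U \<beta> w) x \<le> ennreal (1 / \<beta>) * ennreal (1 / \<beta>) * ennreal (1 / (\<beta> + \<alpha>))"
      using \<beta> \<alpha> by (intro U_le[OF _ Uw]) simp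
    then have "?V (U \<beta> w) x < \<infinity>" by (rule order_le_less_trans) (simp add: ennreal_mult_less_top)
    then show ?thesis by (simp add: ennreal_mult_eq_top_iff)
  qed
  ultimately have "U \<beta> ?g x \<le> ?V w x" by (simp add: ennreal_add_left_cancel_le)
  then have "ennreal \<alpha> * U \<beta> ?g x \<le> ennreal \<alpha> * ?V w x" by (intro mult_left_mono) auto
  also have "\<dots> \<le> u x" using aVw[of x] w_u[of x] by (rule order_trans)
  finally show ?thesis .
qed

text \<open>\<open>domination_approx\<close> has the extra factor
  \<open>\<alpha> U\<^sub>\<beta>\<^sub>+\<^sub>\<alpha> 1\<^sub>A\<close> on \<open>A\<close>.
  Outer regularity of \<open>resolvent \<nu> \<beta> x\<close> encloses \<open>A\<close> in an open
  \<open>G\<close> at cost \<open>e\<close>; for \<open>G\<close> the corresponding factor tends to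
  1, and the part from \<open>G - A\<close> costs at most \<open>e\<close>.\<close>

theorem domination_principle:
  assumes u: "excessive \<nu> \<beta> u" and A [measurable]: "A \<in> sets borel" and \<beta>: "0 < \<beta>"
    and le: "\<And>y. y \<in> A \<Longrightarrow> U \<beta> (indicator A) y \<le> u y"
  shows "U \<beta> (indicator A) x \<le> u x"
proof (rule ennreal_le_epsilon)
  fix e :: real assume e: "0 < e"
  have u_meas: "u \<in> borel_measurable borel" and sm: "\<And>\<alpha> x. 0 < \<alpha> \<Longrightarrow> ennreal \<alpha> * U (\<beta> + \<alpha>) u x \<le> u x"
    using u by (auto simp: excessive_def)
  let ?\<sigma> = "resolvent \<nu> \<beta> x"
  have "emeasure ?\<sigma> UNIV = U \<beta> (\<lambda>_. 1) x" by (simp add: kernel_op_def)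
  then have fin: "finite_measure ?\<sigma>"
    using U_one[OF \<beta>, of x] by (intro finite_measureI) simp
  then interpret finite_measure ?\<sigma> .
  have "emeasure ?\<sigma> A < emeasure ?\<sigma> A + ennreal e"
    using e by (simp add: emeasure_eq_measure ennreal_plus[symmetric] ennreal_less_iff del: ennreal_plus)
  then have "(INF G\<in>{G. A \<subseteq> G \<and> open G}. emeasure ?\<sigma> G) < emeasure ?\<sigma> A + ennreal e"
    using outer_regular[of ?\<sigma> A] emeasure_finite by simp
  then obtain G where G: "A \<subseteq> G" "open G" "emeasure ?\<sigma> G < emeasure ?\<sigma> A + ennreal e"
    by (auto simp: INF_less_iff)
  have [measurable]: "G \<in> sets borel" using G by simp
  let ?V = "\<lambda>n. U (\<beta> + real (Suc n))"
  let ?J = "\<lambda>n B. \<integral>\<^sup>+y. indicator A y * (ennreal (Suc n) * ?V n (indicator B) y) \<partial>?\<sigma>"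
  have cong: "borel_measurable ?\<sigma> = (borel_measurable borel :: ('e \<Rightarrow> ennreal) set)"
    by (intro measurable_cong_sets) simp_all
  have "(\<lambda>n. ?J n G) \<longlonglongrightarrow> (\<integral>\<^sup>+y. indicator A y \<partial>?\<sigma>)"
  proof (rule tendsto_dominated_nn_integral_le_1[OF fin])
    show "(\<lambda>y. indicator A y * (ennreal (Suc n) * ?V n (indicator G) y)) \<in> borel_measurable ?\<sigma>" for n
      unfolding cong by measurable
    show "indicator A \<in> borel_measurable ?\<sigma>" using A by (intro borel_measurable_indicator) simp
    fix y
    show "(\<lambda>n. indicator A y * (ennreal (Suc n) * ?V n (indicator G) y)) \<longlonglongrightarrow> indicator A y"
      using scaled_U_open[OF G(2) _ \<beta>, of y] G(1) by (cases "y \<in> A") auto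
    fix n
    have "ennreal (Suc n) * ?V n (indicator G) y \<le> ennreal (Suc n) * (1 * ennreal (1 / (\<beta> + Suc n)))"
      using \<beta> by (intro mult_left_mono U_le) (auto split: split_indicator)
    also have "\<dots> \<le> 1"
      using \<beta> by (simp add: ennreal_mult[symmetric] ennreal_le_1 field_simps del: of_nat_Suc)
    finally show "indicator A y * (ennreal (Suc n) * ?V n (indicator G) y) \<le> 1"
      by (simp split: split_indicator)
  qed
  moreover have "?J n G \<le> u x + ennreal e" for n
  proof -
    have J: "?J n B = ennreal (Suc n) * U \<beta> (\<lambda>y. indicator A y * ?V n (indicator B) y) x"
      if [measurable]: "B \<in> sets borel" for B
    proof -
      have "?J n B = U \<beta> (\<lambda>y. ennreal (Suc n) * (indicator A y * ?V n (indicator B) y)) x"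
        by (simp add: kernel_op_def ac_simps)
      then show ?thesis by (subst (asm) U_cmult) simp_all
    qed
    have "?V n (indicator G) y = ?V n (indicator A) y + ?V n (indicator (G - A)) y" for y
    proof -
      have "(indicator G :: 'e \<Rightarrow> ennreal) = (\<lambda>y. indicator A y + indicator (G - A) y)"
        using G(1) by (auto simp: fun_eq_iff split: split_indicator)
      then show ?thesis by (simp add: U_add)
    qed
    then have "?J n G = (\<integral>\<^sup>+y. indicator A y * (ennreal (Suc n) * ?V n (indicator A) y) +
        indicator A y * (ennreal (Suc n) * ?V n (indicator (G - A)) y) \<partial>?\<sigma>)"
      by (simp add: distrib_left)
    also have "\<dots> = ?J n A + ?J n (G - A)"
      by (rule nn_integral_add) (unfold cong, measurable)
    also have "\<dots> \<le> u x + ennreal e"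
    proof (rule add_mono)
      have GA: "G - A \<in> sets borel" by measurable
      show "?J n A \<le> u x"
        unfolding J[OF A] by (rule domination_approx[OF u_meas A \<beta> _ sm le]) simp_all
      \<comment> \<open>Dropping the indicator of \<open>A\<close> and commuting the resolvents
        reduces the error term, uniformly in \<open>n\<close>, to the potential of
        \<open>G - A\<close> at \<open>x\<close>.\<close>
      have "?J n (G - A) \<le> ennreal (Suc n) * U \<beta> (?V n (indicator (G - A))) x"
        unfolding J[OF GA] by (intro mult_left_mono U_mono) (auto split: split_indicator)
      also have "\<dots> = ennreal (Suc n) * ?V n (U \<beta> (indicator (G - A))) x"
        by (simp only: U_commute[of "indicator (G - A)"] borel_measurable_indicator sets.Diff A \<open>G \<in> sets borel\<close>)
      also have "\<dots> \<le> U \<beta> (indicator (G - A)) x" by (rule U_supermedian) simp_all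
      also have "\<dots> = emeasure ?\<sigma> G - emeasure ?\<sigma> A"
        using G(1) emeasure_finite by (subst U_indicator) (auto intro!: emeasure_Diff)
      also have "\<dots> \<le> ennreal e" using G(3) by (simp add: ennreal_minus_le_iff less_imp_le)
      finally show "?J n (G - A) \<le> ennreal e" .
    qed
    finally show ?thesis .
  qed
  ultimately have "(\<integral>\<^sup>+y. indicator A y \<partial>?\<sigma>) \<le> u x + ennreal e"
    by (intro LIMSEQ_le_const2) auto
  then show "U \<beta> (indicator A) x \<le> u x + ennreal e" by (simp add: kernel_op_def)
qed

section \<open>Balayage of potentials\<close>

lemma balayage_le:
  assumes v: "excessive \<nu> \<beta> v"
  shows "balayage \<nu> \<beta> M v x \<le> v x"
  unfolding balayage_def
proof (rule SUP_least)
  fix \<alpha> :: real assume "\<alpha> \<in> {0<..}"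
  have "reduced \<nu> \<beta> M v y \<le> v y" for y
    unfolding reduced_def using v by (intro INF_lower) simp
  then have "ennreal \<alpha> * U (\<beta> + \<alpha>) (reduced \<nu> \<beta> M v) x \<le> ennreal \<alpha> * U (\<beta> + \<alpha>) v x"
    by (intro mult_left_mono U_mono) auto
  also have "\<dots> \<le> v x" using v \<open>\<alpha> \<in> {0<..}\<close> by (auto simp: excessive_def)
  finally show "ennreal \<alpha> * U (\<beta> + \<alpha>) (reduced \<nu> \<beta> M v) x \<le> v x" .
qed

text \<open>As \<open>A \<subseteq> M\<close>, every competitor in the infimum dominates the
  potential on \<open>A\<close>, hence everywhere. Regularization loses nothing because the
  potential is itself excessive.\<close>

lemma balayage_potential_eq:
  assumes \<beta>: "0 < \<beta>" and A: "A \<in> sets borel" "A \<subseteq> M"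
  shows "balayage \<nu> \<beta> M (U \<beta> (indicator A)) x = U \<beta> (indicator A) x"
proof (rule antisym)
  let ?p = "U \<beta> (indicator A)"
  have p: "excessive \<nu> \<beta> ?p"
    using A(1) by (intro excessive_U[OF _ _ \<beta>]) (auto split: split_indicator)
  show "balayage \<nu> \<beta> M ?p x \<le> ?p x" by (rule balayage_le[OF p])
  have red: "?p y \<le> reduced \<nu> \<beta> M ?p y" for y
    unfolding reduced_def
  proof (rule INF_greatest)
    fix u assume "u \<in> {u. excessive \<nu> \<beta> u \<and> (\<forall>y\<in>M. ?p y \<le> u y)}"
    then have u: "excessive \<nu> \<beta> u" "\<forall>z\<in>M. ?p z \<le> u z" by blast+
    show "?p y \<le> u y"
      by (rule domination_principle[OF u(1) A(1) \<beta>]) (use u(2) A(2) in blast)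
  qed
  have "((\<lambda>\<alpha>. ennreal \<alpha> * U (\<beta> + \<alpha>) ?p x) \<longlongrightarrow> ?p x) at_top" using p by (simp add: excessive_def)
  moreover have "\<forall>\<^sub>F \<alpha> in at_top. ennreal \<alpha> * U (\<beta> + \<alpha>) ?p x \<le> balayage \<nu> \<beta> M ?p x"
    using eventually_gt_at_top[of 0]
  proof eventually_elim
    case (elim \<alpha>)
    have "ennreal \<alpha> * U (\<beta> + \<alpha>) ?p x \<le> ennreal \<alpha> * U (\<beta> + \<alpha>) (reduced \<nu> \<beta> M ?p) x"
      using red by (intro mult_left_mono U_mono) auto
    also have "\<dots> \<le> balayage \<nu> \<beta> M ?p x"
      unfolding balayage_def using elim by (intro SUP_upper) simp
    finally show ?case .
  qed
  ultimately show "?p x \<le> balayage \<nu> \<beta> M ?p x"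
    by (rule tendsto_upperbound[OF _ _ trivial_limit_at_top_linorder])
qed

section \<open>Balayage of measures\<close>

lemma emeasure_resolvent_measurable:
  assumes "A \<in> sets borel"
  shows "(\<lambda>x. emeasure (resolvent \<nu> \<alpha> x) A) \<in> borel_measurable borel"
  using U_measurable[of "indicator A" \<alpha>] assms by (simp add: U_indicator[OF assms, abs_def])

lemma emeasure_comp_resolvent:
  assumes \<mu>: "sets \<mu> = sets borel" and A: "A \<in> sets borel"
  shows "emeasure (kernel_comp borel \<mu> (resolvent \<nu> \<alpha>)) A = (\<integral>\<^sup>+x. U \<alpha> (indicator A) x \<partial>\<mu>)"
proof -
  have "(\<lambda>x. emeasure (resolvent \<nu> \<alpha> x) B) \<in> borel_measurable (completion \<mu>)" if "B \<in> sets borel" for B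
    using emeasure_resolvent_measurable[OF that] by (intro measurable_completion) (simp add: measurable_cong_sets[OF \<mu> refl])
  then show ?thesis using A by (subst emeasure_kernel_comp) (simp_all add: U_indicator[OF A, abs_def])
qed

lemma hitting_op_one_le_1: 
  assumes "0 < \<beta>"
  shows "hitting_op X P \<beta> M (\<lambda>_. 1) x \<le> 1"
proof -
  have "hitting_op X P \<beta> M (\<lambda>_. 1) x \<le> (\<integral>\<^sup>+\<omega>. 1 \<partial>P x)"
    unfolding hitting_op_def
  proof (rule nn_integral_mono)
    fix \<omega>
    have "0 \<le> real_of_ereal (hitting_time X M \<omega>)"
      using hitting_time_nonneg by (rule real_of_ereal_pos)
    then show "(if hitting_time X M \<omega> < \<infinity> then let T = real_of_ereal (hitting_time X M \<omega>)
        in ennreal (exp (- \<beta> * T)) * 1 else 0) \<le> 1"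
      using assms by (simp add: Let_def ennreal_le_1)
  qed
  then show ?thesis using P.emeasure_space_1[of x] by simp
qed

text \<open>The regular points are those with \<open>emeasure (N y) UNIV = 1\<close>, a universally
  measurable condition. The exceptional set is covered by a Borel set of irregular points, never
  charged by the hitting distribution, and a null set.\<close>

lemma balayage_carried_by_fine_closure:
  assumes \<beta>: "0 < \<beta>" and M: "M \<in> sets borel" and N: "balayage_kernel \<nu> X P \<beta> M N"
    and \<mu>: "sets \<mu> = sets borel" "sigma_finite_measure \<mu>"
  shows "AE x in kernel_comp borel \<mu> N. x \<in> fine_topology \<nu> \<beta> closure_of M"
proof -
  have N_sets: "\<And>x. sets (N x) = sets borel"
    and N_univ: "\<And>A. A \<in> sets borel \<Longrightarrow> (\<lambda>x. emeasure (N x) A) \<in> borel_measurable (universal_completion borel)"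
    and N_hit: "\<And>f. f \<in> borel_measurable borel \<Longrightarrow> kernel_op N f = hitting_op X P \<beta> M f"
    using N by (auto simp: balayage_kernel_def is_kernel_def)
  have N_op: "emeasure (N x) A = hitting_op X P \<beta> M (indicator A) x" if A: "A \<in> sets borel" for x A
  proof -
    have "hitting_op X P \<beta> M (indicator A) x = kernel_op N (indicator A) x"
      using A by (subst N_hit) auto
    then show ?thesis using A N_sets by (simp add: kernel_op_def)
  qed
  have N_UNIV: "emeasure (N x) UNIV = hitting_op X P \<beta> M (\<lambda>_. 1) x" for x
  proof -
    have "hitting_op X P \<beta> M (\<lambda>_. 1) x = kernel_op N (\<lambda>_. 1) x" by (subst N_hit) auto
    then show ?thesis using sets_eq_imp_space_eq[OF N_sets[of x]] by (simp add: kernel_op_def)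
  qed
  have comp: "emeasure (kernel_comp borel \<rho> N) A = (\<integral>\<^sup>+x. emeasure (N x) A \<partial>\<rho>)"
    if "sigma_finite_measure \<rho>" "sets \<rho> = sets borel" "A \<in> sets borel" for \<rho> A
    by (rule emeasure_kernel_comp[OF N_sets universally_measurable[OF that(1,2) N_univ] that(3)])
  obtain h where h: "h \<in> borel_measurable \<mu>" "finite_measure (density \<mu> h)"
    "\<And>x. x \<in> space \<mu> \<Longrightarrow> 0 < h x"
    using equivalent_finite_density[OF \<mu>(2)] by blast
  let ?d = "density \<mu> h"
  interpret d: finite_measure ?d by (rule h(2))
  have d: "sigma_finite_measure ?d" "sets ?d = sets borel"
    using \<mu>(1) d.sigma_finite_measure_axioms by simp_all
  \<comment> \<open>Universal measurability is used for a sigma-finite measure, which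
    \<open>kernel_comp borel \<mu> N\<close> may fail to be. From the finite \<open>?d\<close>, the
    sub-Markov kernel \<open>N\<close> produces a finite measure.\<close>
  let ?\<kappa> = "kernel_comp borel ?d N"
  have sp: "space ?\<kappa> = UNIV" using sets_eq_imp_space_eq[of ?\<kappa> borel] by simp
  have "emeasure ?\<kappa> UNIV \<le> (\<integral>\<^sup>+x. 1 \<partial>?d)"
    unfolding comp[OF d borel_open[OF open_UNIV]] N_UNIV
    by (intro nn_integral_mono hitting_op_one_le_1 \<beta>)
  also have "\<dots> < \<infinity>" using d.emeasure_finite[of "space ?d"] by (simp add: less_top[symmetric])
  finally have fin: "finite_measure ?\<kappa>" by (intro finite_measureI) (simp add: sp)
  define W where "W = {y. emeasure (N y) UNIV < 1} - M"
  have "W \<in> sets (completion ?\<kappa>)"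
  proof -
    have sf: "sigma_finite_measure ?\<kappa>"
      using fin by (simp add: finite_measure_def)
    have "(\<lambda>x. emeasure (N x) UNIV) \<in> borel_measurable (completion ?\<kappa>)"
      by (rule universally_measurable[OF sf sets_kernel_comp N_univ]) simp
    then have "{y \<in> space (completion ?\<kappa>). emeasure (N y) UNIV < 1} \<in> sets (completion ?\<kappa>)"
      by measurable
    then show ?thesis using M unfolding W_def by (auto simp: sp)
  qed
  then obtain S R R' where W: "W = S \<union> R" "R \<subseteq> R'" "R' \<in> null_sets ?\<kappa>" "S \<in> sets ?\<kappa>"
    by (rule sets_completionE)
  have S: "S \<in> sets borel" "S \<subseteq> W" and R': "R' \<in> sets borel" using W by auto
  have "emeasure (N x) S = 0" for x
    unfolding N_op[OF S(1)]
  proof (rule not_hit_irregular_outside[OF M S(1)])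
    show "S \<inter> M = {}" using S(2) by (auto simp: W_def)
    show "hitting_op X P \<beta> M (\<lambda>_. 1) y < 1" if "y \<in> S" for y
      using that S(2) by (auto simp: W_def N_UNIV[symmetric])
  qed
  then have "S \<in> null_sets (kernel_comp borel \<mu> N)"
    using comp[OF \<mu>(2,1) S(1)] S(1) by (simp add: null_sets_def)
  moreover have "R' \<in> null_sets (kernel_comp borel \<mu> N)"
  proof -
    \<comment> \<open>\<open>R'\<close> is null for \<open>?\<kappa>\<close>; since
      \<open>h > 0\<close>, the vanishing of \<open>emeasure (N x) R'\<close> passes from
      \<open>?d\<close>-almost every to \<open>\<mu>\<close>-almost every \<open>x\<close>.\<close>
    have "(\<integral>\<^sup>+x. emeasure (N x) R' \<partial>completion ?d) = 0"
      using W(3) comp[OF d R'] by (simp add: nn_integral_completion null_sets_def)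
    then have "AE x in completion ?d. emeasure (N x) R' = 0"
      using universally_measurable[OF d N_univ[OF R']] by (simp add: nn_integral_0_iff_AE)
    then have "AE x in \<mu>. 0 < h x \<longrightarrow> emeasure (N x) R' = 0"
      using h(1) by (simp add: AE_completion_iff AE_density)
    then have "AE x in \<mu>. emeasure (N x) R' = 0"
      using AE_space by eventually_elim (use h(3) in blast)
    then have "(\<integral>\<^sup>+x. emeasure (N x) R' \<partial>\<mu>) = (\<integral>\<^sup>+x. 0 \<partial>\<mu>)" by (rule nn_integral_cong_AE)
    then show ?thesis using comp[OF \<mu>(2,1) R'] R' by (simp add: null_sets_def)
  qed
  ultimately have "S \<union> R' \<in> null_sets (kernel_comp borel \<mu> N)" by (rule null_sets.Un)
  moreover have "y \<in> fine_topology \<nu> \<beta> closure_of M" if y: "y \<notin> S \<union> R'" for y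
  proof (cases "y \<in> M")
    case True
    then show ?thesis by (auto simp: in_closure_of topspace_fine_topology)
  next
    case False
    then have "1 \<le> hitting_op X P \<beta> M (\<lambda>_. 1) y"
      using y W by (auto simp: W_def N_UNIV not_less)
    then show ?thesis
      by (intro fine_closure_if_regular[OF \<beta>] regular_if_hitting_op_ge_1[OF M \<beta>])
  qed
  ultimately show ?thesis by (intro AE_I'[of "S \<union> R'"]) auto
qed

text \<open>Fubini moves the resolvent onto the indicator, so \<open>N\<close> acts on a bounded
  potential. Such a potential is excessive, and there \<open>N\<close> is given by
  \<open>balayage\<close>.\<close>

lemma emeasure_balayage_comp_resolvent:
  assumes \<beta>: "0 < \<beta>" and N: "balayage_kernel \<nu> X P \<beta> M N"
    and \<mu>: "sets \<mu> = sets borel" "sigma_finite_measure \<mu>" and A: "A \<in> sets borel"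
  shows "emeasure (kernel_comp borel (kernel_comp borel \<mu> N) (resolvent \<nu> \<beta>)) A =
    (\<integral>\<^sup>+x. balayage \<nu> \<beta> M (U \<beta> (indicator A)) x \<partial>\<mu>)"
proof -
  let ?p = "U \<beta> (indicator A)"
  have N_sets: "\<And>x. sets (N x) = sets borel"
    and N_univ: "\<And>A. A \<in> sets borel \<Longrightarrow> (\<lambda>x. emeasure (N x) A) \<in> borel_measurable (universal_completion borel)"
    and N_bal: "\<And>v. excessive \<nu> \<beta> v \<Longrightarrow> kernel_op N v = balayage \<nu> \<beta> M v"
    using N by (auto simp: balayage_kernel_def is_kernel_def)
  have p: "?p \<in> borel_measurable borel" "excessive \<nu> \<beta> ?p"
    using A by (auto intro!: excessive_U[OF _ _ \<beta>] split: split_indicator)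
  have "emeasure (kernel_comp borel (kernel_comp borel \<mu> N) (resolvent \<nu> \<beta>)) A =
      (\<integral>\<^sup>+x. ?p x \<partial>kernel_comp borel \<mu> N)"
    by (rule emeasure_comp_resolvent[OF sets_kernel_comp A])
  also have "\<dots> = (\<integral>\<^sup>+x. kernel_op N ?p x \<partial>\<mu>)"
    unfolding kernel_op_def[of N]
    by (intro nn_integral_kernel_comp N_sets p(1) universally_measurable[OF \<mu>(2,1)] N_univ)
  finally show ?thesis by (simp add: N_bal[OF p(2)])
qed

end

theorem proposition4p14:
  fixes \<iota> :: "'h::{real_inner, complete_space, second_countable_topology} \<Rightarrow>
              'e::{banach, second_countable_topology}"
    and \<nu> :: "real \<Rightarrow> 'e measure"
    and F :: "'w measure" and Ft :: "real \<Rightarrow> 'w measure"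
    and X :: "real \<Rightarrow> 'w \<Rightarrow> 'e" and \<theta> :: "real \<Rightarrow> 'w \<Rightarrow> 'w" and P :: "'e \<Rightarrow> 'w measure"
    and \<beta> :: real and M :: "'e set" and N :: "'e \<Rightarrow> 'e measure" and \<mu> :: "'e measure"
  assumes "bounded_linear \<iota>" and "inj \<iota>" and "closure (range \<iota>) = UNIV"
    and "convolution_semigroup \<nu>"
    and "right_process \<nu> F Ft X \<theta> P"
    and "\<beta> > 0"
    and "M \<in> sets borel"
    and "balayage_kernel \<nu> X P \<beta> M N"
    and "sets \<mu> = sets borel" and "sigma_finite_measure \<mu>"
  defines "\<mu>\<^sub>M \<equiv> kernel_comp borel \<mu> N"
  shows "(AE x in \<mu>\<^sub>M. x \<in> fine_topology \<nu> \<beta> closure_of M) \<and>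
         (\<forall>A\<in>sets borel. emeasure (kernel_comp borel \<mu>\<^sub>M (resolvent \<nu> \<beta>)) A
                        \<le> emeasure (kernel_comp borel \<mu> (resolvent \<nu> \<beta>)) A) \<and>
         (\<forall>A\<in>sets borel. A \<subseteq> M \<longrightarrow>
            emeasure (kernel_comp borel \<mu>\<^sub>M (resolvent \<nu> \<beta>)) A
              = emeasure (kernel_comp borel \<mu> (resolvent \<nu> \<beta>)) A)"
proof -
  interpret convolution_process \<nu> F Ft X \<theta> P
    using assms(4,5) by (simp add: convolution_process_def convolution_process_axioms_def)
  have p: "excessive \<nu> \<beta> (U \<beta> (indicator A))" if "A \<in> sets borel" for A
    using that by (intro excessive_U \<open>0 < \<beta>\<close>) (auto split: split_indicator)
  have "emeasure (kernel_comp borel \<mu>\<^sub>M (resolvent \<nu> \<beta>)) A \<le> emeasure (kernel_comp borel \<mu> (resolvent \<nu> \<beta>)) A"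
    if "A \<in> sets borel" for A
    unfolding \<mu>\<^sub>M_def emeasure_balayage_comp_resolvent[OF assms(6,8-10) that]
      emeasure_comp_resolvent[OF assms(9) that]
    by (intro nn_integral_mono balayage_le p that)
  moreover have "emeasure (kernel_comp borel \<mu>\<^sub>M (resolvent \<nu> \<beta>)) A = emeasure (kernel_comp borel \<mu> (resolvent \<nu> \<beta>)) A"
    if "A \<in> sets borel" "A \<subseteq> M" for A
    unfolding \<mu>\<^sub>M_def emeasure_balayage_comp_resolvent[OF assms(6,8-10) that(1)]
      emeasure_comp_resolvent[OF assms(9) that(1)] balayage_potential_eq[OF assms(6) that] ..
  moreover have "AE x in \<mu>\<^sub>M. x \<in> fine_topology \<nu> \<beta> closure_of M"
    unfolding \<mu>\<^sub>M_def by (rule balayage_carried_by_fine_closure[OF assms(6-10)])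
  ultimately show ?thesis by blast
qed

end
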